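(* Let $\mathbb{K}$ be a field of characteristic $0$, let $I$ be a curved Lie ideal of a curved DG-algebra $(A,d,R)$ over $\mathbb{K}$, let $B$ denote the quotient DG-Lie algebra $A/I$ and let $\pi\colon A\to B$ be the projection. Let $k\ge0$ be an integer. Then, for every morphism of graded vector spaces $s\colon B\to A$ such that $\pi s=\operatorname{Id}_B$, the image of $W(s)^{k+1}\in \operatorname{Hom}^{2k+1}_{\mathbb{K}}(S(B[1]),A)$ onto \[ \operatorname{Hom}^{2k+1}_{\mathbb{K}}\left(S(B[1]),\frac{A}{[A,A]+I^{(k+1)}A}\right)=\operatorname{Hom}^0_{\mathbb{K}}\left(S(B[1]),\frac{A}{[A,A]+I^{(k+1)}A}[2k+1]\right)\] is an $L_\infty$ morphism \[\sigma^k=(\sigma^k_1,\sigma^k_2,\ldots,\sigma^k_{2k+1},0,0,\ldots)\colon B\rightsquigarrow \frac{A}{[A,A]+I^{(k+1)}A}[2k]\] with all Taylor coefficients of degree $\ge 2k+2$ vanishing and with linear Taylor coefficient \[\sigma^k_1\colon B\to \frac{A}{[A,A]+I^{(k+1)}A}[2k],\qquad \sigma_1^k(x)=\frac{1}{k!}\operatorname{tr}(R^kx).\]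
   Context: Graded algebras are graded associative algebras with unit over $\mathbb{K}$; $[a,b]=ab-(-1)^{|a||b|}ba$ is the graded commutator. A curved DG-algebra $(A,d,R)$ is a graded algebra $A$ with a degree one derivation $d$ and an element $R\in A^2$ (the curvature) such that $d(R)=0$ and $d^2(x)=[R,x]$ for all $x\in A$. A curved Lie ideal of $A$ is a homogeneous Lie ideal $I\subset A$ such that $d(I)\subset I$ and $R\in I$. $[A,A]$ is the linear span of all graded commutators; $\operatorname{tr}$ denotes the projection $A\to A/[A,A]$ (composed with further quotients). For a subspace $E\subset A$, $E^{(k)}$ ($k\ge1$) is the linear span of the products $e_1\cdots e_k$, $e_i\in E$, and $EA$ is the linear span of the products $ea$. The complex $\frac{A}{[A,A]+I^{(k+1)}A}[2k]$ (with $V[n]^i=V^{n+i}$) is a DG-Lie algebra with trivial bracket. In the formula for $\sigma^k_1$, $x$ is replaced by any lifting to $A$. For a DG-Lie algebra $(L,\bar\partial,[-,-])$, write $|x|$ for the degree of $x$ in $L$. $S(L[1])$ is the symmetric coalgebra with unshuffle coproduct $\Delta$ and coderivation $Q=Q_0+Q_1$, $Q_0(1)=Q_1(1)=0$, $Q_0(x_1\odot\cdots\odot x_n)=\sum_{i}(-1)^{i+|x_1|+\cdots+|x_{i-1}|}x_1\odot\cdots\odot\bar\partial x_i\odot\cdots\odot x_n$, $Q_1(x_1\odot\cdots\odot x_n)=\sum_{\tau\in S(2,n-2)}\varepsilon(\tau)(-1)^{|x_{\tau(1)}|}[x_{\tau(1)},x_{\tau(2)}]\odot x_{\tau(3)}\odot\cdots\odot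 x_{\tau(n)}$, where $S(i,n-i)$ denotes $(i,n-i)$-unshuffles and $\varepsilon(\tau)$ the symmetric Koszul sign in $L[1]^{\odot n}$. Let $\mathbf{C}(L,A)=\bigoplus_{i\ge0}\operatorname{Hom}^*_{\mathbb{K}}(L[1]^{\odot i},A)\subset\operatorname{Hom}^*_{\mathbb{K}}(S(L[1]),A)$, with convolution product $f\star g=m(f\otimes g)\Delta$ ($m$ the product of $A$), i.e. for $f$ with $i$ and $g$ with $j$ arguments, $(f\star g)(x_1,\ldots,x_{i+j})=\sum_{\tau\in S(i,j)}\varepsilon(\tau)(-1)^{|g|(|x_{\tau(1)}|+\cdots+|x_{\tau(i)}|-i)}f(x_{\tau(1)},\ldots,x_{\tau(i)})g(x_{\tau(i+1)},\ldots,x_{\tau(i+j)})$, and degree one derivation $\delta(f)=df-(-1)^{|f|}fQ$. $R$ is regarded as an element of $\operatorname{Hom}^2_{\mathbb{K}}(L[1]^{\odot 0},A)=A^2$. A morphism of graded vector spaces $s\colon L\to A$ is regarded as a degree $1$ element of $\operatorname{Hom}^*_{\mathbb{K}}(L[1],A)\subset\mathbf{C}(L,A)$, and \[ W(s)^{k+1}=\frac{1}{k!}\int_0^1(R+t\,\delta(s)+t^2\,s\star s)^k\star s\,dt\in\mathbf{C}(L,A)^{2k+1},\] where powers are taken with respect to $\star$, $t$ is a central variable of degree $0$ and the integral is the formal one, $\int_0^1t^n\,dt=\frac1{n+1}$. In the claim these are used with $L=B$. An $L_\infty$ morphism $f\colon L\rightsquigarrow M$ into a DG-Lie algebra $(M,d_M,0)$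 with trivial bracket is (via corestriction of DG-coalgebra morphisms $S(L[1])\to S(M[1])$) a degree $0$ linear map $f\colon S(L[1])\to M[1]$ with $f(1)=0$ and $-d_Mf=fQ$. Its Taylor coefficients are the restrictions $f_i\colon L[1]^{\odot i}\to M[1]$, and $f_1$ is viewed as a map $L\to M$. *)

theory Defs
  imports
    Complex_Main
    "HOL-Combinatorics.Permutations"
    "HOL-Library.Set_Algebras"
begin

section \<open>Graded vector spaces, complexes and DG-Lie algebras\<close>

text \<open>
  A graded vector space is a family of vector spaces indexed by the integers. All of
  its pieces live in one type and share their operations and their zero, but only
  homogeneous elements carry meaning; a graded linear map is determined by its values on
  them. Accordingly a bilinear operation whose sign rule depends on degrees, such as the
  bracket, takes the degrees of its arguments as additional arguments. This avoids
  speaking of the degree of the zero vector.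
\<close>

record ('k, 'v) gvs =
  gpart :: "int \<Rightarrow> 'v set"
  gzero :: 'v
  gadd :: "'v \<Rightarrow> 'v \<Rightarrow> 'v"
  gsmult :: "'k \<Rightarrow> 'v \<Rightarrow> 'v"

record ('k, 'v) dgvs = "('k, 'v) gvs" +
  gdiff :: "'v \<Rightarrow> 'v"

record ('k, 'v) dgla = "('k, 'v) dgvs" +
  gbracket :: "int \<Rightarrow> int \<Rightarrow> 'v \<Rightarrow> 'v \<Rightarrow> 'v"

definition graded_vector_space :: "('k::field, 'v, 'z) gvs_scheme \<Rightarrow> bool" where
  "graded_vector_space V \<longleftrightarrow> (\<forall>n.
     gzero V \<in> gpart V n \<and>
     (\<forall>x\<in>gpart V n. \<forall>y\<in>gpart V n. gadd V x y \<in> gpart V n \<and> gadd V x y = gadd V y x) \<and>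
     (\<forall>x\<in>gpart V n. \<forall>y\<in>gpart V n. \<forall>z\<in>gpart V n.
        gadd V (gadd V x y) z = gadd V x (gadd V y z)) \<and>
     (\<forall>x\<in>gpart V n. gadd V (gzero V) x = x \<and> gadd V (gsmult V (-1) x) x = gzero V) \<and>
     (\<forall>c. \<forall>x\<in>gpart V n. gsmult V c x \<in> gpart V n) \<and>
     (\<forall>c. \<forall>x\<in>gpart V n. \<forall>y\<in>gpart V n.
        gsmult V c (gadd V x y) = gadd V (gsmult V c x) (gsmult V c y)) \<and>
     (\<forall>b c. \<forall>x\<in>gpart V n.
        gsmult V (b + c) x = gadd V (gsmult V b x) (gsmult V c x) \<and>
        gsmult V (b * c) x = gsmult V b (gsmult V c x)) \<and>
     (\<forall>x\<in>gpart V n. gsmult V 1 x = x))"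

definition graded_linear ::
  "int \<Rightarrow> ('k, 'v, 'y) gvs_scheme \<Rightarrow> ('k, 'w, 'z) gvs_scheme \<Rightarrow> ('v \<Rightarrow> 'w) \<Rightarrow> bool" where
  "graded_linear p V W h \<longleftrightarrow> (\<forall>n.
     (\<forall>x\<in>gpart V n. h x \<in> gpart W (n + p)) \<and>
     (\<forall>x\<in>gpart V n. \<forall>y\<in>gpart V n. h (gadd V x y) = gadd W (h x) (h y)) \<and>
     (\<forall>c. \<forall>x\<in>gpart V n. h (gsmult V c x) = gsmult W c (h x)))"

definition is_complex :: "('k::field, 'v, 'z) dgvs_scheme \<Rightarrow> bool" where
  "is_complex V \<longleftrightarrow> graded_vector_space V \<and> graded_linear 1 V V (gdiff V) \<and>
     (\<forall>n. \<forall>x\<in>gpart V n. gdiff V (gdiff V x) = gzero V)"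

definition is_dgla :: "('k::field, 'v, 'z) dgla_scheme \<Rightarrow> bool" where
  "is_dgla L \<longleftrightarrow> is_complex L \<and>
     (\<forall>i j. \<forall>x\<in>gpart L i. \<forall>y\<in>gpart L j.
        gbracket L i j x y \<in> gpart L (i + j) \<and>
        (\<forall>x'\<in>gpart L i. gbracket L i j (gadd L x x') y =
           gadd L (gbracket L i j x y) (gbracket L i j x' y)) \<and>
        (\<forall>y'\<in>gpart L j. gbracket L i j x (gadd L y y') =
           gadd L (gbracket L i j x y) (gbracket L i j x y')) \<and>
        (\<forall>c. gbracket L i j (gsmult L c x) y = gsmult L c (gbracket L i j x y) \<and>
             gbracket L i j x (gsmult L c y) = gsmult L c (gbracket L i j x y))) \<and>
     (\<forall>i j. \<forall>x\<in>gpart L i. \<forall>y\<in>gpart L j.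
        gbracket L i j x y = gsmult L (- ((-1) powi (i * j))) (gbracket L j i y x)) \<and>
     (\<forall>i j l. \<forall>x\<in>gpart L i. \<forall>y\<in>gpart L j. \<forall>z\<in>gpart L l.
        gbracket L i (j + l) x (gbracket L j l y z) =
          gadd L (gbracket L (i + j) l (gbracket L i j x y) z)
            (gsmult L ((-1) powi (i * j)) (gbracket L j (i + l) y (gbracket L i l x z)))) \<and>
     (\<forall>i j. \<forall>x\<in>gpart L i. \<forall>y\<in>gpart L j.
        gdiff L (gbracket L i j x y) =
          gadd L (gbracket L (i + 1) j (gdiff L x) y)
            (gsmult L ((-1) powi i) (gbracket L i (j + 1) x (gdiff L y))))"

definition abelian_dgla :: "('k, 'v) dgvs \<Rightarrow> ('k, 'v) dgla" where
  "abelian_dgla V = dgvs.extend V (dgla.fields (\<lambda>_ _ _ _. gzero V))"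

definition shift_gvs :: "int \<Rightarrow> ('k, 'v, 'z) gvs_scheme \<Rightarrow> ('k, 'v, 'z) gvs_scheme" where
  "shift_gvs n V = V\<lparr>gpart := \<lambda>i. gpart V (n + i)\<rparr>"

definition shift_complex ::
  "int \<Rightarrow> ('k::field, 'v, 'z) dgvs_scheme \<Rightarrow> ('k, 'v, 'z) dgvs_scheme" where
  "shift_complex n V = (shift_gvs n V)\<lparr>gdiff := \<lambda>x. gsmult V ((-1) powi n) (gdiff V x)\<rparr>"

text \<open>
  The sum of a finite family in one graded piece. There addition is associative and
  commutative, so the fold does not depend on the order.
\<close>

definition gsum :: "('k, 'v, 'z) gvs_scheme \<Rightarrow> ('i \<Rightarrow> 'v) \<Rightarrow> 'i set \<Rightarrow> 'v" where
  "gsum V h S = Finite_Set.fold (\<lambda>i. gadd V (h i)) (gzero V) S"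


section \<open>The symmetric coalgebra of a shifted DG-Lie algebra\<close>

text \<open>
  A word \<open>[(n\<^sub>1, x\<^sub>1), \<dots>, (n\<^sub>i, x\<^sub>i)]\<close> with \<open>x\<^sub>j\<close> of degree \<open>n\<^sub>j\<close> in \<open>L\<close> stands
  for the generator \<open>x\<^sub>1 \<odot> \<dots> \<odot> x\<^sub>i\<close> of \<open>S(L[1])\<close>, the empty word for 1. A linear map
  on \<open>S(L[1])\<close> is a function on words which on the words of each length is multilinear and
  graded symmetric for the degrees in \<open>L[1]\<close> (universal property of the symmetric powers).
  The restriction to words of length \<open>i\<close> is the component on the \<open>i\<close>-th symmetric power.
\<close>

type_synonym 'l word = "(int \<times> 'l) list"

definition words :: "('k, 'l, 'z) gvs_scheme \<Rightarrow> 'l word set" where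
  "words L = {xs. \<forall>(n, x)\<in>set xs. x \<in> gpart L n}"

definition wdeg :: "'l word \<Rightarrow> int" where
  "wdeg xs = (\<Sum>(n, x)\<leftarrow>xs. n - 1)"

definition Hom_S ::
  "int \<Rightarrow> ('k::field, 'l, 'y) gvs_scheme \<Rightarrow> ('k, 'v, 'z) gvs_scheme \<Rightarrow> ('l word \<Rightarrow> 'v) set" where
  "Hom_S p L V = {f.
     (\<forall>xs\<in>words L. f xs \<in> gpart V (p + wdeg xs)) \<and>
     (\<forall>us\<in>words L. \<forall>vs\<in>words L. \<forall>n. \<forall>x\<in>gpart L n. \<forall>y\<in>gpart L n.
        f (us @ (n, gadd L x y) # vs) = gadd V (f (us @ (n, x) # vs)) (f (us @ (n, y) # vs))) \<and>
     (\<forall>us\<in>words L. \<forall>vs\<in>words L. \<forall>n c. \<forall>x\<in>gpart L n.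
        f (us @ (n, gsmult L c x) # vs) = gsmult V c (f (us @ (n, x) # vs))) \<and>
     (\<forall>us\<in>words L. \<forall>vs\<in>words L. \<forall>n m. \<forall>x\<in>gpart L n. \<forall>y\<in>gpart L m.
        f (us @ (n, x) # (m, y) # vs) =
          gsmult V ((-1) powi ((n - 1) * (m - 1))) (f (us @ (m, y) # (n, x) # vs)))}"

text \<open>Permutations act on the positions \<open>0, \<dots>, n - 1\<close>.\<close>

definition unshuffles :: "nat \<Rightarrow> nat \<Rightarrow> (nat \<Rightarrow> nat) set" where
  "unshuffles i n = {\<tau>. i \<le> n \<and> \<tau> permutes {..<n} \<and>
     strict_mono_on {..<i} \<tau> \<and> strict_mono_on {i..<n} \<tau>}"

definition koszul :: "(nat \<Rightarrow> nat) \<Rightarrow> 'l word \<Rightarrow> 'k::field" where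
  "koszul \<tau> xs = (\<Prod>(i, j)\<in>{(i, j). i < j \<and> j < length xs \<and> \<tau> j < \<tau> i}.
     (-1) powi ((fst (xs ! \<tau> i) - 1) * (fst (xs ! \<tau> j) - 1)))"

text \<open>
  The composite \<open>f Q\<close> of a linear map \<open>f\<close> on \<open>S(L[1])\<close> with the coderivation \<open>Q = Q\<^sub>0 + Q\<^sub>1\<close>.
  The exponent \<open>int i + 1\<close> accounts for positions being counted from 0.
\<close>

definition comp_Q0 ::
  "('k::field, 'l, 'y) dgla_scheme \<Rightarrow> ('k, 'v, 'z) gvs_scheme \<Rightarrow> ('l word \<Rightarrow> 'v) \<Rightarrow> 'l word \<Rightarrow> 'v" where
  "comp_Q0 L V f xs = gsum V (\<lambda>i. gsmult V ((-1) powi (int i + 1 + (\<Sum>j<i. fst (xs ! j))))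
     (f (xs[i := (fst (xs ! i) + 1, gdiff L (snd (xs ! i)))]))) {..<length xs}"

definition comp_Q1 ::
  "('k::field, 'l, 'y) dgla_scheme \<Rightarrow> ('k, 'v, 'z) gvs_scheme \<Rightarrow> ('l word \<Rightarrow> 'v) \<Rightarrow> 'l word \<Rightarrow> 'v" where
  "comp_Q1 L V f xs = gsum V (\<lambda>\<tau>.
     let ys = permute_list \<tau> xs; (m, x) = ys ! 0; (n, y) = ys ! 1
     in gsmult V (koszul \<tau> xs * (-1) powi m) (f ((m + n, gbracket L m n x y) # drop 2 ys)))
     (unshuffles 2 (length xs))"

definition comp_Q ::
  "('k::field, 'l, 'y) dgla_scheme \<Rightarrow> ('k, 'v, 'z) gvs_scheme \<Rightarrow> ('l word \<Rightarrow> 'v) \<Rightarrow> 'l word \<Rightarrow> 'v" where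
  "comp_Q L V f xs = gadd V (comp_Q0 L V f xs) (comp_Q1 L V f xs)"

text \<open>
  \<open>L\<^sub>\<infinity>\<close> morphisms into a DG-Lie algebra with trivial bracket, given by their corestrictions.
  The \<open>i\<close>-th Taylor coefficient is the restriction to words of length \<open>i\<close>.
\<close>

definition Linf_morphism_abelian ::
  "('k::field, 'l, 'y) dgla_scheme \<Rightarrow> ('k, 'm, 'z) dgla_scheme \<Rightarrow> ('l word \<Rightarrow> 'm) \<Rightarrow> bool" where
  "Linf_morphism_abelian L M f \<longleftrightarrow> is_dgla L \<and> is_dgla M \<and>
     (\<forall>i j. \<forall>x\<in>gpart M i. \<forall>y\<in>gpart M j. gbracket M i j x y = gzero M) \<and>
     f \<in> Hom_S 0 L (shift_gvs 1 M) \<and> f [] = gzero M \<and>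
     (\<forall>xs\<in>words L. gsmult M (-1) (gdiff M (f xs)) = comp_Q L M f xs)"


section \<open>Curved DG-algebras and their curved Lie ideals\<close>

text \<open>
  The product and the unit are those of the carrier type. The sort \<open>{ring, monoid_mult}\<close>
  rather than \<open>ring_1\<close> is used for it in order to admit the zero algebra.
\<close>

record ('k, 'a) cdga =
  scal :: "'k \<Rightarrow> 'a \<Rightarrow> 'a"
  gr :: "int \<Rightarrow> 'a set"
  der :: "'a \<Rightarrow> 'a"
  curv :: 'a

definition gvs_of :: "('k, 'a::{ring, monoid_mult}) cdga \<Rightarrow> ('k, 'a) gvs" where
  "gvs_of A = \<lparr>gpart = gr A, gzero = 0, gadd = (+), gsmult = scal A\<rparr>"

abbreviation spanA :: "('k::field, 'a::{ring, monoid_mult}) cdga \<Rightarrow> 'a set \<Rightarrow> 'a set" where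
  "spanA A \<equiv> module.span (scal A)"

definition gcomm :: "('k::field, 'a::{ring, monoid_mult}) cdga \<Rightarrow> int \<Rightarrow> int \<Rightarrow> 'a \<Rightarrow> 'a \<Rightarrow> 'a" where
  "gcomm A i j a b = a * b - scal A ((-1) powi (i * j)) (b * a)"

definition graded_algebra :: "('k::field, 'a::{ring, monoid_mult}) cdga \<Rightarrow> bool" where
  "graded_algebra A \<longleftrightarrow>
     vector_space (scal A) \<and>
     (\<forall>c a b. scal A c (a * b) = scal A c a * b \<and> scal A c (a * b) = a * scal A c b) \<and>
     (\<forall>n. module.subspace (scal A) (gr A n)) \<and>
     spanA A (\<Union>n. gr A n) = UNIV \<and>
     (\<forall>J x. finite J \<and> (\<forall>n\<in>J. x n \<in> gr A n) \<and> (\<Sum>n\<in>J. x n) = 0 \<longrightarrow> (\<forall>n\<in>J. x n = 0)) \<and>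
     1 \<in> gr A 0 \<and>
     (\<forall>i j. \<forall>a\<in>gr A i. \<forall>b\<in>gr A j. a * b \<in> gr A (i + j))"

definition curved_dg_algebra :: "('k::field, 'a::{ring, monoid_mult}) cdga \<Rightarrow> bool" where
  "curved_dg_algebra A \<longleftrightarrow>
     graded_algebra A \<and>
     Vector_Spaces.linear (scal A) (scal A) (der A) \<and>
     (\<forall>n. \<forall>a\<in>gr A n. der A a \<in> gr A (n + 1)) \<and>
     (\<forall>n. \<forall>a\<in>gr A n. \<forall>b. der A (a * b) = der A a * b + scal A ((-1) powi n) (a * der A b)) \<and>
     curv A \<in> gr A 2 \<and>
     der A (curv A) = 0 \<and>
     (\<forall>n. \<forall>a\<in>gr A n. der A (der A a) = gcomm A 2 n (curv A) a)"

definition curved_Lie_ideal :: "('k::field, 'a::{ring, monoid_mult}) cdga \<Rightarrow> 'a set \<Rightarrow> bool" where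
  "curved_Lie_ideal A I \<longleftrightarrow>
     module.subspace (scal A) I \<and>
     I = spanA A (\<Union>n. I \<inter> gr A n) \<and>
     (\<forall>i j. \<forall>a\<in>gr A i. \<forall>x\<in>I \<inter> gr A j. gcomm A i j a x \<in> I) \<and>
     der A ` I \<subseteq> I \<and>
     curv A \<in> I"

definition commutators :: "('k::field, 'a::{ring, monoid_mult}) cdga \<Rightarrow> 'a set" where
  "commutators A = spanA A {gcomm A i j a b | i j a b. a \<in> gr A i \<and> b \<in> gr A j}"

definition subspace_power :: "('k::field, 'a::{ring, monoid_mult}) cdga \<Rightarrow> 'a set \<Rightarrow> nat \<Rightarrow> 'a set" where
  "subspace_power A E k = spanA A {prod_list es | es. length es = k \<and> set es \<subseteq> E}"

definition subspace_times_algebra :: "('k::field, 'a::{ring, monoid_mult}) cdga \<Rightarrow> 'a set \<Rightarrow> 'a set" where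
  "subspace_times_algebra A E = spanA A {e * a | e a. e \<in> E}"

text \<open>
  Quotients: the elements are the cosets \<open>a +o U\<close>. The operations are computed on
  arbitrary representatives (for the bracket, homogeneous ones); when they are well
  defined, the unions below are unions of equal cosets.
\<close>

definition quotient_complex ::
  "('k::field, 'a::{ring, monoid_mult}) cdga \<Rightarrow> 'a set \<Rightarrow> ('k, 'a set) dgvs" where
  "quotient_complex A U =
     \<lparr>gpart = \<lambda>n. (\<lambda>a. a +o U) ` gr A n,
      gzero = U,
      gadd = \<lambda>X Y. \<Union>x\<in>X. \<Union>y\<in>Y. (x + y) +o U,
      gsmult = \<lambda>c X. \<Union>x\<in>X. scal A c x +o U,
      gdiff = \<lambda>X. \<Union>x\<in>X. der A x +o U\<rparr>"

definition quotient_dgla ::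
  "('k::field, 'a::{ring, monoid_mult}) cdga \<Rightarrow> 'a set \<Rightarrow> ('k, 'a set) dgla" where
  "quotient_dgla A I = dgvs.extend (quotient_complex A I)
     (dgla.fields (\<lambda>i j X Y. \<Union>x\<in>X \<inter> gr A i. \<Union>y\<in>Y \<inter> gr A j. gcomm A i j x y +o I))"

definition trace_kernel :: "('k::field, 'a::{ring, monoid_mult}) cdga \<Rightarrow> 'a set \<Rightarrow> nat \<Rightarrow> 'a set" where
  "trace_kernel A I k = commutators A + subspace_times_algebra A (subspace_power A I (k + 1))"

definition trace_complex ::
  "('k::field, 'a::{ring, monoid_mult}) cdga \<Rightarrow> 'a set \<Rightarrow> nat \<Rightarrow> ('k, 'a set) dgla" where
  "trace_complex A I k =
     abelian_dgla (shift_complex (2 * int k) (quotient_complex A (trace_kernel A I k)))"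


section \<open>The convolution algebra and the Chern-Simons type cochains\<close>

text \<open>
  Elements of \<open>C(L, A)\<close> are functions on words. Signs depending on the degree of a
  cochain get that degree as an explicit argument: \<open>q\<close> is the degree of the right factor
  \<open>g\<close> in \<open>star A q f g\<close>, and \<open>p\<close> is the degree of \<open>f\<close> in \<open>delta A L p f\<close>.
\<close>

definition star ::
  "('k::field, 'a::{ring, monoid_mult}) cdga \<Rightarrow> int \<Rightarrow> ('l word \<Rightarrow> 'a) \<Rightarrow> ('l word \<Rightarrow> 'a) \<Rightarrow> 'l word \<Rightarrow> 'a" where
  "star A q f g xs = (\<Sum>i\<le>length xs. \<Sum>\<tau>\<in>unshuffles i (length xs).
     let ys = permute_list \<tau> xs
     in scal A (koszul \<tau> xs * (-1) powi (q * wdeg (take i ys))) (f (take i ys) * g (drop i ys)))"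

definition delta ::
  "('k::field, 'a::{ring, monoid_mult}) cdga \<Rightarrow> ('k, 'l, 'z) dgla_scheme \<Rightarrow> int \<Rightarrow> ('l word \<Rightarrow> 'a) \<Rightarrow> 'l word \<Rightarrow> 'a" where
  "delta A L p f xs = der A (f xs) - scal A ((-1) powi p) (comp_Q L (gvs_of A) f xs)"

definition const_cochain :: "'a::zero \<Rightarrow> 'l word \<Rightarrow> 'a" where
  "const_cochain a xs = (if xs = [] then a else 0)"

definition linear_cochain :: "('l \<Rightarrow> 'a::zero) \<Rightarrow> 'l word \<Rightarrow> 'a" where
  "linear_cochain s xs = (case xs of [(n, x)] \<Rightarrow> s x | _ \<Rightarrow> 0)"

text \<open>
  Polynomials in the central variable \<open>t\<close> of degree 0 with coefficients in \<open>C(L, A)\<close>, as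
  sequences of coefficients. The integral is applied only to sequences of finite support.
\<close>

definition star_t ::
  "('k::field, 'a::{ring, monoid_mult}) cdga \<Rightarrow> int \<Rightarrow>
   (nat \<Rightarrow> 'l word \<Rightarrow> 'a) \<Rightarrow> (nat \<Rightarrow> 'l word \<Rightarrow> 'a) \<Rightarrow> nat \<Rightarrow> 'l word \<Rightarrow> 'a" where
  "star_t A q P P' n xs = (\<Sum>i\<le>n. star A q (P i) (P' (n - i)) xs)"

definition const_t :: "('l word \<Rightarrow> 'a::zero) \<Rightarrow> nat \<Rightarrow> 'l word \<Rightarrow> 'a" where
  "const_t f n xs = (if n = 0 then f xs else 0)"

primrec power_t ::
  "('k::field, 'a::{ring, monoid_mult}) cdga \<Rightarrow> int \<Rightarrow> (nat \<Rightarrow> 'l word \<Rightarrow> 'a) \<Rightarrow> nat \<Rightarrow> nat \<Rightarrow> 'l word \<Rightarrow> 'a" where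
  "power_t A q P 0 = const_t (const_cochain 1)"
| "power_t A q P (Suc k) = star_t A q (power_t A q P k) P"

definition integral_t ::
  "('k::field, 'a::{ring, monoid_mult}) cdga \<Rightarrow> (nat \<Rightarrow> 'l word \<Rightarrow> 'a) \<Rightarrow> 'l word \<Rightarrow> 'a" where
  "integral_t A P xs = (\<Sum>n | P n xs \<noteq> 0. scal A (1 / of_nat (n + 1)) (P n xs))"

text \<open>The polynomial \<open>R + t \<delta>(s) + t\<^sup>2 s \<star> s\<close>.\<close>

definition curvature_t ::
  "('k::field, 'a::{ring, monoid_mult}) cdga \<Rightarrow> ('k, 'l, 'z) dgla_scheme \<Rightarrow> ('l \<Rightarrow> 'a) \<Rightarrow> nat \<Rightarrow> 'l word \<Rightarrow> 'a" where
  "curvature_t A L s n =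
     (if n = 0 then const_cochain (curv A)
      else if n = 1 then delta A L 1 (linear_cochain s)
      else if n = 2 then star A 1 (linear_cochain s) (linear_cochain s)
      else (\<lambda>_. 0))"

text \<open>\<open>W A L s k\<close> is \<open>W(s)\<^sup>k\<^sup>+\<^sup>1\<close>, a cochain of degree \<open>2k + 1\<close>.\<close>

definition W ::
  "('k::field_char_0, 'a::{ring, monoid_mult}) cdga \<Rightarrow> ('k, 'l, 'z) dgla_scheme \<Rightarrow> ('l \<Rightarrow> 'a) \<Rightarrow> nat \<Rightarrow> 'l word \<Rightarrow> 'a" where
  "W A L s k xs = scal A (1 / fact k)
     (integral_t A (star_t A 1 (power_t A 2 (curvature_t A L s) k) (const_t (linear_cochain s))) xs)"

end

theory Submission
  imports Defs "HOL-Computational_Algebra.Formal_Power_Series"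
begin

text \<open>
  Cochains with values in \<open>A\<close> form a curved DG-algebra with curvature \<open>R\<close>, product \<open>\<star>\<close> and
  derivation \<open>\<delta>\<close>. The polynomial \<open>F = R + t \<delta>(s) + t\<^sup>2 s \<star> s\<close> is the curvature of the deformed
  derivation \<open>\<delta> + t [s, -]\<close>, so it satisfies the Bianchi identity \<open>\<delta>(F) = t (F \<star> s - s \<star> F)\<close>.
  Hence \<open>\<delta>(F\<^sup>k \<star> s)\<close> equals \<open>F\<^sup>k \<star> (\<delta>(s) + 2 t s \<star> s) = F\<^sup>k \<star> \<partial>F/\<partial>t\<close> up to graded commutators, and
  \<open>(k + 1) F\<^sup>k \<star> \<partial>F/\<partial>t\<close> equals \<open>\<partial>(F\<^sup>k\<^sup>+\<^sup>1)/\<partial>t\<close> up to graded commutators. Integrating from 0 to 1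
  expresses \<open>\<delta>(W)\<close>, up to a factor and commutators, as \<open>F(1)\<^sup>k\<^sup>+\<^sup>1 - R\<^sup>k\<^sup>+\<^sup>1\<close>. The values of
  \<open>F(1) = R + \<delta>(s) + s \<star> s\<close> are \<open>R\<close> on the empty word, \<open>d(s x) - s(d x)\<close> on a letter and
  \<open>\<plusminus>(s [x, y] - [s x, s y])\<close> on a pair. They lie in \<open>I\<close> because \<open>s\<close> is a section of the projection
  onto the quotient \<open>A/I\<close>. So both powers have values in \<open>I\<^sup>(\<^sup>k\<^sup>+\<^sup>1\<^sup>)\<close>, and \<open>\<delta>(W)\<close> vanishes in the trace
  quotient (\<open>W_closed\<close>). This is the equation of an \<open>L\<^sub>\<infinity>\<close> morphism into an abelian target.

  Since \<open>F\<close> vanishes on words of three or more letters and \<open>s\<close> on words other than single letters,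
  \<open>F\<^sup>k \<star> s\<close> vanishes on words of more than \<open>2 k + 1\<close> letters (\<open>W_vanish\<close>). On a single letter only the
  value \<open>R\<close> of \<open>F\<close> at the empty word contributes (\<open>W_singleton\<close>). There the linear coefficient
  \<open>R\<^sup>k s(x)\<close> may be computed with any other lifting of \<open>x\<close>, because \<open>R\<^sup>k I\<close> is contained in \<open>I\<^sup>(\<^sup>k\<^sup>+\<^sup>1\<^sup>)\<close>.

  The sums over unshuffles are replaced by recursions on words. Inserting a first letter is a graded
  derivation of the product, which gives \<open>conv\<close>, and the transpose of the coderivation obeys a similar
  recursion, which gives \<open>Q_transpose\<close>. Associativity, graded commutativity up to commutators and the
  Leibniz rules then are inductions on words that only involve signs. The bridges to the definitions by
  unshuffles are \<open>star_eq_conv\<close> and \<open>comp_Q_eq_Q_transpose\<close>. Polynomials in \<open>t\<close> become cochains with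
  values in power series over \<open>A\<close>, to which the same product applies.
\<close>

unbundle fps_syntax

section \<open>Signs, words and additive subgroups\<close>

text \<open>
  Multiplication by \<open>(-1)\<^sup>n\<close>, for groups without a scalar action. A sign identity between such
  expressions is decided by distinguishing the parities of the degrees that occur.
\<close>
definition signed :: "int \<Rightarrow> 'b::ab_group_add \<Rightarrow> 'b" where
  "signed n a = (if even n then a else - a)"

lemma (in vector_space) scale_powi_minus_one: "scale ((-1) powi n) a = signed n a"
  by (simp add: signed_def power_int_minus_left)

lemma signed_0 [simp]: "signed n 0 = 0" by (simp add: signed_def)
lemma signed_add: "signed n (a + b) = signed n a + signed n b" by (simp add: signed_def)
lemma signed_minus: "signed n (a - b) = signed n a - signed n b" by (simp add: signed_def)
lemma signed_signed: "signed m (signed n a) = signed (m + n) a" by (simp add: signed_def)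
lemma signed_mult_left: "signed n a * b = signed n (a * b :: 'b::ring)" by (simp add: signed_def)
lemma signed_mult_right: "a * signed n b = signed n (a * b :: 'b::ring)" by (simp add: signed_def)
lemma signed_cong: "even (m - n) \<Longrightarrow> signed m a = signed n a" by (auto simp: signed_def)

lemma words_Nil [simp]: "[] \<in> words L" by (simp add: words_def)
lemma words_Cons: "x # w \<in> words L \<longleftrightarrow> snd x \<in> gpart L (fst x) \<and> w \<in> words L"
  by (auto simp: words_def)
lemma words_append: "u @ w \<in> words L \<longleftrightarrow> u \<in> words L \<and> w \<in> words L"
  by (auto simp: words_def)
lemma wdeg_Nil [simp]: "wdeg [] = 0" by (simp add: wdeg_def)
lemma wdeg_Cons: "wdeg (x # w) = fst x - 1 + wdeg w" by (simp add: wdeg_def case_prod_beta)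

text \<open>
  Additive subgroups are the closure condition in all inductions over the convolution product:
  graded pieces, ideals, commutators, polynomials of bounded degree, and 0.
\<close>
definition add_closed :: "'b::ab_group_add set \<Rightarrow> bool" where
  "add_closed Z \<longleftrightarrow> 0 \<in> Z \<and> (\<forall>a\<in>Z. \<forall>b\<in>Z. a - b \<in> Z)"

lemma add_closedD:
  assumes "add_closed Z"
  shows add_closed_zero: "0 \<in> Z"
    and add_closed_diff: "a \<in> Z \<Longrightarrow> b \<in> Z \<Longrightarrow> a - b \<in> Z"
    and add_closed_uminus: "a \<in> Z \<Longrightarrow> - a \<in> Z"
    and add_closed_add: "a \<in> Z \<Longrightarrow> b \<in> Z \<Longrightarrow> a + b \<in> Z"
    and add_closed_signed: "a \<in> Z \<Longrightarrow> signed n a \<in> Z"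
proof -
  show z: "0 \<in> Z" and d: "\<And>a b. a \<in> Z \<Longrightarrow> b \<in> Z \<Longrightarrow> a - b \<in> Z"
    using assms by (auto simp: add_closed_def)
  show u: "\<And>a. a \<in> Z \<Longrightarrow> - a \<in> Z" using d[OF z] by simp
  show "\<And>a b. a \<in> Z \<Longrightarrow> b \<in> Z \<Longrightarrow> a + b \<in> Z" using d[OF _ u] by simp
  show "a \<in> Z \<Longrightarrow> signed n a \<in> Z" using u by (simp add: signed_def)
qed

lemma add_closed_sum: "add_closed Z \<Longrightarrow> (\<And>i. i \<in> J \<Longrightarrow> h i \<in> Z) \<Longrightarrow> sum h J \<in> Z"
  by (induction J rule: infinite_finite_induct) (auto simp: add_closed_zero add_closed_add)

lemma additive_signed:
  fixes h :: "'b::ab_group_add \<Rightarrow> 'c::ab_group_add"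
  assumes "\<And>a b. h (a + b) = h a + h b"
  shows "h 0 = 0" and "h (- a) = - h a" and "h (signed n a) = signed n (h a)" and "h (a - b) = h a - h b"
proof -
  interpret additive h by standard (rule assms)
  show "h 0 = 0" "h (- a) = - h a" "h (signed n a) = signed n (h a)" "h (a - b) = h a - h b"
    by (simp_all add: zero minus diff signed_def)
qed

section \<open>Unshuffles and subsets of positions\<close>

lemma nths_eq_map_filter: "nths xs S = map ((!) xs) (filter (\<lambda>i. i \<in> S) [0..<length xs])"
proof -
  have "zip xs [0..<length xs] = map (\<lambda>i. (xs ! i, i)) [0..<length xs]"
    by (rule nth_equalityI) auto
  then show ?thesis by (simp add: nths_def filter_map o_def)
qed

text \<open>
  An unshuffle lists the positions of a subset in increasing order, followed by those of the
  complement in increasing order. It is therefore determined by the image of the first block.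
\<close>
lemma unshuffle_eq_filter:
  assumes "\<tau> \<in> unshuffles i n"
  shows "map \<tau> [0..<i] = filter (\<lambda>j. j \<in> \<tau> ` {..<i}) [0..<n]"
    and "map \<tau> [i..<n] = filter (\<lambda>j. j \<notin> \<tau> ` {..<i}) [0..<n]"
proof -
  have i: "i \<le> n" and p: "\<tau> permutes {..<n}" and m1: "strict_mono_on {..<i} \<tau>"
    and m2: "strict_mono_on {i..<n} \<tau>" using assms by (auto simp: unshuffles_def)
  have inj: "inj \<tau>" using p by (rule permutes_inj)
  have im: "\<tau> ` {..<n} = {..<n}" using p by (rule permutes_image)
  have s1: "sorted_wrt (<) (map \<tau> [0..<i])"
    using m1 by (auto simp: sorted_wrt_iff_nth_less strict_mono_on_def)
  have s2: "sorted_wrt (<) (map \<tau> [i..<n])"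
    using m2 by (auto simp: sorted_wrt_iff_nth_less strict_mono_on_def less_diff_conv add.commute)
  have f: "sorted_wrt (<) (filter P [0..<n])" for P
    by (rule sorted_wrt_filter) simp
  have e: "l = l'" if "sorted_wrt (<) l" "sorted_wrt (<) l'" "set l = set l'" for l l' :: "nat list"
    using that by (simp add: strict_sorted_equal)
  have "{x. x < n \<and> x \<in> \<tau> ` {..<i}} = \<tau> ` {0..<i}" using im i by force
  then show "map \<tau> [0..<i] = filter (\<lambda>j. j \<in> \<tau> ` {..<i}) [0..<n]"
    by (intro e s1 f) (auto simp: atLeast0LessThan)
  have "{x. x < n \<and> x \<notin> \<tau> ` {..<i}} = \<tau> ` ({..<n} - {..<i})"
    using im i inj_on_image_set_diff[OF inj, of "{..<n}" "{..<i}"] by auto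
  also have "{..<n} - {..<i} = {i..<n}" by auto
  finally show "map \<tau> [i..<n] = filter (\<lambda>j. j \<notin> \<tau> ` {..<i}) [0..<n]"
    by (intro e s2 f) auto
qed

lemma unshuffle_nths:
  assumes "\<tau> \<in> unshuffles i (length xs)"
  shows "take i (permute_list \<tau> xs) = nths xs (\<tau> ` {..<i})"
    and "drop i (permute_list \<tau> xs) = nths xs (- \<tau> ` {..<i})"
proof -
  have i: "i \<le> length xs" using assms by (auto simp: unshuffles_def)
  have "map (\<lambda>j. xs ! \<tau> j) l = map ((!) xs) (map \<tau> l)" for l by simp
  then show "take i (permute_list \<tau> xs) = nths xs (\<tau> ` {..<i})"
    "drop i (permute_list \<tau> xs) = nths xs (- \<tau> ` {..<i})"
    using i unshuffle_eq_filter[OF assms]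
    by (simp_all add: permute_list_def take_map drop_map nths_eq_map_filter min_def del: map_map)
qed

lemma bij_betw_unshuffles:
  "bij_betw (\<lambda>\<tau>. \<tau> ` {..<i}) (unshuffles i n) {S. S \<subseteq> {..<n} \<and> card S = i}"
proof (rule bij_betwI')
  fix \<tau> \<tau>' assume t: "\<tau> \<in> unshuffles i n" "\<tau>' \<in> unshuffles i n"
  show "(\<tau> ` {..<i} = \<tau>' ` {..<i}) = (\<tau> = \<tau>')"
  proof
    assume "\<tau> ` {..<i} = \<tau>' ` {..<i}"
    then have "map \<tau> [0..<i] = map \<tau>' [0..<i]" "map \<tau> [i..<n] = map \<tau>' [i..<n]"
      using unshuffle_eq_filter[OF t(1)] unshuffle_eq_filter[OF t(2)] by simp_all
    then have "\<tau> j = \<tau>' j" if "j < n" for j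
      using that by (cases "j < i") (auto simp: map_eq_conv)
    moreover have "\<tau> j = \<tau>' j" if "\<not> j < n" for j
      using t that by (auto simp: unshuffles_def permutes_def)
    ultimately show "\<tau> = \<tau>'" by blast
  qed simp
next
  fix \<tau> assume t: "\<tau> \<in> unshuffles i n"
  then have "\<tau> ` {..<i} \<subseteq> \<tau> ` {..<n}" by (auto simp: unshuffles_def)
  with t show "\<tau> ` {..<i} \<in> {S. S \<subseteq> {..<n} \<and> card S = i}"
    by (auto simp: unshuffles_def permutes_image card_image permutes_inj_on
        dest: permutes_inj_on[where A = "{..<i}"])
next
  fix S assume "S \<in> {S. S \<subseteq> {..<n} \<and> card S = i}"
  then have S: "S \<subseteq> {..<n}" and c: "card S = i" by auto
  define l1 where "l1 = filter (\<lambda>j. j \<in> S) [0..<n]"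
  define l2 where "l2 = filter (\<lambda>j. j \<notin> S) [0..<n]"
  have set: "set l1 = S" "set l2 = {..<n} - S" using S by (auto simp: l1_def l2_def)
  have d: "distinct l1" "distinct l2" by (simp_all add: l1_def l2_def)
  have len1: "length l1 = i" using distinct_card[OF d(1)] set c by simp
  have len2: "length l2 = n - i" using distinct_card[OF d(2)] set c S
    by (simp add: card_Diff_subset finite_subset)
  have i: "i \<le> n" using card_mono[OF _ S] c by simp
  have s: "sorted_wrt (<) l1" "sorted_wrt (<) l2"
    unfolding l1_def l2_def by (rule sorted_wrt_filter; simp)+
  define \<tau> where "\<tau> j = (if j < n then (l1 @ l2) ! j else j)" for j
  have len: "length (l1 @ l2) = n" using len1 len2 i by simp
  have "bij_betw ((!) (l1 @ l2)) {..<n} {..<n}"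
  proof (rule bij_betw_nth)
    show "distinct (l1 @ l2)" using d set by auto
    show "{..<n} = {..<length (l1 @ l2)}" using len by simp
    show "{..<n} = set (l1 @ l2)" using set S by auto
  qed
  then have "bij_betw \<tau> {..<n} {..<n}"
    by (rule bij_betw_cong[THEN iffD1, rotated]) (simp add: \<tau>_def)
  then have p: "\<tau> permutes {..<n}" by (rule bij_imp_permutes) (simp add: \<tau>_def)
  have m1: "strict_mono_on {..<i} \<tau>"
    using s(1) i len1 by (auto simp: strict_mono_on_def \<tau>_def nth_append sorted_wrt_iff_nth_less)
  have m2: "strict_mono_on {i..<n} \<tau>"
    using s(2) i len1 len2
    by (auto simp: strict_mono_on_def \<tau>_def nth_append sorted_wrt_iff_nth_less)
  have "\<tau> ` {..<i} = (!) l1 ` {..<i}"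
    using i len1 by (intro image_cong) (auto simp: \<tau>_def nth_append)
  also have "\<dots> = S" using set(1) len1 by (auto simp: set_conv_nth)
  finally show "\<exists>\<tau>\<in>unshuffles i n. S = \<tau> ` {..<i}"
    using p m1 m2 i by (auto simp: unshuffles_def intro!: bexI[of _ \<tau>])
qed

text \<open>
  The Koszul sign of moving the letters at the positions in \<open>S\<close> to the front: one factor for each pair
  of a position in \<open>S\<close> and an earlier position outside \<open>S\<close>.
\<close>
definition subset_sign :: "nat set \<Rightarrow> 'l word \<Rightarrow> 'k::field" where
  "subset_sign S xs = (\<Prod>v<length xs. \<Prod>u<length xs.
     if v < u \<and> v \<notin> S \<and> u \<in> S then (-1) powi ((fst (xs ! u) - 1) * (fst (xs ! v) - 1)) else 1)"

text \<open>
  The inversions of an unshuffle pair an argument in the first block with one in the second block that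
  has a smaller image, so reindexing the product over inversions by \<open>\<tau>\<close> gives the subset sign.
\<close>
lemma koszul_unshuffle:
  assumes "\<tau> \<in> unshuffles i (length xs)"
  shows "koszul \<tau> xs = (subset_sign (\<tau> ` {..<i}) xs :: 'k::field)"
proof -
  let ?n = "length xs"
  define e :: "nat \<Rightarrow> nat \<Rightarrow> 'k" where "e u v = (-1) powi ((fst (xs ! u) - 1) * (fst (xs ! v) - 1))" for u v
  have p: "\<tau> permutes {..<?n}" and m1: "strict_mono_on {..<i} \<tau>" and i: "i \<le> ?n"
    and m2: "strict_mono_on {i..<?n} \<tau>" using assms by (auto simp: unshuffles_def)
  have b: "bij_betw \<tau> {..<?n} {..<?n}" using p by (rule permutes_imp_bij)
  have mem: "\<tau> a \<in> \<tau> ` {..<i} \<longleftrightarrow> a < i" for a using permutes_inj[OF p] by (auto simp: inj_def)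
  have "koszul \<tau> xs = (\<Prod>(a, b)\<in>{(a, b). a < b \<and> b < ?n \<and> \<tau> b < \<tau> a}. e (\<tau> a) (\<tau> b))"
    by (simp add: koszul_def e_def)
  also have "{(a, b). a < b \<and> b < ?n \<and> \<tau> b < \<tau> a} =
      {p \<in> {..<?n} \<times> {..<?n}. fst p < snd p \<and> \<tau> (snd p) < \<tau> (fst p)}" by auto
  also have "(\<Prod>(a, b)\<in>\<dots>. e (\<tau> a) (\<tau> b)) = (\<Prod>(a, b)\<in>{..<?n} \<times> {..<?n}. if a < b \<and> \<tau> b < \<tau> a then e (\<tau> a) (\<tau> b) else 1)"
    by (subst prod.inter_filter) (auto intro!: prod.cong)
  also have "\<dots> = (\<Prod>a<?n. \<Prod>b<?n. if a < b \<and> \<tau> b < \<tau> a then e (\<tau> a) (\<tau> b) else 1)"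
    by (simp add: prod.cartesian_product)
  also have "\<dots> = (\<Prod>a<?n. \<Prod>b<?n. if \<tau> b < \<tau> a \<and> \<tau> b \<notin> \<tau> ` {..<i} \<and> \<tau> a \<in> \<tau> ` {..<i} then e (\<tau> a) (\<tau> b) else 1)"
  proof (intro prod.cong refl if_cong)
    fix a b assume ab: "a \<in> {..<?n}" "b \<in> {..<?n}"
    show "(a < b \<and> \<tau> b < \<tau> a) = (\<tau> b < \<tau> a \<and> \<tau> b \<notin> \<tau> ` {..<i} \<and> \<tau> a \<in> \<tau> ` {..<i})"
      unfolding mem
    proof safe
      assume *: "a < b" "\<tau> b < \<tau> a"
      { assume "b < i" then have "\<tau> a < \<tau> b" using m1 * by (auto simp: strict_mono_on_def) }
      with * show "b < i \<Longrightarrow> False" by auto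
      show "a < i"
      proof (rule ccontr)
        assume "\<not> a < i" then have "\<tau> a < \<tau> b" using m2 * ab by (auto simp: strict_mono_on_def)
        with * show False by auto
      qed
    qed auto
  qed
  also have "\<dots> = (\<Prod>a<?n. \<Prod>v<?n. if v < \<tau> a \<and> v \<notin> \<tau> ` {..<i} \<and> \<tau> a \<in> \<tau> ` {..<i} then e (\<tau> a) v else 1)"
    by (intro prod.cong refl prod.reindex_bij_betw[OF b])
  also have "\<dots> = (\<Prod>u<?n. \<Prod>v<?n. if v < u \<and> v \<notin> \<tau> ` {..<i} \<and> u \<in> \<tau> ` {..<i} then e u v else 1)"
    by (rule prod.reindex_bij_betw[OF b])
  also have "\<dots> = subset_sign (\<tau> ` {..<i}) xs"
    unfolding subset_sign_def e_def by (rule prod.swap)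
  finally show ?thesis .
qed

lemma powi_minus_one_sum_list:
  "(-1 :: 'k::field) powi (c * (\<Sum>x\<leftarrow>xs. f x)) = (\<Prod>x\<leftarrow>xs. (-1) powi (c * f x))"
  by (induction xs) (simp_all add: distrib_left power_int_add)

lemma powi_wdeg_nths:
  "(-1 :: 'k::field) powi (c * wdeg (nths xs S)) =
     (\<Prod>u<length xs. if u \<in> S then (-1) powi (c * (fst (xs ! u) - 1)) else 1)"
proof -
  have "(-1 :: 'k) powi (c * wdeg (nths xs S)) =
      (\<Prod>u\<leftarrow>filter (\<lambda>i. i \<in> S) [0..<length xs]. (-1) powi (c * (fst (xs ! u) - 1)))"
    by (simp add: wdeg_def powi_minus_one_sum_list nths_eq_map_filter o_def case_prod_beta)
  also have "\<dots> = (\<Prod>u\<in>{..<length xs} \<inter> S. (-1) powi (c * (fst (xs ! u) - 1)))"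
    by (subst prod.distinct_set_conv_list[symmetric]) (auto intro!: prod.cong)
  also have "\<dots> = (\<Prod>u<length xs. if u \<in> S then (-1) powi (c * (fst (xs ! u) - 1)) else 1)"
    by (simp add: prod.inter_restrict)
  finally show ?thesis .
qed

lemma subset_sign_Nil [simp]: "subset_sign S [] = 1"
  by (simp add: subset_sign_def)

text \<open>
  If the first letter is not selected, all selected letters have to pass it.
\<close>
lemma subset_sign_Cons:
  "subset_sign S (x # xs) = (if 0 \<in> S then 1 else (-1) powi ((fst x - 1) * wdeg (nths xs {j. Suc j \<in> S}))) *
     (subset_sign {j. Suc j \<in> S} xs :: 'k::field)"
proof -
  have "subset_sign S (x # xs) =
     (\<Prod>u<length xs. if 0 \<notin> S \<and> Suc u \<in> S then (-1) powi ((fst (xs ! u) - 1) * (fst x - 1)) else 1) *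
     (subset_sign {j. Suc j \<in> S} xs :: 'k::field)"
    by (simp add: subset_sign_def prod.lessThan_Suc_shift del: prod.lessThan_Suc cong: if_cong)
  then show ?thesis
    by (simp add: powi_wdeg_nths mult.commute[of _ "fst x - 1"] cong: if_cong)
qed

lemma sum_Pow_lessThan_Suc:
  fixes h :: "nat set \<Rightarrow> 'b::comm_monoid_add"
  shows "(\<Sum>S\<in>Pow {..<Suc n}. h S) = (\<Sum>S\<in>Pow {..<n}. h (insert 0 (Suc ` S))) + (\<Sum>S\<in>Pow {..<n}. h (Suc ` S))"
proof -
  have P: "Pow {..<Suc n} = image Suc ` Pow {..<n} \<union> (\<lambda>S. insert 0 (Suc ` S)) ` Pow {..<n}"
    by (simp add: lessThan_Suc_eq_insert_0 Pow_insert image_image flip: image_Pow_surj[OF refl])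
  have i1: "inj_on (image Suc) (Pow {..<n})"
    by (simp add: inj_on_def inj_image_eq_iff)
  have i2: "inj_on (\<lambda>S. insert 0 (Suc ` S)) (Pow {..<n})"
  proof (rule inj_onI)
    fix S T assume "insert 0 (Suc ` S) = insert 0 (Suc ` T)"
    then have "insert 0 (Suc ` S) - {0} = insert 0 (Suc ` T) - {0}" by simp
    then have "Suc ` S = Suc ` T" by (simp add: insert_Diff_if) 
    then show "S = T" by (simp add: inj_image_eq_iff)
  qed
  show ?thesis unfolding P
    by (subst sum.union_disjoint) (auto simp: sum.reindex[OF i1] sum.reindex[OF i2] add.commute)
qed

lemma sum_unshuffles:
  fixes h :: "nat set \<Rightarrow> 'b::comm_monoid_add"
  shows "(\<Sum>i\<le>n. \<Sum>\<tau>\<in>unshuffles i n. h (\<tau> ` {..<i})) = (\<Sum>S\<in>Pow {..<n}. h S)"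
proof -
  have "(\<Sum>i\<le>n. \<Sum>\<tau>\<in>unshuffles i n. h (\<tau> ` {..<i})) = (\<Sum>i\<le>n. \<Sum>S\<in>{S. S \<subseteq> {..<n} \<and> card S = i}. h S)"
    by (intro sum.cong refl sum.reindex_bij_betw[OF bij_betw_unshuffles])
  also have "\<dots> = (\<Sum>i\<le>n. \<Sum>S\<in>{S \<in> Pow {..<n}. card S = i}. h S)" by (simp add: Pow_def)
  also have "\<dots> = (\<Sum>S\<in>Pow {..<n}. h S)"
  proof (rule sum.group)
    show "card ` Pow {..<n} \<subseteq> {..n}"
      using card_mono[of "{..<n}"] by fastforce
  qed auto
  finally show ?thesis .
qed

section \<open>The convolution product by recursion on words\<close>

text \<open>
  The first letter of a word goes either to the left factor, where it picks up the sign for passing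
  the right factor of degree \<open>q\<close>, or to the right factor, whose degree it then raises.
\<close>
primrec conv :: "int \<Rightarrow> ('l word \<Rightarrow> 'b::ring) \<Rightarrow> ('l word \<Rightarrow> 'b) \<Rightarrow> 'l word \<Rightarrow> 'b" where
  conv_Nil: "conv q f g [] = f [] * g []"
| conv_Cons: "conv q f g (x # w) = signed (q * (fst x - 1)) (conv q (\<lambda>u. f (x # u)) g w) +
     conv (q + (fst x - 1)) f (\<lambda>u. g (x # u)) w"

declare conv.simps [simp del]

lemma star_eq_conv:
  fixes A :: "('k::field, 'a::{ring, monoid_mult}) cdga"
    and f g :: "'l word \<Rightarrow> 'a"
  assumes "vector_space (scal A)"
  shows "star A q f g xs = conv q f g xs"
proof -
  interpret vector_space "scal A" by fact
  define h where "h q f g xs S = scal A (subset_sign S xs * (-1) powi (q * wdeg (nths xs S)))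
     (f (nths xs S) * g (nths xs (- S)))" for q and f g :: "'l word \<Rightarrow> 'a" and xs S
  have "(\<Sum>S\<in>Pow {..<length xs}. h q f g xs S) = conv q f g xs"
  proof (induction xs arbitrary: q f g)
    case Nil
    show ?case by (simp add: h_def wdeg_def conv_Nil)
  next
    case (Cons x xs)
    have 1: "h q f g (x # xs) (insert 0 (Suc ` S)) = signed (q * (fst x - 1)) (h q (\<lambda>u. f (x # u)) g xs S)" for S
    proof -
      have [simp]: "{j. Suc j \<in> Suc ` S} = S" "{j. Suc j \<notin> Suc ` S} = - S" by auto
      show ?thesis
        by (simp add: h_def subset_sign_Cons nths_Cons wdeg_def distrib_left power_int_add case_prod_beta
          mult.assoc mult.left_commute flip: scale_powi_minus_one)
    qed
    have 2: "h q f g (x # xs) (Suc ` S) = h (q + (fst x - 1)) f (\<lambda>u. g (x # u)) xs S" for S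
    proof -
      have [simp]: "{j. Suc j \<in> Suc ` S} = S" "{j. Suc j \<notin> Suc ` S} = - S" by auto
      show ?thesis
        by (simp add: h_def subset_sign_Cons nths_Cons distrib_right power_int_add 
          mult.assoc mult.left_commute)
    qed
    have 3: "(\<Sum>S\<in>P. signed n (h' S)) = signed n (\<Sum>S\<in>P. h' S)" for n h' and P :: "nat set set"
      by (simp add: signed_def sum_negf)
    show ?case
      by (simp only: length_Cons sum_Pow_lessThan_Suc 1 2 3 Cons.IH conv_Cons)
  qed
  moreover have "star A q f g xs = (\<Sum>i\<le>length xs. \<Sum>\<tau>\<in>unshuffles i (length xs). h q f g xs (\<tau> ` {..<i}))"
    unfolding star_def
    by (intro sum.cong refl) (simp add: h_def Let_def unshuffle_nths koszul_unshuffle)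
  ultimately show ?thesis by (simp add: sum_unshuffles)
qed

text \<open>
  An additive map that is compatible with the product of the values passes through the convolution
  product. Congruence, ring homomorphisms and multiplication by scalars are instances.
\<close>
lemma conv_map:
  assumes "\<And>a b. h (a + b) = h a + h b"
    and "\<And>u v. u \<in> words L \<Longrightarrow> v \<in> words L \<Longrightarrow> h (f u * g v) = f' u * g' v"
    and "w \<in> words L"
  shows "h (conv q f g w) = conv q f' g' w"
  using assms(2,3)
proof (induction w arbitrary: q f g f' g')
  case (Cons x w)
  then show ?case
    by (simp add: conv_Cons assms(1) additive_signed(3)[of h, OF assms(1)] words_Cons)
qed (simp add: conv_Nil)

lemma conv_cong:
  assumes "\<And>u. u \<in> words L \<Longrightarrow> f u = f' u" and "\<And>u. u \<in> words L \<Longrightarrow> g u = g' u" and "w \<in> words L"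
  shows "conv q f g w = conv q f' g' w"
  using assms by (intro conv_map[where h = "\<lambda>a. a" and L = L]) simp_all

lemma conv_mem:
  assumes Z: "add_closed Z"
    and "\<And>u v. u \<in> words L \<Longrightarrow> v \<in> words L \<Longrightarrow> length u + length v = length w \<Longrightarrow>
      wdeg u + wdeg v = wdeg w \<Longrightarrow> f u * g v \<in> Z"
    and "w \<in> words L"
  shows "conv q f g w \<in> Z"
  using assms(2,3)
proof (induction w arbitrary: q f g)
  case Nil
  then show ?case using Nil(1)[of "[]" "[]"] by (simp add: conv_Nil)
next
  case (Cons x w)
  from Cons.prems(2) have x: "snd x \<in> gpart L (fst x)" and w: "w \<in> words L" by (auto simp: words_Cons)
  have 1: "conv q (\<lambda>u. f (x # u)) g w \<in> Z" for q
    using Cons.prems(1)[of "x # _"] x w by (intro Cons.IH) (auto simp: words_Cons wdeg_Cons)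
  have 2: "conv q f (\<lambda>u. g (x # u)) w \<in> Z" for q
    using Cons.prems(1)[of _ "x # _"] x w by (intro Cons.IH) (auto simp: words_Cons wdeg_Cons)
  show ?case using 1 2 Z by (simp add: conv_Cons add_closed_add add_closed_signed)
qed

lemma conv_parity:
  fixes f g :: "'l word \<Rightarrow> 'b::ring"
  shows "even (q - q') \<Longrightarrow> conv q f g w = conv q' f g w"
proof (induction w arbitrary: q q' f g)
  case (Cons x w)
  have e: "even (q + (fst x - 1) - (q' + (fst x - 1)))" using Cons.prems by simp
  have "signed (q * (fst x - 1)) a = signed (q' * (fst x - 1)) a" for a :: 'b
    using Cons.prems by (auto simp: signed_def)
  then show ?case by (simp only: conv_Cons Cons.IH[OF e] Cons.IH[OF Cons.prems])
qed (simp add: conv_Nil)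

lemma conv_add_left: "conv q (\<lambda>u. f u + f' u) g w = conv q f g w + conv q f' g w"
  by (induction w arbitrary: q f f' g) (simp_all add: conv_Nil conv_Cons distrib_right signed_add)

lemma conv_add_right: "conv q f (\<lambda>u. g u + g' u) w = conv q f g w + conv q f g' w"
  by (induction w arbitrary: q f g g') (simp_all add: conv_Nil conv_Cons distrib_left signed_add)

lemma conv_signed_left: "conv q (\<lambda>u. signed n (f u)) g w = signed n (conv q f g w)"
  by (induction w arbitrary: q f g)
    (simp_all add: conv_Nil conv_Cons signed_mult_left signed_add signed_signed add.commute)

lemma conv_signed_right: "conv q f (\<lambda>u. signed n (g u)) w = signed n (conv q f g w)"
  by (induction w arbitrary: q f g)
    (simp_all add: conv_Nil conv_Cons signed_mult_right signed_add signed_signed add.commute)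

lemma conv_uminus_left: "conv q (\<lambda>u. - f u) g w = - conv q f g w"
  using conv_signed_left[of q 1] by (simp add: signed_def)

lemma conv_uminus_right: "conv q f (\<lambda>u. - g u) w = - conv q f g w"
  using conv_signed_right[of q f 1] by (simp add: signed_def)

lemma conv_diff_left: "conv q (\<lambda>u. f u - f' u) g w = conv q f g w - conv q f' g w"
  using conv_add_left[of q f "\<lambda>u. - f' u"] by (simp add: conv_uminus_left)

lemma conv_diff_right: "conv q f (\<lambda>u. g u - g' u) w = conv q f g w - conv q f g' w"
  using conv_add_right[of q f g "\<lambda>u. - g' u"] by (simp add: conv_uminus_right)

lemma conv_zero [simp]: "conv q (\<lambda>u. 0) g w = 0" "conv q f (\<lambda>u. 0) w = 0"
  by (induction w arbitrary: q f g) (simp_all add: conv_Nil conv_Cons)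

lemma conv_const_left: "conv q (const_cochain a) g w = a * g w"
  by (induction w arbitrary: q g) (simp_all add: conv_Nil conv_Cons const_cochain_def)

lemma conv_const_right: "conv q f (const_cochain a) w = signed (q * wdeg w) (f w * a)"
  by (induction w arbitrary: q f)
    (simp_all add: conv_Nil conv_Cons const_cochain_def wdeg_Cons signed_signed distrib_left signed_def)

text \<open>
  The index \<open>q + r\<close> on the right is the degree of \<open>g \<star> h\<close>, if \<open>q\<close> and \<open>r\<close> are the degrees of \<open>g\<close> and \<open>h\<close>.
\<close>
lemma conv_assoc: "conv r (conv q f g) h w = conv (q + r) f (conv r g h) w"
proof (induction w arbitrary: q r f g h)
  case (Cons x w)
  have [simp]: "q + (fst x - 1) + r = q + r + (fst x - 1)" "q + (r + (fst x - 1)) = q + r + (fst x - 1)" by simp_all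
  show ?case
    by (simp add: conv_Cons conv_add_left conv_add_right conv_signed_left conv_signed_right
        Cons.IH signed_add signed_signed distrib_right) (simp add: algebra_simps)
qed (simp add: conv_Nil mult.assoc)

text \<open>
  The unshuffle coproduct is graded cocommutative, so the commutator of two cochains is a sum of
  commutators of their values.
\<close>
lemma conv_graded_commute:
  assumes Z: "add_closed Z"
    and "\<And>u v. u \<in> words L \<Longrightarrow> v \<in> words L \<Longrightarrow>
      f u * g v - signed ((p + wdeg u) * (q + wdeg v)) (g v * f u) \<in> Z"
    and "w \<in> words L"
  shows "conv q f g w - signed (p * q) (conv p g f w) \<in> Z"
  using assms(2,3)
proof (induction w arbitrary: p q f g)
  case Nil
  then show ?case using Nil(1)[of "[]" "[]"] by (simp add: conv_Nil)
next
  case (Cons x w)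
  let ?e = "fst x - 1"
  from Cons.prems(2) have x: "snd x \<in> gpart L (fst x)" and w: "w \<in> words L" by (auto simp: words_Cons)
  have 1: "conv q (\<lambda>u. f (x # u)) g w - signed ((p + ?e) * q) (conv (p + ?e) g (\<lambda>u. f (x # u)) w) \<in> Z"
    using Cons.prems(1)[of "x # _"] x w by (intro Cons.IH) (auto simp: words_Cons wdeg_Cons add.assoc)
  have 2: "conv (q + ?e) f (\<lambda>u. g (x # u)) w - signed (p * (q + ?e)) (conv p (\<lambda>u. g (x # u)) f w) \<in> Z"
    using Cons.prems(1)[of _ "x # _"] x w by (intro Cons.IH) (auto simp: words_Cons wdeg_Cons add.assoc)
  have "conv q f g (x # w) - signed (p * q) (conv p g f (x # w)) =
     signed (q * ?e) (conv q (\<lambda>u. f (x # u)) g w - signed ((p + ?e) * q) (conv (p + ?e) g (\<lambda>u. f (x # u)) w))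
    + (conv (q + ?e) f (\<lambda>u. g (x # u)) w - signed (p * (q + ?e)) (conv p (\<lambda>u. g (x # u)) f w))"
    by (cases "even p"; cases "even q"; cases "even ?e"; simp add: conv_Cons signed_def)
  then show ?case using add_closed_add[OF Z add_closed_signed[OF Z 1] 2] by simp
qed

text \<open>
  The analogue for derivations of degree 0, used for the derivative with respect to \<open>t\<close>.
\<close>
lemma even_derivation_conv:
  assumes "\<And>a b. d (a + b) = d a + d b" and "\<And>a b. d (a * b) = d a * b + a * d b"
  shows "d (conv q f g w) = conv q (\<lambda>u. d (f u)) g w + conv q f (\<lambda>u. d (g u)) w"
proof (induction w arbitrary: q f g)
  case (Cons x w)
  have "d (signed n a) = signed n (d a)" for a n
    by (rule additive_signed(3)[of d, OF assms(1)])
  then show ?case by (simp add: conv_Cons assms(1) Cons.IH signed_add)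
qed (simp add: conv_Nil assms)

section \<open>The coderivation by recursion on words\<close>

lemma dgla_diff_closed:
  assumes "is_dgla L" and "x \<in> gpart L n"
  shows "gdiff L x \<in> gpart L (n + 1)"
  by (rule assms(1)[unfolded is_dgla_def is_complex_def graded_linear_def, THEN conjunct1, THEN conjunct2,
        THEN conjunct1, THEN spec, THEN conjunct1, THEN bspec, OF assms(2)])

lemma dgla_bracket_closed:
  assumes "is_dgla L" and "x \<in> gpart L i" and "y \<in> gpart L j"
  shows "gbracket L i j x y \<in> gpart L (i + j)"
  by (rule assms(1)[unfolded is_dgla_def, THEN conjunct2, THEN conjunct1, THEN spec, THEN spec,
        THEN bspec, THEN bspec, THEN conjunct1, OF assms(2,3)])

lemma dgla_axioms:
  assumes L: "is_dgla L"
  shows dgla_gzero: "gzero L \<in> gpart L n" "gadd L (gzero L) (gzero L) = gzero L"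
    and dgla_gadd_closed: "x \<in> gpart L n \<Longrightarrow> y \<in> gpart L n \<Longrightarrow> gadd L x y \<in> gpart L n"
    and dgla_gsmult_closed: "x \<in> gpart L n \<Longrightarrow> gsmult L c x \<in> gpart L n"
    and dgla_diff_add: "x \<in> gpart L n \<Longrightarrow> y \<in> gpart L n \<Longrightarrow> gdiff L (gadd L x y) = gadd L (gdiff L x) (gdiff L y)"
    and dgla_diff_scale: "x \<in> gpart L n \<Longrightarrow> gdiff L (gsmult L c x) = gsmult L c (gdiff L x)"
    and dgla_diff_diff: "x \<in> gpart L n \<Longrightarrow> gdiff L (gdiff L x) = gzero L"
proof -
  have c: "is_complex L" using L unfolding is_dgla_def by (rule conjunct1)
  note c' = c[unfolded is_complex_def]
  note g = c'[THEN conjunct1, unfolded graded_vector_space_def, THEN spec[of _ n]]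
  note l = c'[THEN conjunct2, THEN conjunct1, unfolded graded_linear_def, THEN spec[of _ n]]
  show z: "gzero L \<in> gpart L n" by (rule g[THEN conjunct1])
  have "\<forall>x\<in>gpart L n. gadd L (gzero L) x = x \<and> gadd L (gsmult L (-1) x) x = gzero L"
    by (rule g[THEN conjunct2, THEN conjunct2, THEN conjunct2, THEN conjunct1])
  with z show "gadd L (gzero L) (gzero L) = gzero L" by blast
  show "x \<in> gpart L n \<Longrightarrow> y \<in> gpart L n \<Longrightarrow> gadd L x y \<in> gpart L n"
    using g[THEN conjunct2, THEN conjunct1] by blast
  show "x \<in> gpart L n \<Longrightarrow> gsmult L c x \<in> gpart L n"
    using g[THEN conjunct2, THEN conjunct2, THEN conjunct2, THEN conjunct2, THEN conjunct1] by blast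
  show "x \<in> gpart L n \<Longrightarrow> y \<in> gpart L n \<Longrightarrow> gdiff L (gadd L x y) = gadd L (gdiff L x) (gdiff L y)"
    using l[THEN conjunct2, THEN conjunct1] by blast
  show "x \<in> gpart L n \<Longrightarrow> gdiff L (gsmult L c x) = gsmult L c (gdiff L x)"
    using l[THEN conjunct2, THEN conjunct2] by blast
  show "x \<in> gpart L n \<Longrightarrow> gdiff L (gdiff L x) = gzero L"
    using c'[THEN conjunct2, THEN conjunct2] by blast
qed

lemma dgla_bracket_axioms:
  assumes L: "is_dgla L" and x: "x \<in> gpart L i" and y: "y \<in> gpart L j"
  shows dgla_bracket_add_left: "x' \<in> gpart L i \<Longrightarrow>
        gbracket L i j (gadd L x x') y = gadd L (gbracket L i j x y) (gbracket L i j x' y)"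
    and dgla_bracket_add_right: "y' \<in> gpart L j \<Longrightarrow>
        gbracket L i j x (gadd L y y') = gadd L (gbracket L i j x y) (gbracket L i j x y')"
    and dgla_bracket_scale_left: "gbracket L i j (gsmult L c x) y = gsmult L c (gbracket L i j x y)"
    and dgla_bracket_scale_right: "gbracket L i j x (gsmult L c y) = gsmult L c (gbracket L i j x y)"
    and dgla_antisym: "gbracket L i j x y = gsmult L (- ((-1) powi (i * j))) (gbracket L j i y x)"
    and dgla_leibniz: "gdiff L (gbracket L i j x y) =
          gadd L (gbracket L (i + 1) j (gdiff L x) y)
            (gsmult L ((-1) powi i) (gbracket L i (j + 1) x (gdiff L y)))"
    and dgla_jacobi: "z \<in> gpart L l \<Longrightarrow> gbracket L i (j + l) x (gbracket L j l y z) =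
          gadd L (gbracket L (i + j) l (gbracket L i j x y) z)
            (gsmult L ((-1) powi (i * j)) (gbracket L j (i + l) y (gbracket L i l x z)))"
proof -
  note c = L[unfolded is_dgla_def, THEN conjunct2]
  have b: "\<forall>x\<in>gpart L i. \<forall>y\<in>gpart L j.
        gbracket L i j x y \<in> gpart L (i + j) \<and>
        (\<forall>x'\<in>gpart L i. gbracket L i j (gadd L x x') y =
           gadd L (gbracket L i j x y) (gbracket L i j x' y)) \<and>
        (\<forall>y'\<in>gpart L j. gbracket L i j x (gadd L y y') =
           gadd L (gbracket L i j x y) (gbracket L i j x y')) \<and>
        (\<forall>c. gbracket L i j (gsmult L c x) y = gsmult L c (gbracket L i j x y) \<and>
             gbracket L i j x (gsmult L c y) = gsmult L c (gbracket L i j x y))"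
    using c[THEN conjunct1] by blast
  note b' = b[THEN bspec, OF x, THEN bspec, OF y, THEN conjunct2]
  show "x' \<in> gpart L i \<Longrightarrow>
        gbracket L i j (gadd L x x') y = gadd L (gbracket L i j x y) (gbracket L i j x' y)"
    using b'[THEN conjunct1] by blast
  show "y' \<in> gpart L j \<Longrightarrow>
        gbracket L i j x (gadd L y y') = gadd L (gbracket L i j x y) (gbracket L i j x y')"
    using b'[THEN conjunct2, THEN conjunct1] by blast
  show "gbracket L i j (gsmult L c x) y = gsmult L c (gbracket L i j x y)"
    "gbracket L i j x (gsmult L c y) = gsmult L c (gbracket L i j x y)"
    using b'[THEN conjunct2, THEN conjunct2] by blast+
  show "gbracket L i j x y = gsmult L (- ((-1) powi (i * j))) (gbracket L j i y x)"
    using c[THEN conjunct2, THEN conjunct1] x y by blast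
  show "gdiff L (gbracket L i j x y) =
          gadd L (gbracket L (i + 1) j (gdiff L x) y)
            (gsmult L ((-1) powi i) (gbracket L i (j + 1) x (gdiff L y)))"
    using c[THEN conjunct2, THEN conjunct2, THEN conjunct2] x y by blast
  show "z \<in> gpart L l \<Longrightarrow> gbracket L i (j + l) x (gbracket L j l y z) =
          gadd L (gbracket L (i + j) l (gbracket L i j x y) z)
            (gsmult L ((-1) powi (i * j)) (gbracket L j (i + l) y (gbracket L i l x z)))"
    using c[THEN conjunct2, THEN conjunct2, THEN conjunct1] x y by blast
qed

text \<open>
  \<open>ad_transpose L m x f\<close> is the composite of \<open>f\<close> with the derivation of words that replaces one letter
  \<open>y\<close> by \<open>[x, y]\<close>. In \<open>L[1]\<close> the bracket with \<open>x\<close> has degree \<open>m\<close>, hence the sign for passing a letter.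
\<close>
primrec ad_transpose :: "('k, 'l, 'z) dgla_scheme \<Rightarrow> int \<Rightarrow> 'l \<Rightarrow> ('l word \<Rightarrow> 'b::ab_group_add) \<Rightarrow> 'l word \<Rightarrow> 'b" where
  ad_transpose_Nil: "ad_transpose L m x f [] = 0"
| ad_transpose_Cons: "ad_transpose L m x f (y # w) = f ((m + fst y, gbracket L m (fst y) x (snd y)) # w) +
     signed (m * (fst y - 1)) (ad_transpose L m x (\<lambda>u. f (y # u)) w)"

text \<open>
  The composite of \<open>f\<close> with \<open>Q\<close>, where brackets are left at the place of their second letter: either the
  first letter is differentiated, or it is bracketed with a later letter, or \<open>Q\<close> acts behind it.
\<close>
primrec Q_transpose :: "('k, 'l, 'z) dgla_scheme \<Rightarrow> ('l word \<Rightarrow> 'b::ab_group_add) \<Rightarrow> 'l word \<Rightarrow> 'b" where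
  Q_transpose_Nil: "Q_transpose L f [] = 0"
| Q_transpose_Cons: "Q_transpose L f (x # w) = - f ((fst x + 1, gdiff L (snd x)) # w) +
     signed (fst x) (ad_transpose L (fst x) (snd x) f w) +
     signed (fst x - 1) (Q_transpose L (\<lambda>u. f (x # u)) w)"

declare ad_transpose_Cons [simp del] Q_transpose_Cons [simp del]

lemma ad_transpose_map:
  assumes L: "is_dgla L" and "\<And>a b. h (a + b) = h a + h b"
    and "\<And>u. u \<in> words L \<Longrightarrow> h (f u) = f' u" and "w \<in> words L" and "x \<in> gpart L m"
  shows "h (ad_transpose L m x f w) = ad_transpose L m x f' w"
  using assms(3,4)
proof (induction w arbitrary: f f')
  case (Cons y w)
  then show ?case using L assms(5)
    by (simp add: ad_transpose_Cons assms(2) additive_signed(3)[of h, OF assms(2)] words_Cons dgla_bracket_closed)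
qed (simp add: additive_signed(1)[of h, OF assms(2)])

lemma Q_transpose_map:
  assumes L: "is_dgla L" and "\<And>a b. h (a + b) = h a + h b"
    and "\<And>u. u \<in> words L \<Longrightarrow> h (f u) = f' u" and "w \<in> words L"
  shows "h (Q_transpose L f w) = Q_transpose L f' w"
  using assms(3,4)
proof (induction w arbitrary: f f')
  case (Cons y w)
  have h: "h (- a) = - h a" "h (signed n a) = signed n (h a)" "h (a - b) = h a - h b" for a b n
    using additive_signed[of h, OF assms(2)] by auto
  have "h (ad_transpose L (fst y) (snd y) f w) = ad_transpose L (fst y) (snd y) f' w"
    using Cons.prems by (intro ad_transpose_map[OF L assms(2)]) (auto simp: words_Cons)
  with Cons show ?case
    by (simp add: Q_transpose_Cons assms(2) h words_Cons dgla_diff_closed[OF L])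
qed (simp add: additive_signed(1)[of h, OF assms(2)])

lemma Q_transpose_cong:
  assumes "is_dgla L" and "\<And>u. u \<in> words L \<Longrightarrow> f u = f' u" and "w \<in> words L"
  shows "Q_transpose L f w = Q_transpose L f' w"
  using assms by (intro Q_transpose_map[where h = "\<lambda>a. a" and L = L]) simp_all

lemma ad_transpose_mem:
  assumes L: "is_dgla L" and Z: "add_closed Z"
    and "\<And>u. u \<in> words L \<Longrightarrow> wdeg u = wdeg w + m \<Longrightarrow> length u = length w \<Longrightarrow> f u \<in> Z"
    and "w \<in> words L" and "x \<in> gpart L m"
  shows "ad_transpose L m x f w \<in> Z"
  using assms(3,4)
proof (induction w arbitrary: f)
  case (Cons y w)
  from Cons.prems(2) have y: "snd y \<in> gpart L (fst y)" and w: "w \<in> words L" by (auto simp: words_Cons)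
  have "ad_transpose L m x (\<lambda>u. f (y # u)) w \<in> Z"
    using Cons.prems(1)[of "y # _"] y w by (intro Cons.IH) (auto simp: words_Cons wdeg_Cons)
  moreover have "f ((m + fst y, gbracket L m (fst y) x (snd y)) # w) \<in> Z"
    using L y w assms(5) by (intro Cons.prems(1)) (auto simp: words_Cons wdeg_Cons dgla_bracket_closed)
  ultimately show ?case using Z by (simp add: ad_transpose_Cons add_closed_add add_closed_signed)
qed (simp add: add_closed_zero Z)

lemma Q_transpose_mem:
  assumes L: "is_dgla L" and Z: "add_closed Z"
    and "\<And>u. u \<in> words L \<Longrightarrow> wdeg u = wdeg w + 1 \<Longrightarrow> length u \<le> length w \<Longrightarrow> length w \<le> length u + 1 \<Longrightarrow> f u \<in> Z"
    and "w \<in> words L"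
  shows "Q_transpose L f w \<in> Z"
  using assms(3,4)
proof (induction w arbitrary: f)
  case (Cons x w)
  from Cons.prems(2) have x: "snd x \<in> gpart L (fst x)" and w: "w \<in> words L" by (auto simp: words_Cons)
  have "Q_transpose L (\<lambda>u. f (x # u)) w \<in> Z"
    using Cons.prems(1)[of "x # _"] x w by (intro Cons.IH) (auto simp: words_Cons wdeg_Cons)
  moreover have "f ((fst x + 1, gdiff L (snd x)) # w) \<in> Z"
    using L x w by (intro Cons.prems(1))
      (auto simp: words_Cons wdeg_Cons dgla_diff_closed)
  moreover have "ad_transpose L (fst x) (snd x) f w \<in> Z"
    using x w by (intro ad_transpose_mem[OF L Z]) (auto intro!: Cons.prems(1) simp: wdeg_Cons)
  ultimately show ?case
    using Z by (simp add: Q_transpose_Cons add_closed_add add_closed_diff add_closed_signed)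
qed (simp add: add_closed_zero Z)

lemma ad_transpose_add: "ad_transpose L m x (\<lambda>u. f u + g u) w = ad_transpose L m x f w + ad_transpose L m x g w"
  by (induction w arbitrary: f g) (simp_all add: ad_transpose_Cons signed_add)

lemma ad_transpose_signed: "ad_transpose L m x (\<lambda>u. signed n (f u)) w = signed n (ad_transpose L m x f w)"
  by (induction w arbitrary: f) (simp_all add: ad_transpose_Cons signed_add signed_signed add.commute)

lemma Q_transpose_add: "Q_transpose L (\<lambda>u. f u + g u) w = Q_transpose L f w + Q_transpose L g w"
  by (induction w arbitrary: f g) (simp_all add: Q_transpose_Cons signed_add ad_transpose_add)

lemma Q_transpose_signed: "Q_transpose L (\<lambda>u. signed n (f u)) w = signed n (Q_transpose L f w)"
  by (induction w arbitrary: f)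
    (simp_all add: Q_transpose_Cons signed_add signed_signed ad_transpose_signed signed_minus add.commute)

text \<open>
  Replacing letters one at a time is a coderivation, hence its transpose is a derivation of \<open>\<star>\<close>.
\<close>
lemma ad_transpose_conv:
  "ad_transpose L m x (conv q f g) w =
     signed (q * m) (conv q (ad_transpose L m x f) g w) + conv (q + m) f (ad_transpose L m x g) w"
proof (induction w arbitrary: q f g)
  case (Cons y w)
  obtain e y' where y: "y = (1 + e, y')" by (metis add_diff_cancel_left' add.commute diff_add_cancel prod.exhaust)
  show ?case unfolding y
    by (simp add: ad_transpose_Cons conv_Cons conv_add_left conv_add_right conv_signed_left conv_signed_right
        ad_transpose_add ad_transpose_signed Cons.IH add_ac)
      (cases "even q"; cases "even m"; cases "even e"; simp add: signed_def)
qed (simp add: conv_Nil)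

text \<open>
  \<open>Q\<close> is a coderivation. The induction step combines the recursions of \<open>conv\<close> and \<open>Q_transpose\<close> with
  \<open>ad_transpose_conv\<close> for the terms in which the first letter is bracketed.
\<close>
lemma Q_transpose_conv:
  "Q_transpose L (conv q f g) w =
     signed q (conv q (Q_transpose L f) g w) + conv (q + 1) f (Q_transpose L g) w"
proof (induction w arbitrary: q f g)
  case (Cons x w)
  obtain e x' where x: "x = (1 + e, x')" by (metis add_diff_cancel_left' add.commute diff_add_cancel prod.exhaust)
  show ?case unfolding x
    by (simp add: Q_transpose_Cons conv_Cons conv_add_left conv_add_right conv_diff_left conv_diff_right
         conv_signed_left conv_signed_right conv_uminus_left conv_uminus_right
        Q_transpose_add Q_transpose_signed ad_transpose_conv Cons.IH add_ac)
      (cases "even q"; cases "even e"; simp add: signed_def)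
qed (simp add: conv_Nil)

text \<open>
  For a derivation \<open>d\<close> of degree 1, passing \<open>f\<close> costs the sign of the degree of the value of \<open>f\<close>. Its part
  depending on the word is absorbed by the index \<open>q + 1\<close>.
\<close>
lemma derivation_conv:
  assumes "\<And>a b. d (a + b) = d a + d b"
    and "\<And>u v. u \<in> words L \<Longrightarrow> v \<in> words L \<Longrightarrow>
       d (f u * g v) = d (f u) * g v + signed (p + wdeg u) (f u * d (g v))"
    and "w \<in> words L"
  shows "d (conv q f g w) = conv q (\<lambda>u. d (f u)) g w + signed p (conv (q + 1) f (\<lambda>u. d (g u)) w)"
  using assms(2,3)
proof (induction w arbitrary: p q f g)
  case (Cons x w)
  let ?e = "fst x - 1"
  have d: "d (signed n a) = signed n (d a)" for a n
    by (rule additive_signed(3)[of d, OF assms(1)])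
  from Cons.prems(2) have x: "snd x \<in> gpart L (fst x)" and w: "w \<in> words L" by (auto simp: words_Cons)
  have 1: "d (conv q (\<lambda>u. f (x # u)) g w) = conv q (\<lambda>u. d (f (x # u))) g w
      + signed (p + ?e) (conv (q + 1) (\<lambda>u. f (x # u)) (\<lambda>u. d (g u)) w)"
    using x w Cons.prems(1)[of "x # _"] by (intro Cons.IH) (auto simp: words_Cons wdeg_Cons add.assoc)
  have 2: "d (conv (q + ?e) f (\<lambda>u. g (x # u)) w) = conv (q + ?e) (\<lambda>u. d (f u)) (\<lambda>u. g (x # u)) w
      + signed p (conv (q + ?e + 1) f (\<lambda>u. d (g (x # u))) w)"
    using x w Cons.prems(1)[of _ "x # _"] by (intro Cons.IH) (auto simp: words_Cons wdeg_Cons)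
  have 3: "q + ?e + 1 = q + 1 + ?e" by simp
  show ?case
    by (simp add: conv_Cons assms(1) d 1 2[unfolded 3])
      (cases "even p"; cases "even q"; cases "even ?e"; simp add: signed_def)
qed (simp add: conv_Nil)

text \<open>
  The derivation \<open>\<delta>\<close> on cochains of degree \<open>p\<close>, for values in any ring with a derivation \<open>d\<close>.
\<close>
definition cdelta :: "('k, 'l, 'z) dgla_scheme \<Rightarrow> ('b::ring \<Rightarrow> 'b) \<Rightarrow> int \<Rightarrow> ('l word \<Rightarrow> 'b) \<Rightarrow> 'l word \<Rightarrow> 'b" where
  "cdelta L d p f w = d (f w) - signed p (Q_transpose L f w)"

lemma cdelta_conv:
  assumes "\<And>a b. d (a + b) = d a + d b"
    and "\<And>u v. u \<in> words L \<Longrightarrow> v \<in> words L \<Longrightarrow>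
       d (f u * g v) = d (f u) * g v + signed (p + wdeg u) (f u * d (g v))"
    and "w \<in> words L"
  shows "cdelta L d (p + q) (conv q f g) w =
     conv q (cdelta L d p f) g w + signed p (conv (q + 1) f (cdelta L d q g) w)"
proof -
  have "d (conv q f g w) = conv q (\<lambda>u. d (f u)) g w + signed p (conv (q + 1) f (\<lambda>u. d (g u)) w)"
    using assms by (rule derivation_conv)
  then show ?thesis
    unfolding cdelta_def Q_transpose_conv
    by (simp add: conv_diff_left conv_diff_right conv_signed_left conv_signed_right)
      (cases "even p"; cases "even q"; simp add: signed_def)
qed

lemma ad_transpose_zero: "ad_transpose L m x (\<lambda>u. 0) w = 0"
  by (induction w) (simp_all add: ad_transpose_Cons)

lemma Q_transpose_zero: "Q_transpose L (\<lambda>u. 0) w = 0"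
  by (induction w) (simp_all add: Q_transpose_Cons ad_transpose_zero)

lemma Q_transpose_const_cochain: "Q_transpose L (const_cochain a) w = 0"
proof (cases w)
  case (Cons x v)
  have "ad_transpose L m y (const_cochain a) v = 0" for m y
    by (cases v) (simp_all add: ad_transpose_Cons const_cochain_def ad_transpose_zero)
  then show ?thesis
    by (simp add: Cons Q_transpose_Cons) (simp add: const_cochain_def Q_transpose_zero)
qed simp

section \<open>Symmetric multilinear cochains\<close>

locale graded_ring = vector_space sc
  for sc :: "'k::field \<Rightarrow> 'b::ring \<Rightarrow> 'b" +
  fixes G :: "int \<Rightarrow> 'b set"
  assumes scale_mult_left: "sc c (a * b) = sc c a * b"
    and scale_mult_right: "sc c (a * b) = a * sc c b"
    and subspace_G: "subspace (G n)"
    and mult_G: "a \<in> G i \<Longrightarrow> b \<in> G j \<Longrightarrow> a * b \<in> G (i + j)"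
begin

abbreviation V :: "('k, 'b) gvs" where
  "V \<equiv> \<lparr>gpart = G, gzero = 0, gadd = (+), gsmult = sc\<rparr>"

lemma gsum_V: "gsum V h S = sum h S"
  by (simp add: gsum_def sum.eq_fold comp_def)

lemma add_closed_subspace: "subspace S \<Longrightarrow> add_closed S"
  by (simp add: add_closed_def subspace_0 subspace_diff)

lemma Hom_S_iff:
  "f \<in> Hom_S p L V \<longleftrightarrow>
     (\<forall>xs\<in>words L. f xs \<in> G (p + wdeg xs)) \<and>
     (\<forall>us\<in>words L. \<forall>vs\<in>words L. \<forall>n. \<forall>x\<in>gpart L n. \<forall>y\<in>gpart L n.
        f (us @ (n, gadd L x y) # vs) = f (us @ (n, x) # vs) + f (us @ (n, y) # vs)) \<and>
     (\<forall>us\<in>words L. \<forall>vs\<in>words L. \<forall>n c. \<forall>x\<in>gpart L n.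
        f (us @ (n, gsmult L c x) # vs) = sc c (f (us @ (n, x) # vs))) \<and>
     (\<forall>us\<in>words L. \<forall>vs\<in>words L. \<forall>n m. \<forall>x\<in>gpart L n. \<forall>y\<in>gpart L m.
        f (us @ (n, x) # (m, y) # vs) = signed ((n - 1) * (m - 1)) (f (us @ (m, y) # (n, x) # vs)))"
  by (simp only: Hom_S_def gvs.simps mem_Collect_eq scale_powi_minus_one)

lemma Hom_S_D:
  assumes "f \<in> Hom_S p L V"
  shows Hom_S_degree: "xs \<in> words L \<Longrightarrow> f xs \<in> G (p + wdeg xs)"
    and Hom_S_add: "us \<in> words L \<Longrightarrow> vs \<in> words L \<Longrightarrow> x \<in> gpart L n \<Longrightarrow> y \<in> gpart L n \<Longrightarrow>
        f (us @ (n, gadd L x y) # vs) = f (us @ (n, x) # vs) + f (us @ (n, y) # vs)"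
    and Hom_S_scale: "us \<in> words L \<Longrightarrow> vs \<in> words L \<Longrightarrow> x \<in> gpart L n \<Longrightarrow>
        f (us @ (n, gsmult L c x) # vs) = sc c (f (us @ (n, x) # vs))"
    and Hom_S_swap: "us \<in> words L \<Longrightarrow> vs \<in> words L \<Longrightarrow> x \<in> gpart L n \<Longrightarrow> y \<in> gpart L m \<Longrightarrow>
        f (us @ (n, x) # (m, y) # vs) = signed ((n - 1) * (m - 1)) (f (us @ (m, y) # (n, x) # vs))"
  using assms unfolding Hom_S_iff by blast+

lemma Hom_S_I:
  assumes "\<And>xs. xs \<in> words L \<Longrightarrow> f xs \<in> G (p + wdeg xs)"
    and "\<And>us vs n x y. us \<in> words L \<Longrightarrow> vs \<in> words L \<Longrightarrow> x \<in> gpart L n \<Longrightarrow> y \<in> gpart L n \<Longrightarrow>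
        f (us @ (n, gadd L x y) # vs) = f (us @ (n, x) # vs) + f (us @ (n, y) # vs)"
    and "\<And>us vs n x c. us \<in> words L \<Longrightarrow> vs \<in> words L \<Longrightarrow> x \<in> gpart L n \<Longrightarrow>
        f (us @ (n, gsmult L c x) # vs) = sc c (f (us @ (n, x) # vs))"
    and "\<And>us vs n m x y. us \<in> words L \<Longrightarrow> vs \<in> words L \<Longrightarrow> x \<in> gpart L n \<Longrightarrow> y \<in> gpart L m \<Longrightarrow>
        f (us @ (n, x) # (m, y) # vs) = signed ((n - 1) * (m - 1)) (f (us @ (m, y) # (n, x) # vs))"
  shows "f \<in> Hom_S p L V"
  unfolding Hom_S_iff using assms by blast

lemma Hom_S_tail:
  assumes f: "f \<in> Hom_S p L V" and z: "snd z \<in> gpart L (fst z)"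
  shows "(\<lambda>u. f (z # u)) \<in> Hom_S (p + (fst z - 1)) L V"
proof (rule Hom_S_I)
  have w: "z # us \<in> words L" if "us \<in> words L" for us using z that by (simp add: words_Cons)
  show "f (z # xs) \<in> G (p + (fst z - 1) + wdeg xs)" if "xs \<in> words L" for xs
    using Hom_S_degree[OF f w[OF that]] by (simp add: wdeg_Cons add.assoc)
  fix us vs n m x y c
  assume us: "us \<in> words L" and vs: "vs \<in> words L" and x: "x \<in> gpart L n"
  show "f (z # us @ (n, gsmult L c x) # vs) = sc c (f (z # us @ (n, x) # vs))"
    using Hom_S_scale[OF f w[OF us] vs x] by simp
  show "f (z # us @ (n, gadd L x y) # vs) = f (z # us @ (n, x) # vs) + f (z # us @ (n, y) # vs)"
    if "y \<in> gpart L n"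
    using Hom_S_add[OF f w[OF us] vs x that] by simp
  show "f (z # us @ (n, x) # (m, y) # vs) = signed ((n - 1) * (m - 1)) (f (z # us @ (m, y) # (n, x) # vs))"
    if "y \<in> gpart L m"
    by (rule Hom_S_swap[OF f w[OF us] vs x that, unfolded append_Cons])
qed

text \<open>
  Each condition is checked by peeling off the letters in front of the position concerned. Symmetry in
  the first two letters follows by applying the recursion twice: the terms in which both letters go to
  one factor use the symmetry of this factor, and the two mixed terms are exchanged.
\<close>
lemma conv_Hom_S:
  assumes "f \<in> Hom_S p L V" and "g \<in> Hom_S q L V"
  shows "conv q f g \<in> Hom_S (p + q) L V"
proof (rule Hom_S_I)
  fix xs assume xs: "xs \<in> words L"
  show "conv q f g xs \<in> G (p + q + wdeg xs)"
  proof (rule conv_mem[OF add_closed_subspace[OF subspace_G] _ xs])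
    fix u v assume u: "u \<in> words L" and v: "v \<in> words L" and d: "wdeg u + wdeg v = wdeg xs"
    have "f u * g v \<in> G (p + wdeg u + (q + wdeg v))"
      by (rule mult_G[OF Hom_S_degree[OF assms(1) u] Hom_S_degree[OF assms(2) v]])
    also have "p + wdeg u + (q + wdeg v) = p + q + wdeg xs" using d by simp
    finally show "f u * g v \<in> G (p + q + wdeg xs)" .
  qed
next
  fix us vs n x y assume "us \<in> words L" and vs: "vs \<in> words L" and x: "x \<in> gpart L n" and y: "y \<in> gpart L n"
  then show "conv q f g (us @ (n, gadd L x y) # vs) = conv q f g (us @ (n, x) # vs) + conv q f g (us @ (n, y) # vs)"
    using assms
  proof (induction us arbitrary: p q f g)
    case Nil
    note add = Hom_S_add[OF _ words_Nil _ x y, unfolded append_Nil]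
    have "conv q (\<lambda>u. f ((n, gadd L x y) # u)) g vs = conv q (\<lambda>u. f ((n, x) # u) + f ((n, y) # u)) g vs"
      "conv r f (\<lambda>u. g ((n, gadd L x y) # u)) vs = conv r f (\<lambda>u. g ((n, x) # u) + g ((n, y) # u)) vs" for r
      by (rule conv_cong[OF _ _ vs]; simp add: add[OF Nil(5)] add[OF Nil(6)])+
    then show ?case by (simp add: conv_Cons conv_add_left conv_add_right signed_add)
  next
    case (Cons z us)
    then have z: "snd z \<in> gpart L (fst z)" and us: "us \<in> words L" by (auto simp: words_Cons)
    note t = Hom_S_tail[OF Cons.prems(5) z] Hom_S_tail[OF Cons.prems(6) z]
    show ?case
      using Cons.IH[OF us vs x y t(1) Cons.prems(6)] Cons.IH[OF us vs x y Cons.prems(5) t(2)]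
      by (simp add: conv_Cons signed_add)
  qed
next
  fix us vs n x c assume "us \<in> words L" and vs: "vs \<in> words L" and x: "x \<in> gpart L n"
  then show "conv q f g (us @ (n, gsmult L c x) # vs) = sc c (conv q f g (us @ (n, x) # vs))"
    using assms
  proof (induction us arbitrary: p q f g)
    case Nil
    note scale = Hom_S_scale[OF _ words_Nil _ x, unfolded append_Nil]
    have "sc c (conv q (\<lambda>u. f ((n, x) # u)) g vs) = conv q (\<lambda>u. f ((n, gsmult L c x) # u)) g vs"
      using scale Nil by (intro conv_map[where L = L] vs) (auto simp: scale_right_distrib scale_mult_left)
    moreover have "sc c (conv r f (\<lambda>u. g ((n, x) # u)) vs) = conv r f (\<lambda>u. g ((n, gsmult L c x) # u)) vs" for r
      using scale Nil by (intro conv_map[where L = L] vs) (auto simp: scale_right_distrib scale_mult_right)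
    ultimately show ?case by (simp add: conv_Cons scale_right_distrib signed_def)
  next
    case (Cons z us)
    then have z: "snd z \<in> gpart L (fst z)" and us: "us \<in> words L" by (auto simp: words_Cons)
    note t = Hom_S_tail[OF Cons.prems(4) z] Hom_S_tail[OF Cons.prems(5) z]
    show ?case
      using Cons.IH[OF us vs x t(1) Cons.prems(5)] Cons.IH[OF us vs x Cons.prems(4) t(2)]
      by (simp add: conv_Cons scale_right_distrib signed_def)
  qed
next
  fix us vs n m x y assume "us \<in> words L" and vs: "vs \<in> words L" and x: "x \<in> gpart L n" and y: "y \<in> gpart L m"
  then show "conv q f g (us @ (n, x) # (m, y) # vs) =
      signed ((n - 1) * (m - 1)) (conv q f g (us @ (m, y) # (n, x) # vs))"
    using assms
  proof (induction us arbitrary: p q f g)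
    case Nil
    note swap = Hom_S_swap[OF _ words_Nil _ x y, unfolded append_Nil]
    have 1: "conv q (\<lambda>u. f ((n, x) # (m, y) # u)) g vs =
        conv q (\<lambda>u. signed ((n - 1) * (m - 1)) (f ((m, y) # (n, x) # u))) g vs" for q
      by (rule conv_cong[OF swap[OF Nil(5)] refl vs])
    have 2: "conv q f (\<lambda>u. g ((n, x) # (m, y) # u)) vs =
        conv q f (\<lambda>u. signed ((n - 1) * (m - 1)) (g ((m, y) # (n, x) # u))) vs" for q
      by (rule conv_cong[OF refl swap[OF Nil(6)] vs])
    show ?case
      by (simp add: conv_Cons 1 2 conv_signed_left conv_signed_right algebra_simps)
        (cases "even q"; cases "even n"; cases "even m"; simp add: signed_def)
  next
    case (Cons z us)
    then have z: "snd z \<in> gpart L (fst z)" and us: "us \<in> words L" by (auto simp: words_Cons)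
    note t = Hom_S_tail[OF Cons.prems(5) z] Hom_S_tail[OF Cons.prems(6) z]
    show ?case
      using Cons.IH[OF us vs x y t(1) Cons.prems(6)] Cons.IH[OF us vs x y Cons.prems(5) t(2)]
      by (simp add: conv_Cons signed_add signed_signed add.commute)
  qed
qed

lemma comp_Q0_Cons:
  "comp_Q0 L V f (x # w) = - f ((fst x + 1, gdiff L (snd x)) # w) +
     signed (fst x - 1) (comp_Q0 L V (\<lambda>u. f (x # u)) w)"
proof -
  have "(\<Sum>i<length w. sc ((-1) powi (int (Suc i) + 1 + (\<Sum>j<Suc i. fst ((x # w) ! j)))) (h i)) =
      signed (fst x - 1) (\<Sum>i<length w. sc ((-1) powi (int i + 1 + (\<Sum>j<i. fst (w ! j)))) (h i))" for h
  proof -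
    have "signed (int (Suc i) + 1 + (\<Sum>j<Suc i. fst ((x # w) ! j))) a =
      signed (fst x - 1) (signed (int i + 1 + (\<Sum>j<i. fst (w ! j))) a)" for i and a :: 'b
      by (simp add: sum.lessThan_Suc_shift signed_signed del: sum.lessThan_Suc) (rule signed_cong, simp)
    then have "(\<Sum>i<length w. sc ((-1) powi (int (Suc i) + 1 + (\<Sum>j<Suc i. fst ((x # w) ! j)))) (h i)) =
       (\<Sum>i<length w. signed (fst x - 1) (sc ((-1) powi (int i + 1 + (\<Sum>j<i. fst (w ! j)))) (h i)))"
      unfolding scale_powi_minus_one by simp
    then show ?thesis by (simp add: signed_def sum_negf)
  qed
  from this[of "\<lambda>i. f (x # w[i := (fst (w ! i) + 1, gdiff L (snd (w ! i)))])"]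
  show ?thesis
    unfolding comp_Q0_def gsum_V gvs.simps
    by (simp only: length_Cons sum.lessThan_Suc_shift[of _ "length w"])
      (simp add: scale_powi_minus_one signed_def del: sum.lessThan_Suc)
qed

text \<open>
  The summand of \<open>Q\<^sub>1\<close> for the unshuffle that moves the two positions in \<open>S\<close> to the front.
\<close>
definition Q1_term where
  "Q1_term L f xs S = (let (m, x) = nths xs S ! 0; (n, y) = nths xs S ! 1 in
     sc (subset_sign S xs * (-1) powi m) (f ((m + n, gbracket L m n x y) # nths xs (- S))))"

lemma comp_Q1_eq_sum_subsets:
  "comp_Q1 L V f xs = (\<Sum>S\<in>{S \<in> Pow {..<length xs}. card S = 2}. Q1_term L f xs S)"
proof -
  have "comp_Q1 L V f xs = (\<Sum>\<tau>\<in>unshuffles 2 (length xs). Q1_term L f xs (\<tau> ` {..<2}))"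
    unfolding comp_Q1_def gsum_V
  proof (intro sum.cong refl)
    fix \<tau> assume t: "\<tau> \<in> unshuffles 2 (length xs)"
    have "permute_list \<tau> xs ! i = nths xs (\<tau> ` {..<2}) ! i" if "i < 2" for i
      using that by (simp flip: unshuffle_nths(1)[OF t])
    then show "(let ys = permute_list \<tau> xs; (m, x) = ys ! 0; (n, y) = ys ! 1
        in gsmult V (koszul \<tau> xs * (-1) powi m) (f ((m + n, gbracket L m n x y) # drop 2 ys))) =
        Q1_term L f xs (\<tau> ` {..<2})"
      by (simp add: Q1_term_def Let_def koszul_unshuffle[OF t] unshuffle_nths(2)[OF t])
  qed
  also have "\<dots> = (\<Sum>S\<in>{S. S \<subseteq> {..<length xs} \<and> card S = 2}. Q1_term L f xs S)"
    by (rule sum.reindex_bij_betw[OF bij_betw_unshuffles])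
  finally show ?thesis by (simp add: Pow_def)
qed

lemma nths_single: "j < length w \<Longrightarrow> nths w {j} = [w ! j]"
proof (induction w arbitrary: j)
  case (Cons x w)
  have "{i. Suc i \<in> {Suc j'}} = {j'}" for j' by auto
  with Cons show ?case by (cases j) (auto simp: nths_Cons)
qed simp

lemma subset_sign_empty: "subset_sign {} xs = 1"
  by (simp add: subset_sign_def)

text \<open>
  The subsets that contain the first position: \<open>Q\<^sub>1\<close> puts \<open>[x, w\<^sub>j]\<close> in front, and graded symmetry of \<open>f\<close>
  moves it back to the place of \<open>w\<^sub>j\<close>. The letters in between contribute the sign for being passed by
  \<open>w\<^sub>j\<close> and the sign for being passed by \<open>[x, w\<^sub>j]\<close>; in the product the degree of \<open>w\<^sub>j\<close> cancels.
\<close>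
lemma sum_bracket_eq_ad_transpose:
  assumes L: "is_dgla L" and x: "x \<in> gpart L m" and "f \<in> Hom_S p L V" and "w \<in> words L"
  shows "(\<Sum>j<length w. sc (subset_sign {j} w)
      (f ((m + fst (w ! j), gbracket L m (fst (w ! j)) x (snd (w ! j))) # nths w (- {j})))) =
    ad_transpose L m x f w"
  using assms(3,4)
proof (induction w arbitrary: f p)
  case (Cons y w)
  then have y: "snd y \<in> gpart L (fst y)" and w: "w \<in> words L" by (auto simp: words_Cons)
  have e: "{i. Suc i \<in> {0}} = {}" "{i. Suc i \<in> - {0}} = UNIV"
    "{i. Suc i \<in> {Suc j}} = {j}" "{i. Suc i \<in> - {Suc j}} = - {j}" for j by auto
  have 1: "sc (subset_sign {Suc j} (y # w))
      (f ((m + fst (w ! j), gbracket L m (fst (w ! j)) x (snd (w ! j))) # y # nths w (- {j}))) =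
    signed (m * (fst y - 1)) (sc (subset_sign {j} w)
      (f (y # (m + fst (w ! j), gbracket L m (fst (w ! j)) x (snd (w ! j))) # nths w (- {j}))))"
    if j: "j < length w" for j
  proof -
    have wj: "snd (w ! j) \<in> gpart L (fst (w ! j))" using w j by (auto simp: words_def dest!: nth_mem)
    have nw: "nths w (- {j}) \<in> words L" using w set_nths_subset[of w] by (fastforce simp: words_def)
    let ?b = "gbracket L m (fst (w ! j)) x (snd (w ! j))"
    have "f ((m + fst (w ! j), ?b) # y # nths w (- {j})) =
        signed ((m + fst (w ! j) - 1) * (fst y - 1)) (f (y # (m + fst (w ! j), ?b) # nths w (- {j})))"
      using Hom_S_swap[OF Cons.prems(1) words_Nil nw dgla_bracket_closed[OF L x wj] y]
      by (simp only: append_Nil prod.collapse)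
    moreover have "sc (subset_sign {Suc j} (y # w)) a =
        signed ((fst y - 1) * (fst (w ! j) - 1)) (sc (subset_sign {j} w) a)" for a
      using j by (simp add: subset_sign_Cons e nths_single wdeg_Cons mult.commute flip: scale_powi_minus_one)
    ultimately show ?thesis
      by (simp add: signed_def)
  qed
  have 2: "nths (y # w) (- {0}) = w" by (simp add: nths_Cons e nths_all)
  have 3: "nths (y # w) (- {Suc j}) = y # nths w (- {j})" for j unfolding nths_Cons e by simp
  have 4: "(\<Sum>j<n. signed r (h j)) = signed r (\<Sum>j<n. h j)" for n :: nat and r and h :: "nat \<Rightarrow> 'b"
    by (simp add: signed_def sum_negf)
  show ?case
    unfolding length_Cons sum.lessThan_Suc_shift nth_Cons_0 nth_Cons_Suc 2 3 ad_transpose_Cons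
      Cons.IH[OF Hom_S_tail[OF Cons.prems(1) y] w, symmetric] 4[symmetric]
    by (intro arg_cong2[where f = "(+)"] sum.cong refl; (subst 1)?)
      (simp_all add: subset_sign_Cons e subset_sign_empty)
qed simp

text \<open>
  The subsets of two positions are split according to whether they contain the first position. If not,
  graded symmetry of \<open>f\<close> exchanges the bracket with the first letter.
\<close>
lemma comp_Q1_Cons:
  assumes L: "is_dgla L" and f: "f \<in> Hom_S p L V" and xw: "x # w \<in> words L"
  shows "comp_Q1 L V f (x # w) = signed (fst x) (ad_transpose L (fst x) (snd x) f w) +
     signed (fst x - 1) (comp_Q1 L V (\<lambda>u. f (x # u)) w)"
proof -
  from xw have x: "snd x \<in> gpart L (fst x)" and w: "w \<in> words L" by (auto simp: words_Cons)
  let ?n = "length w"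
  have c: "card (Suc ` S) = card S" for S by (simp add: card_image)
  have c0: "card (insert 0 (Suc ` S)) = Suc (card S)" if "S \<in> Pow {..<?n}" for S
    using that finite_subset[of S "{..<?n}"] by (simp add: card_image)
  have e: "{j. Suc j \<in> insert 0 (Suc ` S)} = S" "{j. Suc j \<in> - insert 0 (Suc ` S)} = - S"
    "{j. Suc j \<in> Suc ` S} = S" "{j. Suc j \<in> - Suc ` S} = - S" for S by auto
  have "comp_Q1 L V f (x # w) = (\<Sum>S\<in>Pow {..<Suc ?n}. if card S = 2 then Q1_term L f (x # w) S else 0)"
    unfolding comp_Q1_eq_sum_subsets length_Cons by (rule sum.inter_filter) simp
  also have "\<dots> = (\<Sum>S\<in>Pow {..<?n}. if card S = 1 then Q1_term L f (x # w) (insert 0 (Suc ` S)) else 0) +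
      (\<Sum>S\<in>Pow {..<?n}. if card S = 2 then Q1_term L f (x # w) (Suc ` S) else 0)"
    unfolding sum_Pow_lessThan_Suc c
    by (intro arg_cong2[where f = "(+)"] sum.cong refl) (simp_all add: c0)
  also have "(\<Sum>S\<in>Pow {..<?n}. if card S = 2 then Q1_term L f (x # w) (Suc ` S) else 0) =
      (\<Sum>S\<in>{S \<in> Pow {..<?n}. card S = 2}. Q1_term L f (x # w) (Suc ` S))"
    by (rule sum.inter_filter[symmetric]) simp
  also have "\<dots> = (\<Sum>S\<in>{S \<in> Pow {..<?n}. card S = 2}. signed (fst x - 1) (Q1_term L (\<lambda>u. f (x # u)) w S))"
  proof (intro sum.cong refl)
    fix S assume S: "S \<in> {S \<in> Pow {..<?n}. card S = 2}"
    then have "{i. i < ?n \<and> i \<in> S} = S" by auto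
    with S have "length (nths w S) = Suc (Suc 0)" by (simp add: length_nths)
    then obtain a b where ab: "nths w S = [a, b]" by (auto simp: length_Suc_conv)
    have "set (nths w S) \<subseteq> set w" by (rule set_nths_subset)
    then have a: "snd a \<in> gpart L (fst a)" and b: "snd b \<in> gpart L (fst b)"
      using w unfolding ab by (auto simp: words_def)
    have nw: "nths w (- S) \<in> words L" using w set_nths_subset[of w] by (fastforce simp: words_def)
    let ?b = "gbracket L (fst a) (fst b) (snd a) (snd b)"
    have "f ((fst a + fst b, ?b) # x # nths w (- S)) =
        signed ((fst a + fst b - 1) * (fst x - 1)) (f (x # (fst a + fst b, ?b) # nths w (- S)))"
      using Hom_S_swap[OF f words_Nil nw dgla_bracket_closed[OF L a b] x]
      by (simp only: append_Nil prod.collapse)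
    moreover have "sc (subset_sign (Suc ` S) (x # w) * r) t =
        signed ((fst x - 1) * (fst a + fst b)) (sc (subset_sign S w * r) t)" for r t
    proof -
      have "(-1 :: 'k) powi ((fst x - 1) * (fst a - 1 + (fst b - 1))) = (-1) powi ((fst x - 1) * (fst a + fst b))"
        by (simp add: power_int_minus_left)
      then show ?thesis
        by (simp add: subset_sign_Cons e wdeg_Cons ab mult.assoc flip: scale_powi_minus_one)
    qed
    ultimately show "Q1_term L f (x # w) (Suc ` S) = signed (fst x - 1) (Q1_term L (\<lambda>u. f (x # u)) w S)"
      unfolding Q1_term_def nths_Cons e
      by (simp add: ab case_prod_beta) (auto simp: signed_def)
  qed
  also have "\<dots> = signed (fst x - 1) (comp_Q1 L V (\<lambda>u. f (x # u)) w)"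
    by (simp add: comp_Q1_eq_sum_subsets signed_def sum_negf)
  also have "(\<Sum>S\<in>Pow {..<?n}. if card S = 1 then Q1_term L f (x # w) (insert 0 (Suc ` S)) else 0) =
      (\<Sum>S\<in>(\<lambda>j. {j}) ` {..<?n}. Q1_term L f (x # w) (insert 0 (Suc ` S)))"
  proof -
    have "{S \<in> Pow {..<?n}. card S = 1} = (\<lambda>j. {j}) ` {..<?n}" by (auto simp: card_1_singleton_iff)
    then show ?thesis by (simp only: flip: sum.inter_filter[OF finite_Pow_iff[THEN iffD2, OF finite_lessThan]])
  qed
  also have "\<dots> = (\<Sum>j<?n. Q1_term L f (x # w) (insert 0 (Suc ` {j})))"
    by (simp add: sum.reindex)
  also have "\<dots> = (\<Sum>j<?n. signed (fst x) (sc (subset_sign {j} w)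
      (f ((fst x + fst (w ! j), gbracket L (fst x) (fst (w ! j)) (snd x) (snd (w ! j))) # nths w (- {j})))))"
    unfolding Q1_term_def nths_Cons subset_sign_Cons e
    by (intro sum.cong refl)
      (simp add: nths_single case_prod_beta mult.commute[of _ "(-1) powi _"] flip: scale_powi_minus_one)
  also have "\<dots> = signed (fst x) (ad_transpose L (fst x) (snd x) f w)"
    unfolding sum_bracket_eq_ad_transpose[OF L x f w, symmetric] by (simp add: signed_def sum_negf)
  finally show ?thesis .
qed

text \<open>
  On symmetric cochains the coderivation given by unshuffles satisfies the recursion of \<open>Q_transpose\<close>.
\<close>
lemma comp_Q_eq_Q_transpose:
  assumes L: "is_dgla L" and "f \<in> Hom_S p L V" and "w \<in> words L"
  shows "comp_Q L V f w = Q_transpose L f w"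
  using assms(2,3)
proof (induction w arbitrary: f p)
  case Nil
  have "unshuffles 2 0 = {}" by (auto simp: unshuffles_def)
  then show ?case by (simp add: comp_Q_def comp_Q0_def comp_Q1_def gsum_V)
next
  case (Cons x w)
  then have x: "snd x \<in> gpart L (fst x)" and w: "w \<in> words L" by (auto simp: words_Cons)
  show ?case
    using Cons.IH[OF Hom_S_tail[OF Cons.prems(1) x] w]
    by (simp add: comp_Q_def comp_Q0_Cons comp_Q1_Cons[OF L Cons.prems] Q_transpose_Cons signed_add
        flip: Cons.IH[OF Hom_S_tail[OF Cons.prems(1) x] w])
qed

lemma Hom_S_cong:
  assumes L: "is_dgla L" and g: "g \<in> Hom_S p L V" and e: "\<And>w. w \<in> words L \<Longrightarrow> f w = g w"
  shows "f \<in> Hom_S p L V"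
proof (rule Hom_S_I)
  show "f xs \<in> G (p + wdeg xs)" if "xs \<in> words L" for xs
    using Hom_S_degree[OF g that] e[OF that] by simp
  fix us vs n m x y c
  assume us: "us \<in> words L" and vs: "vs \<in> words L" and x: "x \<in> gpart L n"
  have w: "us @ (n, z) # vs \<in> words L" if "z \<in> gpart L n" for z
    using us vs that by (simp add: words_append words_Cons)
  show "f (us @ (n, gsmult L c x) # vs) = sc c (f (us @ (n, x) # vs))"
    unfolding e[OF w[OF dgla_gsmult_closed[OF L x]]] e[OF w[OF x]] by (rule Hom_S_scale[OF g us vs x])
  show "f (us @ (n, gadd L x y) # vs) = f (us @ (n, x) # vs) + f (us @ (n, y) # vs)" if y: "y \<in> gpart L n"
    unfolding e[OF w[OF dgla_gadd_closed[OF L x y]]] e[OF w[OF x]] e[OF w[OF y]]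
    by (rule Hom_S_add[OF g us vs x y])
  show "f (us @ (n, x) # (m, y) # vs) = signed ((n - 1) * (m - 1)) (f (us @ (m, y) # (n, x) # vs))"
    if y: "y \<in> gpart L m"
  proof -
    have "us @ (n, x) # (m, y) # vs \<in> words L" "us @ (m, y) # (n, x) # vs \<in> words L"
      using us vs x y by (simp_all add: words_append words_Cons)
    then show ?thesis using Hom_S_swap[OF g us vs x y] e by simp
  qed
qed

lemma Hom_S_map:
  assumes f: "f \<in> Hom_S p L V" and "\<And>a b. h (a + b) = h a + h b" and "\<And>c a. h (sc c a) = sc c (h a)"
    and "\<And>n a. a \<in> G n \<Longrightarrow> h a \<in> G (n + r)"
  shows "(\<lambda>w. h (f w)) \<in> Hom_S (p + r) L V"
proof (rule Hom_S_I)
  show "h (f xs) \<in> G (p + r + wdeg xs)" if "xs \<in> words L" for xs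
    using assms(4)[OF Hom_S_degree[OF f that]] by (simp add: add_ac)
  fix us vs n m x y c
  assume us: "us \<in> words L" and vs: "vs \<in> words L" and x: "x \<in> gpart L n"
  show "h (f (us @ (n, gsmult L c x) # vs)) = sc c (h (f (us @ (n, x) # vs)))"
    by (simp add: Hom_S_scale[OF f us vs x] assms(3))
  show "h (f (us @ (n, gadd L x y) # vs)) = h (f (us @ (n, x) # vs)) + h (f (us @ (n, y) # vs))"
    if y: "y \<in> gpart L n"
    by (simp add: Hom_S_add[OF f us vs x y] assms(2))
  show "h (f (us @ (n, x) # (m, y) # vs)) = signed ((n - 1) * (m - 1)) (h (f (us @ (m, y) # (n, x) # vs)))"
    if y: "y \<in> gpart L m"
    unfolding Hom_S_swap[OF f us vs x y] by (rule additive_signed(3)[of h, OF assms(2)])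
qed

lemma Hom_S_zero: "(\<lambda>w. 0) \<in> Hom_S p L V"
  by (rule Hom_S_I) (simp_all add: subspace_0[OF subspace_G])

lemma Hom_S_plus:
  assumes f: "f \<in> Hom_S p L V" and g: "g \<in> Hom_S p L V"
  shows "(\<lambda>w. f w + g w) \<in> Hom_S p L V"
proof (rule Hom_S_I)
  show "f xs + g xs \<in> G (p + wdeg xs)" if "xs \<in> words L" for xs
    using Hom_S_degree[OF f that] Hom_S_degree[OF g that] by (rule subspace_add[OF subspace_G])
  fix us vs n m x y c
  assume us: "us \<in> words L" and vs: "vs \<in> words L" and x: "x \<in> gpart L n"
  show "f (us @ (n, gsmult L c x) # vs) + g (us @ (n, gsmult L c x) # vs) =
      sc c (f (us @ (n, x) # vs) + g (us @ (n, x) # vs))"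
    by (simp add: Hom_S_scale[OF f us vs x] Hom_S_scale[OF g us vs x] scale_right_distrib)
  show "f (us @ (n, gadd L x y) # vs) + g (us @ (n, gadd L x y) # vs) =
      f (us @ (n, x) # vs) + g (us @ (n, x) # vs) + (f (us @ (n, y) # vs) + g (us @ (n, y) # vs))"
    if y: "y \<in> gpart L n"
    by (simp add: Hom_S_add[OF f us vs x y] Hom_S_add[OF g us vs x y])
  show "f (us @ (n, x) # (m, y) # vs) + g (us @ (n, x) # (m, y) # vs) =
      signed ((n - 1) * (m - 1)) (f (us @ (m, y) # (n, x) # vs) + g (us @ (m, y) # (n, x) # vs))"
    if y: "y \<in> gpart L m"
    unfolding Hom_S_swap[OF f us vs x y] Hom_S_swap[OF g us vs x y] by (simp add: signed_add)
qed

lemma Hom_S_sum: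
  assumes "\<And>i. i \<in> J \<Longrightarrow> f i \<in> Hom_S p L V"
  shows "(\<lambda>w. \<Sum>i\<in>J. f i w) \<in> Hom_S p L V"
  using assms by (induction J rule: infinite_finite_induct) (simp_all add: Hom_S_zero Hom_S_plus)

lemma const_cochain_Hom_S: "a \<in> G p \<Longrightarrow> const_cochain a \<in> Hom_S p L V"
  by (rule Hom_S_I) (simp_all add: const_cochain_def subspace_0[OF subspace_G])

end

section \<open>The quotients of a curved DG-algebra\<close>

lemma elt_set_plus_mem: "b \<in> a +o U \<longleftrightarrow> b - a \<in> U" for a b :: "'a::ab_group_add"
  by (auto simp: elt_set_plus_def algebra_simps intro: bexI[of _ "b - a"])

text \<open>
  The operations of a quotient are unions over representatives; this reduces them to one representative.
\<close>
lemma UN_eqI: "a \<in> X \<Longrightarrow> (\<And>x. x \<in> X \<Longrightarrow> F x = c) \<Longrightarrow> (\<Union>x\<in>X. F x) = c"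
  by auto

lemma is_complex_extend: "is_complex (dgvs.extend V m) \<longleftrightarrow> is_complex V"
  unfolding is_complex_def graded_vector_space_def graded_linear_def dgvs.defs by simp

locale curved_ideal =
  fixes A :: "('k::field, 'a::{ring, monoid_mult}) cdga" and I :: "'a set"
  assumes curved_algebra: "curved_dg_algebra A" and curved_ideal: "curved_Lie_ideal A I"
begin

lemma graded_algebra: "graded_algebra A"
  using curved_algebra by (simp add: curved_dg_algebra_def)

sublocale graded_ring "scal A" "gr A"
proof -
  interpret vector_space "scal A" using graded_algebra by (simp add: graded_algebra_def)
  show "graded_ring (scal A) (gr A)"
  proof unfold_locales
    have m: "\<forall>c a b. scal A c (a * b) = scal A c a * b \<and> scal A c (a * b) = a * scal A c b"
      and g: "\<forall>n. subspace (gr A n)" "\<forall>i j. \<forall>a\<in>gr A i. \<forall>b\<in>gr A j. a * b \<in> gr A (i + j)"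
      using graded_algebra unfolding graded_algebra_def by - (elim conjE, assumption)+
    show "scal A c (a * b) = scal A c a * b" for c a b
      using m by blast
    show "scal A c (a * b) = a * scal A c b" for c a b
      using m by blast
    show "subspace (gr A n)" for n using g(1) ..
    show "a * b \<in> gr A (i + j)" if "a \<in> gr A i" "b \<in> gr A j" for a b i j
      using g(2) that by blast
  qed
qed

lemma one_mem_gr: "1 \<in> gr A 0" using graded_algebra by (simp add: graded_algebra_def)

lemma gvs_of_eq: "gvs_of A = V" by (simp add: gvs_of_def)

sublocale der: Vector_Spaces.linear "scal A" "scal A" "der A"
  using curved_algebra by (simp add: curved_dg_algebra_def)

lemma der_gr: "a \<in> gr A n \<Longrightarrow> der A a \<in> gr A (n + 1)"
  and der_mult: "a \<in> gr A n \<Longrightarrow> der A (a * b) = der A a * b + signed n (a * der A b)"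
  and curv_mem_gr: "curv A \<in> gr A 2"
  and der_curv: "der A (curv A) = 0"
  and der_der: "a \<in> gr A n \<Longrightarrow> der A (der A a) = gcomm A 2 n (curv A) a"
proof -
  note c = curved_algebra[unfolded curved_dg_algebra_def scale_powi_minus_one, THEN conjunct2, THEN conjunct2]
  show "a \<in> gr A n \<Longrightarrow> der A a \<in> gr A (n + 1)"
    using c[THEN conjunct1] by blast
  show "a \<in> gr A n \<Longrightarrow> der A (a * b) = der A a * b + signed n (a * der A b)"
    using c[THEN conjunct2, THEN conjunct1] by blast
  show "curv A \<in> gr A 2"
    by (rule c[THEN conjunct2, THEN conjunct2, THEN conjunct1])
  show "der A (curv A) = 0"
    by (rule c[THEN conjunct2, THEN conjunct2, THEN conjunct2, THEN conjunct1])
  show "a \<in> gr A n \<Longrightarrow> der A (der A a) = gcomm A 2 n (curv A) a"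
    using c[THEN conjunct2, THEN conjunct2, THEN conjunct2, THEN conjunct2] by blast
qed

lemma gcomm_eq: "gcomm A i j a b = a * b - signed (i * j) (b * a)"
  by (simp add: gcomm_def scale_powi_minus_one)

lemma gcomm_mem_gr: "a \<in> gr A i \<Longrightarrow> b \<in> gr A j \<Longrightarrow> gcomm A i j a b \<in> gr A (i + j)"
  using mult_G[of a i b j] mult_G[of b j a i]
  by (auto simp: gcomm_def add.commute intro!: subspace_diff[OF subspace_G] subspace_scale[OF subspace_G])

lemma subspace_I: "subspace I"
  and I_eq_span: "I = span (\<Union>n. I \<inter> gr A n)"
  and gcomm_I: "a \<in> gr A i \<Longrightarrow> x \<in> I \<Longrightarrow> x \<in> gr A j \<Longrightarrow> gcomm A i j a x \<in> I"
  and der_I: "x \<in> I \<Longrightarrow> der A x \<in> I"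
  and curv_I: "curv A \<in> I"
proof -
  note c = curved_ideal[unfolded curved_Lie_ideal_def]
  show "subspace I" by (rule c[THEN conjunct1])
  show "I = span (\<Union>n. I \<inter> gr A n)" by (rule c[THEN conjunct2, THEN conjunct1])
  show "a \<in> gr A i \<Longrightarrow> x \<in> I \<Longrightarrow> x \<in> gr A j \<Longrightarrow> gcomm A i j a x \<in> I"
    using c[THEN conjunct2, THEN conjunct2, THEN conjunct1] by blast
  show "x \<in> I \<Longrightarrow> der A x \<in> I"
    by (rule c[THEN conjunct2, THEN conjunct2, THEN conjunct2, THEN conjunct1, THEN subsetD, OF imageI])
  show "curv A \<in> I" by (rule c[THEN conjunct2, THEN conjunct2, THEN conjunct2, THEN conjunct2])
qed

lemma gcomm_I_left: "a \<in> gr A i \<Longrightarrow> x \<in> I \<Longrightarrow> x \<in> gr A j \<Longrightarrow> gcomm A j i x a \<in> I"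
proof -
  assume "a \<in> gr A i" "x \<in> I" "x \<in> gr A j"
  then have "gcomm A i j a x \<in> I" by (rule gcomm_I)
  moreover have "gcomm A j i x a = - signed (i * j) (gcomm A i j a x)"
    by (simp add: gcomm_eq signed_def mult.commute)
  ultimately show ?thesis
    using add_closed_uminus add_closed_signed add_closed_subspace[OF subspace_I] by metis
qed

lemma coset_eq_iff:
  assumes "subspace U"
  shows "a +o U = b +o U \<longleftrightarrow> a - b \<in> U"
proof
  assume "a +o U = b +o U"
  then have "a \<in> b +o U" using elt_set_plus_mem[of a a U] subspace_0[OF assms] by simp
  then show "a - b \<in> U" by (simp add: elt_set_plus_mem)
next
  assume d: "a - b \<in> U"
  have "c - a \<in> U \<longleftrightarrow> c - b \<in> U" for c
    using subspace_add[OF assms _ d, of "c - a"] subspace_diff[OF assms _ d, of "c - b"] by auto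
  then show "a +o U = b +o U" by (auto simp: elt_set_plus_mem)
qed

lemma coset_self: "subspace U \<Longrightarrow> a \<in> a +o U"
  by (simp add: elt_set_plus_mem subspace_0)

lemma quotient_gadd:
  assumes U: "subspace U"
  shows "gadd (quotient_complex A U) (a +o U) (b +o U) = (a + b) +o U"
proof -
  have "(x + y) +o U = (a + b) +o U" if "x \<in> a +o U" "y \<in> b +o U" for x y
    using subspace_add[OF U, of "x - a" "y - b"] that
    by (simp add: coset_eq_iff[OF U] elt_set_plus_mem algebra_simps)
  then have "(\<Union>y\<in>b +o U. (x + y) +o U) = (a + b) +o U" if "x \<in> a +o U" for x
    using that by (intro UN_eqI[OF coset_self[OF U]])
  then show ?thesis unfolding quotient_complex_def dgvs.simps gvs.simps
    by (rule UN_eqI[OF coset_self[OF U]])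
qed

lemma quotient_gsmult:
  assumes U: "subspace U"
  shows "gsmult (quotient_complex A U) c (a +o U) = scal A c a +o U"
proof -
  have "scal A c x +o U = scal A c a +o U" if "x \<in> a +o U" for x
    using subspace_scale[OF U, of "x - a" c] that
    by (simp add: coset_eq_iff[OF U] elt_set_plus_mem scale_right_diff_distrib)
  then show ?thesis unfolding quotient_complex_def dgvs.simps gvs.simps
    by (intro UN_eqI[OF coset_self[OF U]])
qed

lemma quotient_gdiff:
  assumes U: "subspace U" and "\<And>x. x \<in> U \<Longrightarrow> der A x \<in> U"
  shows "gdiff (quotient_complex A U) (a +o U) = der A a +o U"
proof -
  have "der A x +o U = der A a +o U" if "x \<in> a +o U" for x
    using assms(2)[of "x - a"] that
    by (simp add: coset_eq_iff[OF U] elt_set_plus_mem der.diff)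
  then show ?thesis unfolding quotient_complex_def dgvs.simps gvs.simps
    by (intro UN_eqI[OF coset_self[OF U]])
qed

lemma quotient_gzero: "gzero (quotient_complex A U) = 0 +o U"
  by (simp add: quotient_complex_def)

lemma quotient_gpart: "gpart (quotient_complex A U) n = (\<lambda>a. a +o U) ` gr A n"
  by (simp add: quotient_complex_def)

lemma graded_vector_space_quotient:
  assumes U: "subspace U"
  shows "graded_vector_space (quotient_complex A U)"
  unfolding graded_vector_space_def quotient_gpart ball_simps quotient_gzero
    quotient_gadd[OF U] quotient_gsmult[OF U]
  using subspace_0[OF subspace_G] subspace_add[OF subspace_G] subspace_scale[OF subspace_G]
  by (intro conjI allI ballI)
    (simp_all add: add_ac scale_left_distrib scale_right_distrib del: set_zero_plus)

lemma quotient_complex_is_complex: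
  assumes U: "subspace U" and d: "\<And>x. x \<in> U \<Longrightarrow> der A x \<in> U"
    and R: "\<And>n a. a \<in> gr A n \<Longrightarrow> gcomm A 2 n (curv A) a \<in> U"
  shows "is_complex (quotient_complex A U)"
proof -
  have qd: "gdiff (quotient_complex A U) (a +o U) = der A a +o U" for a
    by (rule quotient_gdiff[OF U d])
  have dg: "der A x +o U \<in> (\<lambda>a. a +o U) ` gr A (n + 1)" if "x \<in> gr A n" for n x
    using der_gr[OF that] by blast
  show ?thesis
    unfolding is_complex_def graded_linear_def quotient_gpart ball_simps quotient_gzero
      quotient_gadd[OF U] quotient_gsmult[OF U] qd
    by (intro conjI allI ballI graded_vector_space_quotient[OF U])
      (simp_all add: der.add der.scale dg der_der coset_eq_iff[OF U] R del: set_zero_plus)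
qed

abbreviation "B \<equiv> quotient_dgla A I"

lemma B_simps:
  "gpart B n = (\<lambda>a. a +o I) ` gr A n"
  "gzero B = 0 +o I"
  "gadd B (a +o I) (b +o I) = (a + b) +o I"
  "gsmult B c (a +o I) = scal A c a +o I"
  "gdiff B (a +o I) = der A a +o I"
  using quotient_gadd[OF subspace_I] quotient_gsmult[OF subspace_I] quotient_gdiff[OF subspace_I der_I]
  by (simp_all add: quotient_dgla_def dgvs.defs dgla.defs quotient_complex_def)

text \<open>
  Two representatives of the same degree differ by a homogeneous element of \<open>I\<close>, so their brackets
  differ by commutators with homogeneous elements of the Lie ideal.
\<close>
lemma B_bracket:
  assumes a: "a \<in> gr A i" and b: "b \<in> gr A j"
  shows "gbracket B i j (a +o I) (b +o I) = gcomm A i j a b +o I"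
proof -
  have e: "gcomm A i j x y +o I = gcomm A i j a b +o I"
    if x: "x \<in> (a +o I) \<inter> gr A i" and y: "y \<in> (b +o I) \<inter> gr A j" for x y
  proof -
    have u: "x - a \<in> I" "x - a \<in> gr A i" and v: "y - b \<in> I" "y - b \<in> gr A j"
      using x y a b by (auto simp: elt_set_plus_mem intro: subspace_diff[OF subspace_G])
    have "gcomm A i j x y - gcomm A i j a b = gcomm A i j (x - a) b + gcomm A i j x (y - b)"
      by (simp add: gcomm_eq signed_def algebra_simps)
    also have "\<dots> \<in> I"
      using x by (intro subspace_add[OF subspace_I] gcomm_I[OF _ v] gcomm_I_left[OF b u]) auto
    finally show ?thesis by (simp add: coset_eq_iff[OF subspace_I])
  qed
  have "gbracket B i j (a +o I) (b +o I) =
      (\<Union>x\<in>(a +o I) \<inter> gr A i. \<Union>y\<in>(b +o I) \<inter> gr A j. gcomm A i j x y +o I)"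
    by (simp add: quotient_dgla_def dgvs.defs dgla.defs quotient_complex_def)
  also have "\<dots> = gcomm A i j a b +o I"
  proof -
    have "(\<Union>y\<in>(b +o I) \<inter> gr A j. gcomm A i j x y +o I) = gcomm A i j a b +o I"
      if "x \<in> (a +o I) \<inter> gr A i" for x
      using e[OF that] coset_self[OF subspace_I, of b] b by (intro UN_eqI[of b]) auto
    then show ?thesis using coset_self[OF subspace_I, of a] a by (intro UN_eqI[of a "(a +o I) \<inter> gr A i"]) simp_all
  qed
  finally show ?thesis .
qed

text \<open>
  The graded commutator of an associative algebra satisfies the axioms of a bracket, and \<open>d\<^sup>2 = [R, -]\<close>
  vanishes modulo \<open>I\<close> because \<open>R\<close> lies in the Lie ideal.
\<close>
lemma is_dgla_B: "is_dgla B"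
proof -
  have c: "is_complex B"
    using quotient_complex_is_complex[OF subspace_I der_I gcomm_I_left[OF _ curv_I curv_mem_gr]]
    by (simp add: quotient_dgla_def is_complex_extend)
  note gr_intro = der_gr gcomm_mem_gr subspace_add[OF subspace_G] subspace_scale[OF subspace_G]
  have jacobi: "gcomm A i (j + l) a (gcomm A j l b c) = gcomm A (i + j) l (gcomm A i j a b) c +
      signed (i * j) (gcomm A j (i + l) b (gcomm A i l a c))" for i j l a b c
    by (simp add: gcomm_eq algebra_simps)
      (cases "even i"; cases "even j"; cases "even l"; simp add: signed_def algebra_simps)
  have leibniz: "der A (gcomm A i j a b) = gcomm A (i + 1) j (der A a) b + signed i (gcomm A i (j + 1) a (der A b))"
    if "a \<in> gr A i" "b \<in> gr A j" for i j a b
    using der_mult[OF that(1), of b] der_mult[OF that(2), of a]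
    by (simp add: gcomm_eq der.diff der.neg signed_def algebra_simps)
  show ?thesis
    unfolding is_dgla_def B_simps(1) ball_simps
  proof (intro conjI allI ballI c)
    fix i j a b assume a: "a \<in> gr A i" and b: "b \<in> gr A j"
    show "gbracket B i j (a +o I) (b +o I) \<in> (\<lambda>a. a +o I) ` gr A (i + j)"
      using a b by (simp add: B_bracket gcomm_mem_gr)
    show "gbracket B i j (gadd B (a +o I) (a' +o I)) (b +o I) =
        gadd B (gbracket B i j (a +o I) (b +o I)) (gbracket B i j (a' +o I) (b +o I))" if "a' \<in> gr A i" for a'
      using a b that
      by (simp add: B_simps B_bracket gr_intro) (simp add: gcomm_eq signed_def algebra_simps)
    show "gbracket B i j (a +o I) (gadd B (b +o I) (b' +o I)) =
        gadd B (gbracket B i j (a +o I) (b +o I)) (gbracket B i j (a +o I) (b' +o I))" if "b' \<in> gr A j" for b'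
      using a b that
      by (simp add: B_simps B_bracket gr_intro) (simp add: gcomm_eq signed_def algebra_simps)
    show "gbracket B i j (gsmult B c (a +o I)) (b +o I) = gsmult B c (gbracket B i j (a +o I) (b +o I))" for c
      using a b by (simp add: B_simps B_bracket gr_intro)
        (simp add: gcomm_eq signed_def scale_right_diff_distrib scale_right_distrib
           flip: scale_mult_left scale_mult_right)
    show "gbracket B i j (a +o I) (gsmult B c (b +o I)) = gsmult B c (gbracket B i j (a +o I) (b +o I))" for c
      using a b by (simp add: B_simps B_bracket gr_intro)
        (simp add: gcomm_eq signed_def scale_right_diff_distrib scale_right_distrib
           flip: scale_mult_left scale_mult_right)
    show "gbracket B i j (a +o I) (b +o I) = gsmult B (- ((-1) powi (i * j))) (gbracket B j i (b +o I) (a +o I))"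
      using a b by (simp add: B_simps B_bracket scale_powi_minus_one scale_minus_left)
        (simp add: gcomm_eq signed_def mult.commute)
    show "gdiff B (gbracket B i j (a +o I) (b +o I)) =
       gadd B (gbracket B (i + 1) j (gdiff B (a +o I)) (b +o I))
         (gsmult B ((-1) powi i) (gbracket B i (j + 1) (a +o I) (gdiff B (b +o I))))"
      using a b by (simp add: B_simps B_bracket gr_intro leibniz scale_powi_minus_one)
    show "gbracket B i (j + l) (a +o I) (gbracket B j l (b +o I) (z +o I)) =
          gadd B (gbracket B (i + j) l (gbracket B i j (a +o I) (b +o I)) (z +o I))
            (gsmult B ((-1) powi (i * j)) (gbracket B j (i + l) (b +o I) (gbracket B i l (a +o I) (z +o I))))"
      if "z \<in> gr A l" for l z
      using a b that by (simp add: B_simps B_bracket gr_intro jacobi[of i j l a b z] scale_powi_minus_one)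
  qed
qed

lemma subspace_commutators: "subspace (commutators A)"
  by (simp add: commutators_def)

lemma gcomm_commutators: "a \<in> gr A i \<Longrightarrow> b \<in> gr A j \<Longrightarrow> gcomm A i j a b \<in> commutators A"
  unfolding commutators_def by (intro span_base) blast

lemma der_commutators: "x \<in> commutators A \<Longrightarrow> der A x \<in> commutators A"
proof -
  assume "x \<in> commutators A"
  then show ?thesis
    unfolding commutators_def
  proof (induction rule: span_induct_alt)
    case base
    then show ?case by (simp add: der.zero span_zero)
  next
    case (step c x y)
    then obtain i j a b where x: "x = gcomm A i j a b" and a: "a \<in> gr A i" and b: "b \<in> gr A j" by blast
    have "der A x = gcomm A (i + 1) j (der A a) b + signed i (gcomm A i (j + 1) a (der A b))"
      using der_mult[OF a, of b] der_mult[OF b, of a]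
      by (simp add: x gcomm_eq der.diff der.neg signed_def algebra_simps)
    also have "\<dots> \<in> commutators A"
      using a b subspace_commutators
      by (intro subspace_add gcomm_commutators add_closed_signed[OF add_closed_subspace] der_gr) auto
    finally show ?case
      using step(2) unfolding commutators_def der.add der.scale
      by (intro span_add span_scale)
  qed
qed

lemma span_mult_right_subset:
  assumes "x \<in> span S" and "\<And>s. s \<in> S \<Longrightarrow> s * a \<in> T" and "subspace T"
  shows "x * a \<in> T"
  using assms(1)
proof (induction rule: span_induct_alt)
  case base
  then show ?case by (simp add: subspace_0[OF assms(3)])
next
  case (step c x y)
  then show ?case
    by (simp add: distrib_right subspace_add[OF assms(3)] subspace_scale[OF assms(3)] assms(2) flip: scale_mult_left)
qed

lemma span_mult_left_subset:
  assumes "x \<in> span S" and "\<And>s. s \<in> S \<Longrightarrow> a * s \<in> T" and "subspace T"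
  shows "a * x \<in> T"
  using assms(1)
proof (induction rule: span_induct_alt)
  case base
  then show ?case by (simp add: subspace_0[OF assms(3)])
next
  case (step c x y)
  then show ?case
    by (simp add: distrib_left subspace_add[OF assms(3)] subspace_scale[OF assms(3)] assms(2) flip: scale_mult_right)
qed

abbreviation "IA m \<equiv> subspace_times_algebra A (subspace_power A I m)"

lemma subspace_power_mult:
  assumes "x \<in> subspace_power A I m" and "y \<in> I"
  shows "x * y \<in> subspace_power A I (Suc m)"
  using assms(1) unfolding subspace_power_def
proof (rule span_mult_right_subset)
  fix s assume "s \<in> {prod_list es |es. length es = m \<and> set es \<subseteq> I}"
  then obtain es where "s = prod_list es" "length es = m" "set es \<subseteq> I" by blast
  then show "s * y \<in> span {prod_list es |es. length es = Suc m \<and> set es \<subseteq> I}"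
    using assms(2) by (intro span_base) (auto intro!: exI[of _ "es @ [y]"])
qed simp

lemma subspace_power_mult_left:
  assumes "x \<in> subspace_power A I m" and "y \<in> I"
  shows "y * x \<in> subspace_power A I (Suc m)"
  using assms(1) unfolding subspace_power_def
proof (rule span_mult_left_subset)
  fix s assume "s \<in> {prod_list es |es. length es = m \<and> set es \<subseteq> I}"
  then obtain es where "s = prod_list es" "length es = m" "set es \<subseteq> I" by blast
  then show "y * s \<in> span {prod_list es |es. length es = Suc m \<and> set es \<subseteq> I}"
    using assms(2) by (intro span_base) (auto intro!: exI[of _ "y # es"])
qed simp

lemma subspace_power_0: "1 \<in> subspace_power A I 0"
  unfolding subspace_power_def by (intro span_base) auto

lemma subspace_power_subset_IA: "x \<in> subspace_power A I m \<Longrightarrow> x \<in> IA m"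
  unfolding subspace_times_algebra_def by (rule span_base) (force intro: exI[of _ 1])

lemma subspace_IA: "subspace (IA m)"
  by (simp add: subspace_times_algebra_def)

lemma I_mult_IA: "x \<in> I \<Longrightarrow> z \<in> IA m \<Longrightarrow> x * z \<in> IA (Suc m)"
proof -
  assume x: "x \<in> I" and "z \<in> IA m"
  from this(2) show ?thesis
    unfolding subspace_times_algebra_def
  proof (rule span_mult_left_subset)
    fix s assume "s \<in> {e * a |e a. e \<in> subspace_power A I m}"
    then obtain e a where "s = e * a" "e \<in> subspace_power A I m" by blast
    then show "x * s \<in> span {e * a |e a. e \<in> subspace_power A I (Suc m)}"
      using subspace_power_mult_left[OF _ x] by (intro span_base) (auto simp flip: mult.assoc)
  qed simp
qed

text \<open>
  The graded Leibniz rule requires a homogeneous left factor, hence the passage to homogeneous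
  generators of \<open>I\<close>.
\<close>
lemma der_I_mult_IA:
  assumes x: "x \<in> I" and z: "z \<in> IA m" and d: "der A z \<in> IA m"
  shows "der A (x * z) \<in> IA (Suc m)"
proof -
  have "x \<in> span (\<Union>n. I \<inter> gr A n)" using x I_eq_span by simp
  then show ?thesis
  proof (induction rule: span_induct_alt)
    case base
    then show ?case by (simp add: der.zero subspace_0[OF subspace_IA])
  next
    case (step c x y)
    then obtain n where x: "x \<in> I" "x \<in> gr A n" by blast
    have "der A (x * z) = der A x * z + signed n (x * der A z)" by (rule der_mult[OF x(2)])
    also have "\<dots> \<in> IA (Suc m)"
      using x z d by (intro subspace_add[OF subspace_IA] I_mult_IA der_I
          add_closed_signed[OF add_closed_subspace[OF subspace_IA]])
    finally show ?case
      using step(2)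
      by (simp add: distrib_right der.add der.scale subspace_add[OF subspace_IA]
          subspace_scale[OF subspace_IA] flip: scale_mult_left)
  qed
qed

text \<open>
  By induction on the length of a product of elements of \<open>I\<close>, peeling off the first factor.
\<close>
lemma der_IA: "z \<in> IA m \<Longrightarrow> der A z \<in> IA m"
proof -
  have p: "prod_list es * a \<in> IA (length es) \<and> der A (prod_list es * a) \<in> IA (length es)"
    if "set es \<subseteq> I" for es a
    using that
  proof (induction es)
    case Nil
    have "b \<in> IA 0" for b
      unfolding subspace_times_algebra_def using subspace_power_0
      by (intro span_base) (force intro: exI[of _ 1])
    then show ?case by simp
  next
    case (Cons e es)
    then show ?case using I_mult_IA[of e] der_I_mult_IA[of e] by (simp add: mult.assoc)
  qed
  have q: "der A (e * a) \<in> IA m" if e: "e \<in> subspace_power A I m" for e a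
  proof -
    have "e \<in> span {prod_list es |es. length es = m \<and> set es \<subseteq> I}"
      using e by (simp add: subspace_power_def)
    then show ?thesis
    proof (induction rule: span_induct_alt)
      case base
      then show ?case by (simp add: der.zero subspace_0[OF subspace_IA])
    next
      case (step c x y)
      then have "der A (x * a) \<in> IA m" using p by auto
      then show ?case using step(2)
        by (simp add: distrib_right der.add der.scale subspace_add[OF subspace_IA]
            subspace_scale[OF subspace_IA] flip: scale_mult_left)
    qed
  qed
  assume "z \<in> IA m"
  then have "z \<in> span {e * a |e a. e \<in> subspace_power A I m}" by (simp add: subspace_times_algebra_def)
  then show ?thesis
  proof (induction rule: span_induct_alt)
    case base
    then show ?case by (simp add: der.zero subspace_0[OF subspace_IA])
  next
    case (step c x y)
    then show ?case using q
      by (auto simp add: der.add der.scale intro!: subspace_add[OF subspace_IA] subspace_scale[OF subspace_IA])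
  qed
qed

lemma trace_kernel_eq: "trace_kernel A I k = commutators A + IA (Suc k)"
  by (simp add: trace_kernel_def)

lemma subspace_trace_kernel: "subspace (trace_kernel A I k)"
proof -
  have "trace_kernel A I k = {x + y |x y. x \<in> commutators A \<and> y \<in> IA (Suc k)}"
    by (auto simp: trace_kernel_eq set_plus_def)
  then show ?thesis using subspace_sums[OF subspace_commutators subspace_IA] by simp
qed

lemma commutators_subset_trace_kernel: "x \<in> commutators A \<Longrightarrow> x \<in> trace_kernel A I k"
  unfolding trace_kernel_eq using subspace_0[OF subspace_IA]
  by (metis add.right_neutral set_plus_intro)

lemma IA_subset_trace_kernel: "x \<in> IA (Suc k) \<Longrightarrow> x \<in> trace_kernel A I k"
  unfolding trace_kernel_eq using subspace_0[OF subspace_commutators]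
  by (metis add.left_neutral set_plus_intro)

lemma der_trace_kernel: "x \<in> trace_kernel A I k \<Longrightarrow> der A x \<in> trace_kernel A I k"
  unfolding trace_kernel_eq
  by (auto elim!: set_plus_elim simp: der.add intro!: set_plus_intro der_commutators der_IA)

abbreviation "M k \<equiv> trace_complex A I k"
abbreviation "trace k a \<equiv> a +o trace_kernel A I k"

lemma trace_eq_iff: "trace k a = trace k b \<longleftrightarrow> a - b \<in> trace_kernel A I k"
  by (rule coset_eq_iff[OF subspace_trace_kernel])

lemma M_simps:
  "gpart (M k) n = trace k ` gr A (2 * int k + n)"
  "gzero (M k) = trace k 0"
  "gadd (M k) (trace k a) (trace k b) = trace k (a + b)"
  "gsmult (M k) c (trace k a) = trace k (scal A c a)"
  "gdiff (M k) (trace k a) = trace k (der A a)"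
  "gbracket (M k) i j X Y = trace k 0"
proof -
  note defs = trace_complex_def abelian_dgla_def shift_complex_def shift_gvs_def dgvs.defs dgla.defs
  let ?Q = "quotient_complex A (trace_kernel A I k)"
  have "gdiff (M k) X = gsmult ?Q ((-1) powi (2 * int k)) (gdiff ?Q X)" for X
    by (simp add: defs)
  then show "gdiff (M k) (trace k a) = trace k (der A a)"
    by (simp add: quotient_gsmult[OF subspace_trace_kernel]
        quotient_gdiff[OF subspace_trace_kernel der_trace_kernel])
  show "gpart (M k) n = trace k ` gr A (2 * int k + n)"
    "gzero (M k) = trace k 0"
    "gadd (M k) (trace k a) (trace k b) = trace k (a + b)"
    "gsmult (M k) c (trace k a) = trace k (scal A c a)"
    "gbracket (M k) i j X Y = trace k 0"
    using quotient_gadd[OF subspace_trace_kernel, of k a b] quotient_gsmult[OF subspace_trace_kernel, of k c a]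
      quotient_gzero[of "trace_kernel A I k"] quotient_gpart[of "trace_kernel A I k"]
    by (simp_all add: defs)
qed

text \<open>
  Here \<open>d\<^sup>2 = [R, -]\<close> vanishes because it takes values in \<open>[A, A]\<close>.
\<close>
lemma is_dgla_M: "is_dgla (M k)"
proof -
  have R: "trace k (gcomm A 2 n (curv A) a) = trace k 0" if "a \<in> gr A n" for n a
    unfolding trace_eq_iff using that
    by (simp add: gcomm_commutators curv_mem_gr commutators_subset_trace_kernel)
  have "graded_vector_space (M k)"
    unfolding graded_vector_space_def M_simps ball_simps
    using subspace_0[OF subspace_G] subspace_add[OF subspace_G] subspace_scale[OF subspace_G]
    by (intro conjI allI ballI)
      (simp_all add: add_ac scale_left_distrib scale_right_distrib del: set_zero_plus)
  moreover have dg: "trace k (der A x) \<in> trace k ` gr A (2 * int k + (n + 1))"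
    if "x \<in> gr A (2 * int k + n)" for n x
    using der_gr[OF that] by (simp add: add.assoc)
  have "graded_linear 1 (M k) (M k) (gdiff (M k))"
    unfolding graded_linear_def M_simps ball_simps
    by (intro conjI allI ballI) (simp_all add: der.add der.scale dg)
  ultimately have c: "is_complex (M k)"
    unfolding is_complex_def M_simps ball_simps
    by (intro conjI allI ballI) (simp_all add: der_der R del: set_zero_plus)
  have z: "trace k 0 \<in> trace k ` gr A n" for n
    using subspace_0[OF subspace_G] by blast
  show ?thesis
    unfolding is_dgla_def
    by (intro conjI allI ballI c)
      (simp_all add: M_simps z der.zero del: set_zero_plus)
qed

text \<open>
  In this form the addition of arbitrary sets is associative and commutative, which makes sums over
  finite sets independent of the order.
\<close>
lemma gadd_M_eq: "gadd (M k) X Y = X + Y + trace_kernel A I k"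
  by (auto simp: trace_complex_def abelian_dgla_def shift_complex_def shift_gvs_def dgvs.defs dgla.defs
       quotient_complex_def set_plus_def elt_set_plus_def)

lemma gsum_M: "gsum (M k) (\<lambda>i. trace k (h i)) S = trace k (sum h S)"
proof (cases "finite S")
  case True
  interpret comp_fun_commute "\<lambda>i. gadd (M k) (trace k (h i))"
    by standard (auto simp: fun_eq_iff gadd_M_eq add_ac)
  from True show ?thesis
    unfolding gsum_def by (induction S) (simp_all add: M_simps)
qed (simp add: gsum_def M_simps)

lemma comp_Q_trace: "comp_Q L (M k) (\<lambda>xs. trace k (f xs)) xs = trace k (comp_Q L (gvs_of A) f xs)"
  unfolding comp_Q_def comp_Q0_def comp_Q1_def gvs_of_eq gsum_V
  by (simp add: M_simps case_prod_beta Let_def gsum_M)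

end

section \<open>Power series in \<open>t\<close>\<close>

lemma fps_nth_signed: "signed n p $ i = signed n (p $ i)" for p :: "'b::ring fps"
  by (simp add: signed_def)

text \<open>
  The convolution product over power series combines the product of cochains with the Cauchy product.
\<close>
lemma conv_fps_nth:
  fixes f g :: "'l word \<Rightarrow> 'b::ring fps"
  shows "conv q f g w $ n = (\<Sum>i\<le>n. conv q (\<lambda>u. f u $ i) (\<lambda>u. g u $ (n - i)) w)"
proof (induction w arbitrary: q f g)
  case Nil
  show ?case by (simp add: conv_Nil fps_mult_nth atLeast0AtMost)
next
  case (Cons x w)
  have "(\<Sum>i\<le>n. signed m (h i)) = signed m (\<Sum>i\<le>n. h i)" for m and h :: "nat \<Rightarrow> 'b"
    by (simp add: signed_def sum_negf)
  then show ?case by (simp add: conv_Cons fps_nth_signed Cons.IH sum.distrib)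
qed

definition mult_t :: "'b::ring fps \<Rightarrow> 'b fps" where
  "mult_t p = Abs_fps (\<lambda>n. if n = 0 then 0 else p $ (n - 1))"

lemma mult_t_nth: "mult_t p $ n = (if n = 0 then 0 else p $ (n - 1))"
  by (simp add: mult_t_def)

lemma mult_t_add: "mult_t (p + q) = mult_t p + mult_t q"
  by (simp add: fps_eq_iff mult_t_nth)

lemma mult_t_diff: "mult_t (p - q) = mult_t p - mult_t q"
  by (simp add: fps_eq_iff mult_t_nth)

lemma mult_t_mult_left: "mult_t (p * q) = mult_t p * q"
proof (rule fps_ext)
  fix n show "mult_t (p * q) $ n = (mult_t p * q) $ n"
    by (cases n) (simp_all add: mult_t_nth fps_mult_nth sum.atLeast0_atMost_Suc_shift del: sum.atLeast0_atMost_Suc sum.cl_ivl_Suc)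
qed

lemma mult_t_mult_right: "mult_t (p * q) = p * mult_t q"
proof (rule fps_ext)
  fix n show "mult_t (p * q) $ n = (p * mult_t q) $ n"
    by (cases n) (simp_all add: mult_t_nth fps_mult_nth Suc_diff_le)
qed

lemma conv_mult_t_left:
  fixes f g :: "'l word \<Rightarrow> 'b::ring fps"
  shows "conv q (\<lambda>u. mult_t (f u)) g w = mult_t (conv q f g w)"
proof (induction w arbitrary: q f g)
  case (Cons x w)
  have "mult_t (signed n a) = signed n (mult_t a)" for n and a :: "'b fps"
    by (rule additive_signed(3)[of mult_t, OF mult_t_add])
  then show ?case by (simp add: conv_Cons Cons.IH mult_t_add)
qed (simp add: conv_Nil mult_t_mult_left)

lemma conv_mult_t_right:
  fixes f g :: "'l word \<Rightarrow> 'b::ring fps"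
  shows "conv q f (\<lambda>u. mult_t (g u)) w = mult_t (conv q f g w)"
proof (induction w arbitrary: q f g)
  case (Cons x w)
  have "mult_t (signed n a) = signed n (mult_t a)" for n and a :: "'b fps"
    by (rule additive_signed(3)[of mult_t, OF mult_t_add])
  then show ?case by (simp add: conv_Cons Cons.IH mult_t_add)
qed (simp add: conv_Nil mult_t_mult_right)

lemma one_mult_fps:
  fixes p :: "'b::{ring, monoid_mult} fps"
  shows "1 * p = p" and "p * 1 = p"
proof -
  show "1 * p = p"
  proof (rule fps_ext)
    fix n show "(1 * p) $ n = p $ n"
      by (simp add: fps_mult_nth sum.atLeast_Suc_atMost[of 0 n])
  qed
  show "p * 1 = p"
  proof (rule fps_ext)
    fix n show "(p * 1) $ n = p $ n"
      by (cases n) (simp_all add: fps_mult_nth)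
  qed
qed

definition bounded_fps :: "nat \<Rightarrow> 'b::zero fps set" where
  "bounded_fps N = {p. \<forall>n>N. p $ n = 0}"

lemma bounded_fps_mult:
  fixes p q :: "'b::ring fps"
  assumes "p \<in> bounded_fps a" and "q \<in> bounded_fps b"
  shows "p * q \<in> bounded_fps (a + b)"
proof -
  have "p $ i * q $ (n - i) = 0" if "n > a + b" for i n
    using assms that by (cases "i > a") (auto simp: bounded_fps_def)
  then show ?thesis by (auto simp: bounded_fps_def fps_mult_nth)
qed

lemma add_closed_bounded_fps: "add_closed (bounded_fps N :: 'b::ring fps set)"
  by (simp add: add_closed_def bounded_fps_def)

text \<open>
  Evaluation at \<open>t = 1\<close> is multiplicative on polynomials. The cutoff \<open>N\<close> makes it additive on all power
  series.
\<close>
lemma eval_one_mult: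
  fixes p q :: "'b::ring fps"
  assumes p: "p \<in> bounded_fps a" and q: "q \<in> bounded_fps b" and N: "a + b \<le> N"
  shows "(\<Sum>n\<le>N. (p * q) $ n) = (\<Sum>n\<le>N. p $ n) * (\<Sum>n\<le>N. q $ n)"
proof -
  have "(\<Sum>n\<le>N. (p * q) $ n) = (\<Sum>n\<le>N. \<Sum>i\<le>n. p $ i * q $ (n - i))"
    by (simp add: fps_mult_nth atLeast0AtMost)
  also have "\<dots> = (\<Sum>(i, j)\<in>{(i, j). i + j \<le> N}. p $ i * q $ j)"
    by (rule sum.triangle_reindex_eq[symmetric])
  also have "\<dots> = (\<Sum>(i, j)\<in>{..N} \<times> {..N}. p $ i * q $ j)"
  proof (rule sum.mono_neutral_left)
    show "\<forall>x\<in>{..N} \<times> {..N} - {(i, j). i + j \<le> N}. (case x of (i, j) \<Rightarrow> p $ i * q $ j) = 0"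
    proof
      fix x assume "x \<in> {..N} \<times> {..N} - {(i, j). i + j \<le> N}"
      then obtain i j where x: "x = (i, j)" and "\<not> i + j \<le> N" by auto
      then have "i > a \<or> j > b" using N by auto
      then show "(case x of (i, j) \<Rightarrow> p $ i * q $ j) = 0" using p q by (auto simp: x bounded_fps_def)
    qed
  qed auto
  also have "\<dots> = (\<Sum>n\<le>N. p $ n) * (\<Sum>n\<le>N. q $ n)"
    by (simp add: sum_product sum.cartesian_product)
  finally show ?thesis .
qed

lemma conv_bounded_fps:
  fixes f g :: "'l word \<Rightarrow> 'b::ring fps"
  assumes "\<And>u. f u \<in> bounded_fps a" and "\<And>u. g u \<in> bounded_fps b"
  shows "conv q f g w \<in> bounded_fps (a + b)"
proof -
  \<comment> \<open>Membership of values is stated for words over a graded vector space; here all letters are allowed.\<close>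
  define all :: "(unit, 'l) gvs" where
    "all = \<lparr>gpart = \<lambda>_. UNIV, gzero = undefined, gadd = undefined, gsmult = undefined\<rparr>"
  have "w \<in> words all" by (auto simp: words_def all_def)
  then show ?thesis
    by (intro conv_mem[OF add_closed_bounded_fps] bounded_fps_mult assms)
qed

section \<open>The curvature of a linear map up to \<open>I\<close>\<close>

text \<open>
  A linear map \<open>s\<close> from a DG-Lie algebra to \<open>A\<close> that commutes with differentials and brackets modulo \<open>I\<close>.
  A section of the projection from \<open>A\<close> to the quotient by \<open>I\<close> is an example.
\<close>
locale chern_simons = curved_ideal A I
  for A :: "('k::field_char_0, 'a::{ring, monoid_mult}) cdga" and I +
  fixes L :: "('k, 'l) dgla" and s :: "'l \<Rightarrow> 'a"
  assumes dgla: "is_dgla L"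
    and s_linear: "graded_linear 0 L (gvs_of A) s"
    and s_diff_mod_I: "x \<in> gpart L n \<Longrightarrow> der A (s x) - s (gdiff L x) \<in> I"
    and s_bracket_mod_I: "x \<in> gpart L i \<Longrightarrow> y \<in> gpart L j \<Longrightarrow>
      s (gbracket L i j x y) - gcomm A i j (s x) (s y) \<in> I"
begin

lemma s_gr: "x \<in> gpart L n \<Longrightarrow> s x \<in> gr A n"
  and s_add: "x \<in> gpart L n \<Longrightarrow> y \<in> gpart L n \<Longrightarrow> s (gadd L x y) = s x + s y"
  and s_scale: "x \<in> gpart L n \<Longrightarrow> s (gsmult L c x) = scal A c (s x)"
  using s_linear by (auto simp: graded_linear_def gvs_of_def)

lemma s_zero: "s (gzero L) = 0"
  using s_add[OF dgla_gzero(1)[OF dgla] dgla_gzero(1)[OF dgla]] dgla_gzero(2)[OF dgla] by simp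

definition \<sigma> :: "'l word \<Rightarrow> 'a" where "\<sigma> = linear_cochain s"

lemma \<sigma>_simps [simp]: "\<sigma> [] = 0" "\<sigma> [x] = s (snd x)" "\<sigma> (x # y # w) = 0"
  by (simp_all add: \<sigma>_def linear_cochain_def split: prod.split)

lemma word_cases:
  obtains "w = []" | x where "w = [x]" | x y where "w = [x, y]"
  | x y z where "w = [x, y, z]" | "length w \<ge> 4"
proof -
  consider "w = []" | x where "w = [x]" | x y where "w = [x, y]" | x y z where "w = [x, y, z]"
    | x y z v u where "w = x # y # z # v # u"
    by (metis neq_Nil_conv)
  then show thesis using that by cases auto
qed

lemma append_Cons_cases:
  obtains "us = []" "vs = []" | z where "us = [z]" "vs = []" | z where "us = []" "vs = [z]"
    | "length us + length vs \<ge> 2"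
proof (cases us)
  case Nil
  then show thesis using that by (cases vs; cases "tl vs") auto
next
  case (Cons z us')
  then show thesis using that by (cases us'; cases vs) auto
qed

lemma \<sigma>_Hom_S: "\<sigma> \<in> Hom_S 1 L V"
proof (rule Hom_S_I)
  show "\<sigma> xs \<in> gr A (1 + wdeg xs)" if "xs \<in> words L" for xs
    using that by (cases xs rule: word_cases)
      (auto simp: words_Cons wdeg_Cons s_gr subspace_0[OF subspace_G] \<sigma>_def linear_cochain_def
        split: list.split)
  fix us vs n x assume x: "x \<in> gpart L n"
  show "\<sigma> (us @ (n, gadd L x y) # vs) = \<sigma> (us @ (n, x) # vs) + \<sigma> (us @ (n, y) # vs)"
    if y: "y \<in> gpart L n" for y
    using s_add[OF x y] by (cases us; cases vs; cases "tl us") (simp_all)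
  show "\<sigma> (us @ (n, gsmult L c x) # vs) = scal A c (\<sigma> (us @ (n, x) # vs))" for c
    using s_scale[OF x] by (cases us; cases vs; cases "tl us") (simp_all)
  show "\<sigma> (us @ (n, x) # (m, y) # vs) = signed ((n - 1) * (m - 1)) (\<sigma> (us @ (m, y) # (n, x) # vs))" for m y
    by (cases us; cases "tl us") simp_all
qed

lemma Q_transpose_vanish:
  assumes "\<And>u. length u \<ge> n \<Longrightarrow> f u = (0 :: 'a)" and "w \<in> words L" and "length w \<ge> Suc n"
  shows "Q_transpose L f w = 0"
proof -
  have "Q_transpose L f w \<in> {0}"
    using assms by (intro Q_transpose_mem[OF dgla]) (auto simp: add_closed_def)
  then show ?thesis by simp
qed

definition Q\<sigma> :: "'l word \<Rightarrow> 'a" where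
  "Q\<sigma> w = (case w of [x] \<Rightarrow> - s (gdiff L (snd x))
     | [x, y] \<Rightarrow> signed (fst x) (s (gbracket L (fst x) (fst y) (snd x) (snd y))) | _ \<Rightarrow> 0)"

lemma Q\<sigma>_simps [simp]: "Q\<sigma> [] = 0" "Q\<sigma> [x] = - s (gdiff L (snd x))"
  "Q\<sigma> [x, y] = signed (fst x) (s (gbracket L (fst x) (fst y) (snd x) (snd y)))"
  "Q\<sigma> (x # y # z # w) = 0"
  by (simp_all add: Q\<sigma>_def)

text \<open>
  The composite \<open>s Q\<close>: only the differential of one letter and the bracket of two letters yield words of
  length one.
\<close>
lemma Q_transpose_\<sigma>: "w \<in> words L \<Longrightarrow> Q_transpose L \<sigma> w = Q\<sigma> w"
proof (cases w rule: word_cases)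
  case (4 x y z)
  assume "w \<in> words L"
  then have "Q_transpose L \<sigma> w = 0"
    by (rule Q_transpose_vanish[where n = 2, rotated]) (auto simp: 4 \<sigma>_def linear_cochain_def split: list.split)
  then show ?thesis by (simp add: 4)
next
  case 5
  assume "w \<in> words L"
  then have "Q_transpose L \<sigma> w = 0"
    by (rule Q_transpose_vanish[where n = 2, rotated]) (use 5 in \<open>auto simp: \<sigma>_def linear_cochain_def split: list.split\<close>)
  moreover have "Q\<sigma> w = 0" using 5 by (auto simp: Q\<sigma>_def split: list.split)
  ultimately show ?thesis by simp
qed (simp_all add: Q_transpose_Cons ad_transpose_Cons)

lemma Q\<sigma>_Hom_S: "Q\<sigma> \<in> Hom_S 2 L V"
proof (rule Hom_S_I)
  show "Q\<sigma> xs \<in> gr A (2 + wdeg xs)" if "xs \<in> words L" for xs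
  proof -
    have "Q_transpose L \<sigma> xs \<in> gr A (2 + wdeg xs)"
      using Hom_S_degree[OF \<sigma>_Hom_S]
      by (intro Q_transpose_mem[OF dgla add_closed_subspace[OF subspace_G] _ that])
        (metis add.commute add.left_commute one_add_one)
    then show ?thesis by (simp add: Q_transpose_\<sigma>[OF that])
  qed
  fix us vs n x assume us: "us \<in> words L" and vs: "vs \<in> words L" and x: "x \<in> gpart L n"
  note cl = dgla_diff_closed[OF dgla] dgla_bracket_closed[OF dgla]
  show "Q\<sigma> (us @ (n, gadd L x y) # vs) = Q\<sigma> (us @ (n, x) # vs) + Q\<sigma> (us @ (n, y) # vs)"
    if y: "y \<in> gpart L n" for y
  proof (cases us vs rule: append_Cons_cases)
    case 1
    then show ?thesis by (simp add: dgla_diff_add[OF dgla x y] s_add[OF cl(1)[OF x] cl(1)[OF y]])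
  next
    case (2 z)
    then have z: "snd z \<in> gpart L (fst z)" using us by (simp add: words_Cons)
    show ?thesis
      by (simp add: 2 dgla_bracket_add_right[OF dgla z x y] s_add[OF cl(2)[OF z x] cl(2)[OF z y]] signed_add)
  next
    case (3 z)
    then have z: "snd z \<in> gpart L (fst z)" using vs by (simp add: words_Cons)
    show ?thesis
      by (simp add: 3 dgla_bracket_add_left[OF dgla x z y] s_add[OF cl(2)[OF x z] cl(2)[OF y z]] signed_add)
  next
    case 4
    then have "Q\<sigma> (us @ a # vs) = 0" for a
      by (auto simp: Q\<sigma>_def split: list.split dest!: arg_cong[where f = length])
    then show ?thesis by simp
  qed
  show "Q\<sigma> (us @ (n, gsmult L c x) # vs) = scal A c (Q\<sigma> (us @ (n, x) # vs))" for c
  proof (cases us vs rule: append_Cons_cases)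
    case 1
    then show ?thesis by (simp add: dgla_diff_scale[OF dgla x] s_scale[OF cl(1)[OF x]])
  next
    case (2 z)
    then have z: "snd z \<in> gpart L (fst z)" using us by (simp add: words_Cons)
    show ?thesis
      by (simp add: 2 dgla_bracket_scale_right[OF dgla z x] s_scale[OF cl(2)[OF z x]] signed_def)
  next
    case (3 z)
    then have z: "snd z \<in> gpart L (fst z)" using vs by (simp add: words_Cons)
    show ?thesis
      by (simp add: 3 dgla_bracket_scale_left[OF dgla x z] s_scale[OF cl(2)[OF x z]] signed_def)
  next
    case 4
    then have "Q\<sigma> (us @ a # vs) = 0" for a
      by (auto simp: Q\<sigma>_def split: list.split dest!: arg_cong[where f = length])
    then show ?thesis by simp
  qed
  show "Q\<sigma> (us @ (n, x) # (m, y) # vs) = signed ((n - 1) * (m - 1)) (Q\<sigma> (us @ (m, y) # (n, x) # vs))"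
    if y: "y \<in> gpart L m" for m y
  proof (cases "us = [] \<and> vs = []")
    case True
    have "s (gbracket L n m x y) = s (gsmult L (- ((-1) powi (n * m))) (gbracket L m n y x))"
      by (subst dgla_antisym[OF dgla x y]) (rule refl)
    also have "\<dots> = - signed (n * m) (s (gbracket L m n y x))"
      by (simp add: s_scale[OF cl(2)[OF y x]] scale_powi_minus_one)
    finally show ?thesis using True
      by (cases "even n"; cases "even m"; simp add: signed_def)
  next
    case False
    then have "length (us @ a # b # vs) \<ge> 3" for a b by (cases us; cases vs) auto
    then have "Q\<sigma> (us @ a # b # vs) = 0" for a b
      by (auto simp: Q\<sigma>_def split: list.split dest!: arg_cong[where f = length])
    then show ?thesis by simp
  qed
qed

text \<open>
  The composite \<open>s Q\<^sup>2\<close> vanishes: on one letter by \<open>d\<^sup>2 = 0\<close>, on two letters by the Leibniz rule, on three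
  letters by the Jacobi identity.
\<close>
lemma Q_transpose_Q\<sigma>: "w \<in> words L \<Longrightarrow> Q_transpose L Q\<sigma> w = 0"
proof (cases w rule: word_cases)
  note cl = dgla_diff_closed[OF dgla] dgla_bracket_closed[OF dgla]
  {
    case 1 then show ?thesis by simp
  next
    case (2 x)
    assume "w \<in> words L"
    then have "snd x \<in> gpart L (fst x)" by (simp add: 2 words_Cons)
    then show ?thesis by (simp add: 2 Q_transpose_Cons dgla_diff_diff[OF dgla] s_zero)
  next
    case (3 a b)
    assume "w \<in> words L"
    obtain m x n y where ab: "a = (m, x)" "b = (n, y)" by (cases a, cases b)
    have x: "x \<in> gpart L m" and y: "y \<in> gpart L n" using \<open>w \<in> words L\<close> by (simp_all add: 3 ab words_Cons)
    have "gsmult L ((-1) powi m) (gbracket L m (n + 1) x (gdiff L y)) \<in> gpart L (m + (n + 1))"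
      by (intro dgla_gsmult_closed[OF dgla] cl x y)
    then have e: "gsmult L ((-1) powi m) (gbracket L m (n + 1) x (gdiff L y)) \<in> gpart L (m + 1 + n)"
      by (simp add: ac_simps)
    have "s (gdiff L (gbracket L m n x y)) =
        s (gbracket L (m + 1) n (gdiff L x) y) + signed m (s (gbracket L m (n + 1) x (gdiff L y)))"
      unfolding dgla_leibniz[OF dgla x y] s_add[OF cl(2)[OF cl(1)[OF x] y] e]
        s_scale[OF cl(2)[OF x cl(1)[OF y]]] scale_powi_minus_one by (rule refl)
    then show ?thesis
      by (simp add: 3 ab Q_transpose_Cons ad_transpose_Cons) (simp add: signed_def)
  next
    case (4 a b c)
    assume "w \<in> words L"
    obtain m x n y l z where abc: "a = (m, x)" "b = (n, y)" "c = (l, z)" by (cases a, cases b, cases c)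
    have x: "x \<in> gpart L m" and y: "y \<in> gpart L n" and z: "z \<in> gpart L l"
      using \<open>w \<in> words L\<close> by (simp_all add: 4 abc words_Cons)
    have "gsmult L ((-1) powi (m * n)) (gbracket L n (m + l) y (gbracket L m l x z)) \<in> gpart L (n + (m + l))"
      by (intro dgla_gsmult_closed[OF dgla] cl x y z)
    then have e: "gsmult L ((-1) powi (m * n)) (gbracket L n (m + l) y (gbracket L m l x z)) \<in> gpart L (m + n + l)"
      by (simp add: ac_simps)
    have "s (gbracket L m (n + l) x (gbracket L n l y z)) =
        s (gbracket L (m + n) l (gbracket L m n x y) z) +
        signed (m * n) (s (gbracket L n (m + l) y (gbracket L m l x z)))"
      unfolding dgla_jacobi[OF dgla x y z] s_add[OF cl(2)[OF cl(2)[OF x y] z] e]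
        s_scale[OF cl(2)[OF y cl(2)[OF x z]]] scale_powi_minus_one by (rule refl)
    then show ?thesis
      by (simp add: 4 abc Q_transpose_Cons ad_transpose_Cons)
        (cases "even m"; cases "even n"; simp add: signed_def)
  next
    case 5
    assume "w \<in> words L"
    then show ?thesis
      by (rule Q_transpose_vanish[where n = 3, rotated])
        (use 5 in \<open>auto simp: Q\<sigma>_def split: list.split\<close>)
  }
qed

definition \<delta>\<sigma> :: "'l word \<Rightarrow> 'a" where "\<delta>\<sigma> = delta A L 1 \<sigma>"

lemma \<delta>\<sigma>_eq: "w \<in> words L \<Longrightarrow> \<delta>\<sigma> w = der A (\<sigma> w) + Q\<sigma> w"
  by (simp add: \<delta>\<sigma>_def delta_def gvs_of_eq comp_Q_eq_Q_transpose[OF dgla \<sigma>_Hom_S] Q_transpose_\<sigma>)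

lemma der_\<sigma>_Hom_S: "(\<lambda>w. der A (\<sigma> w)) \<in> Hom_S 2 L V"
  using Hom_S_map[OF \<sigma>_Hom_S, of "der A" 1] by (simp add: der.add der.scale der_gr)

lemma \<delta>\<sigma>_Hom_S: "\<delta>\<sigma> \<in> Hom_S 2 L V"
  by (rule Hom_S_cong[OF dgla Hom_S_plus[OF der_\<sigma>_Hom_S Q\<sigma>_Hom_S] \<delta>\<sigma>_eq])

definition \<sigma>\<sigma> :: "'l word \<Rightarrow> 'a" where "\<sigma>\<sigma> = conv 1 \<sigma> \<sigma>"

lemma \<sigma>\<sigma>_Hom_S: "\<sigma>\<sigma> \<in> Hom_S 2 L V"
  using conv_Hom_S[OF \<sigma>_Hom_S \<sigma>_Hom_S] by (simp add: \<sigma>\<sigma>_def)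

definition \<rho> :: "'l word \<Rightarrow> 'a" where "\<rho> = const_cochain (curv A)"

lemma \<rho>_Hom_S: "\<rho> \<in> Hom_S 2 L V"
  by (simp add: \<rho>_def const_cochain_Hom_S curv_mem_gr)

text \<open>
  The values of \<open>F(1)\<close>: \<open>R\<close> on the empty word, the failure of \<open>s\<close> to commute with the differential on one
  letter and, up to sign, with the bracket on two letters.
\<close>
lemma curvature_mem_I:
  assumes "w \<in> words L"
  shows "\<rho> w + \<delta>\<sigma> w + \<sigma>\<sigma> w \<in> I"
proof (cases w rule: word_cases)
  case 1
  then show ?thesis by (simp add: \<rho>_def const_cochain_def \<delta>\<sigma>_eq \<sigma>\<sigma>_def conv_Nil curv_I der.zero)
next
  case (2 x)
  then have "snd x \<in> gpart L (fst x)" using assms by (simp add: words_Cons)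
  then show ?thesis using assms s_diff_mod_I
    by (simp add: 2 \<rho>_def const_cochain_def \<delta>\<sigma>_eq \<sigma>\<sigma>_def conv_Nil conv_Cons)
next
  case (3 a b)
  obtain m x n y where ab: "a = (m, x)" "b = (n, y)" by (cases a, cases b)
  have x: "x \<in> gpart L m" and y: "y \<in> gpart L n" using assms by (simp_all add: 3 ab words_Cons)
  have "\<rho> w + \<delta>\<sigma> w + \<sigma>\<sigma> w = signed m (s (gbracket L m n x y) - gcomm A m n (s x) (s y))"
    unfolding \<delta>\<sigma>_eq[OF assms]
    by (simp add: 3 ab \<rho>_def const_cochain_def \<sigma>\<sigma>_def conv_Nil conv_Cons gcomm_eq der.zero)
      (cases "even m"; cases "even n"; simp add: signed_def)
  then show ?thesis
    using add_closed_signed[OF add_closed_subspace[OF subspace_I] s_bracket_mod_I[OF x y]] by simp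
next
  case (4 a b c)
  then show ?thesis unfolding \<delta>\<sigma>_eq[OF assms]
    by (simp add: \<rho>_def const_cochain_def \<sigma>\<sigma>_def conv_Nil conv_Cons der.zero subspace_0[OF subspace_I])
next
  case 5
  have "\<sigma>\<sigma> w \<in> {0}" unfolding \<sigma>\<sigma>_def
  proof (rule conv_mem[OF _ _ assms])
    fix u v :: "'l word" assume "length u + length v = length w"
    then have "length u \<ge> 2 \<or> length v \<ge> 2" using 5 by auto
    then show "\<sigma> u * \<sigma> v \<in> {0}" by (auto simp: \<sigma>_def linear_cochain_def split: list.split)
  qed (simp add: add_closed_def)
  then show ?thesis unfolding \<delta>\<sigma>_eq[OF assms]
    using 5 by (auto simp: \<rho>_def const_cochain_def \<sigma>_def linear_cochain_def Q\<sigma>_def der.zero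
      subspace_0[OF subspace_I] split: list.split)
qed

text \<open>
  The constant coefficient of \<open>\<delta>(F)\<close>. It vanishes because \<open>d R = 0\<close> and \<open>Q\<close> never yields the empty word.
\<close>
lemma cdelta_\<rho>: "cdelta L (der A) 2 \<rho> w = 0"
  by (simp add: cdelta_def \<rho>_def Q_transpose_const_cochain)
    (simp add: const_cochain_def der_curv der.zero)

text \<open>
  \<open>\<delta>\<^sup>2(s) = [R, s]\<close>: the mixed terms cancel since \<open>d\<close> commutes with composition with \<open>Q\<close>, and \<open>s Q\<^sup>2 = 0\<close>.
\<close>
lemma cdelta_\<delta>\<sigma>:
  assumes w: "w \<in> words L"
  shows "cdelta L (der A) 2 \<delta>\<sigma> w = curv A * \<sigma> w - \<sigma> w * curv A"
proof -
  have "Q_transpose L \<delta>\<sigma> w = Q_transpose L (\<lambda>u. der A (\<sigma> u) + Q\<sigma> u) w"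
    using \<delta>\<sigma>_eq by (intro Q_transpose_cong[OF dgla _ w])
  also have "\<dots> = Q_transpose L (\<lambda>u. der A (\<sigma> u)) w"
    by (simp add: Q_transpose_add Q_transpose_Q\<sigma>[OF w])
  also have "\<dots> = der A (Q_transpose L \<sigma> w)"
    by (rule Q_transpose_map[OF dgla der.add refl w, symmetric])
  finally have "cdelta L (der A) 2 \<delta>\<sigma> w = der A (der A (\<sigma> w))"
    by (simp add: cdelta_def \<delta>\<sigma>_eq[OF w] der.add Q_transpose_\<sigma>[OF w] signed_def)
  also have "\<dots> = curv A * \<sigma> w - \<sigma> w * curv A"
  proof (cases "\<exists>x. w = [x]")
    case True
    then obtain x where x: "w = [x]" by blast
    then have "s (snd x) \<in> gr A (fst x)" using w s_gr by (simp add: words_Cons)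
    from der_der[OF this] show ?thesis by (simp add: x gcomm_eq signed_def)
  next
    case False
    then have "\<sigma> w = 0" by (auto simp: \<sigma>_def linear_cochain_def split: list.split)
    then show ?thesis by (simp add: der.zero)
  qed
  finally show ?thesis .
qed

lemma der_mult_cochain:
  assumes "f \<in> Hom_S p L V" and "u \<in> words L"
  shows "der A (f u * b) = der A (f u) * b + signed (p + wdeg u) (f u * der A b)"
  by (rule der_mult[OF Hom_S_degree[OF assms]])

lemma cdelta_\<sigma>: "w \<in> words L \<Longrightarrow> cdelta L (der A) 1 \<sigma> w = \<delta>\<sigma> w"
  by (simp add: cdelta_def \<delta>\<sigma>_eq Q_transpose_\<sigma> signed_def)

lemma cdelta_\<sigma>\<sigma>:
  assumes w: "w \<in> words L"
  shows "cdelta L (der A) 2 \<sigma>\<sigma> w = conv 1 \<delta>\<sigma> \<sigma> w - conv 2 \<sigma> \<delta>\<sigma> w"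
proof -
  have "cdelta L (der A) (1 + 1) \<sigma>\<sigma> w =
      conv 1 (cdelta L (der A) 1 \<sigma>) \<sigma> w + signed 1 (conv (1 + 1) \<sigma> (cdelta L (der A) 1 \<sigma>) w)"
    unfolding \<sigma>\<sigma>_def by (rule cdelta_conv[OF der.add der_mult_cochain[OF \<sigma>_Hom_S] w])
  also have "conv 1 (cdelta L (der A) 1 \<sigma>) \<sigma> w = conv 1 \<delta>\<sigma> \<sigma> w"
    using cdelta_\<sigma> by (intro conv_cong[OF _ _ w]) auto
  also have "conv (1 + 1) \<sigma> (cdelta L (der A) 1 \<sigma>) w = conv 2 \<sigma> \<delta>\<sigma> w"
    using cdelta_\<sigma> by (simp, intro conv_cong[OF _ _ w]) auto
  finally show ?thesis by (simp add: signed_def)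
qed

section \<open>Transgression\<close>

lemma star_conv: "star A q f g = conv q f g"
  by (rule ext) (rule star_eq_conv[OF vector_space_axioms])

text \<open>
  A sequence of cochains as one cochain with values in power series. This turns the product of
  polynomials in \<open>t\<close> into a convolution product.
\<close>
definition gen_fun :: "(nat \<Rightarrow> 'l word \<Rightarrow> 'a) \<Rightarrow> 'l word \<Rightarrow> 'a fps" where
  "gen_fun P w = Abs_fps (\<lambda>n. P n w)"

lemma gen_fun_nth: "gen_fun P w $ n = P n w" by (simp add: gen_fun_def)

lemma gen_fun_star_t: "gen_fun (star_t A q P P') = conv q (gen_fun P) (gen_fun P')"
  by (intro ext fps_ext) (simp add: gen_fun_nth star_t_def star_conv conv_fps_nth)

definition F where "F = gen_fun (curvature_t A L s)"
definition S where "S = gen_fun (const_t \<sigma>)"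
definition Fpow where "Fpow k = gen_fun (power_t A 2 (curvature_t A L s) k)"

lemma F_nth: "F w $ 0 = \<rho> w" "F w $ Suc 0 = \<delta>\<sigma> w" "F w $ Suc (Suc 0) = \<sigma>\<sigma> w"
  by (simp_all add: F_def gen_fun_nth curvature_t_def \<rho>_def \<delta>\<sigma>_def \<sigma>\<sigma>_def star_conv \<sigma>_def[symmetric])

lemma F_nth_cases: "F w $ n = (if n = 0 then \<rho> w else if n = 1 then \<delta>\<sigma> w else if n = 2 then \<sigma>\<sigma> w else 0)"
  by (simp add: F_def gen_fun_nth curvature_t_def \<rho>_def \<delta>\<sigma>_def \<sigma>\<sigma>_def star_conv \<sigma>_def[symmetric])

lemma S_nth: "S w $ n = (if n = 0 then \<sigma> w else 0)"
  by (simp add: S_def gen_fun_nth const_t_def)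

lemma Fpow_0: "Fpow 0 = const_cochain 1"
  by (intro ext fps_ext) (simp add: Fpow_def gen_fun_nth const_t_def const_cochain_def)

lemma Fpow_Suc: "Fpow (Suc k) = conv 2 (Fpow k) F"
  by (simp add: Fpow_def F_def gen_fun_star_t)

lemma conv_even: "even q \<Longrightarrow> conv q f g w = conv 0 f g w"
  by (rule conv_parity) simp

lemma conv_odd: "odd q \<Longrightarrow> conv q f g w = conv 1 f g w"
  by (rule conv_parity) simp

lemma conv_even_fun: "even q \<Longrightarrow> conv q f g = conv 0 f g"
  by (rule ext) (rule conv_even)

lemma Fpow_Suc': "Fpow (Suc k) = conv 0 (Fpow k) F"
  by (simp add: Fpow_Suc conv_even_fun[of 2])

lemma conv_Fpow_0: "conv 0 (Fpow 0) f = f" "conv 0 f (Fpow 0) = f" for f :: "'l word \<Rightarrow> 'a fps"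
  by (simp_all add: fun_eq_iff Fpow_0 conv_const_left conv_const_right one_mult_fps signed_def)

lemma conv_assoc_0: "conv 0 (conv 0 f g) h = conv 0 f (conv 0 g h)"
  by (rule ext) (simp add: conv_assoc)

lemma conv_Fpow_add: "conv 0 (Fpow i) (Fpow j) = Fpow (i + j)"
  by (induction j) (simp_all add: conv_Fpow_0 Fpow_Suc' flip: conv_assoc_0)

lemma conv_F_Fpow: "conv 0 F (Fpow j) = Fpow (Suc j)"
  using conv_Fpow_add[of 1 j] by (simp add: Fpow_Suc' conv_Fpow_0)

lemma F_bounded: "F w \<in> bounded_fps 2"
  by (simp add: bounded_fps_def F_nth_cases)

lemma S_bounded: "S w \<in> bounded_fps 0"
  by (simp add: bounded_fps_def S_nth)

lemma Fpow_bounded: "Fpow k w \<in> bounded_fps (2 * k)"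
proof (induction k arbitrary: w)
  case 0
  show ?case by (auto simp: Fpow_0 const_cochain_def bounded_fps_def)
next
  case (Suc k)
  have "conv 2 (Fpow k) F w \<in> bounded_fps (2 * k + 2)"
    by (rule conv_bounded_fps[OF Suc F_bounded])
  then show ?case by (simp add: Fpow_Suc)
qed

definition homogeneous :: "int \<Rightarrow> ('l word \<Rightarrow> 'a fps) \<Rightarrow> bool" where
  "homogeneous p f \<longleftrightarrow> (\<forall>n. (\<lambda>w. f w $ n) \<in> Hom_S p L V)"

lemma homogeneous_conv:
  assumes "homogeneous p f" and "homogeneous q g"
  shows "homogeneous (p + q) (conv q f g)"
  using assms unfolding homogeneous_def conv_fps_nth
  by (intro allI Hom_S_sum conv_Hom_S) auto

lemma homogeneous_F: "homogeneous 2 F"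
  unfolding homogeneous_def
proof
  fix n
  show "(\<lambda>w. F w $ n) \<in> Hom_S 2 L V"
    using \<rho>_Hom_S \<delta>\<sigma>_Hom_S \<sigma>\<sigma>_Hom_S Hom_S_zero[of 2 L]
    by (cases "n = 0"; cases "n = 1"; cases "n = 2"; simp add: F_nth_cases)
qed

lemma homogeneous_degree: "homogeneous p f \<Longrightarrow> u \<in> words L \<Longrightarrow> f u $ n \<in> gr A (p + wdeg u)"
  using Hom_S_degree[of "\<lambda>w. f w $ n" p L u] by (simp add: homogeneous_def)

lemma homogeneous_S: "homogeneous 1 S"
  unfolding homogeneous_def
proof
  fix n
  show "(\<lambda>w. S w $ n) \<in> Hom_S 1 L V"
    using \<sigma>_Hom_S Hom_S_zero[of 1 L] by (cases "n = 0"; simp add: S_nth)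
qed

lemma homogeneous_Fpow: "homogeneous (2 * int k) (Fpow k)"
proof (induction k)
  case 0
  have "(\<lambda>w. Fpow 0 w $ n) = (if n = 0 then const_cochain 1 else (\<lambda>w. 0))" for n
    by (auto simp: Fpow_0 const_cochain_def)
  then show ?case by (simp add: homogeneous_def Hom_S_zero const_cochain_Hom_S one_mem_gr)
next
  case (Suc k)
  then show ?case using homogeneous_conv[OF Suc homogeneous_F] by (simp add: Fpow_Suc algebra_simps)
qed

definition integrand where "integrand k = conv 1 (Fpow k) S"

lemma homogeneous_integrand: "homogeneous (2 * int k + 1) (integrand k)"
  unfolding integrand_def by (rule homogeneous_conv[OF homogeneous_Fpow homogeneous_S])

lemma integrand_bounded: "integrand k w \<in> bounded_fps (2 * k)"
proof -
  have "conv 1 (Fpow k) S w \<in> bounded_fps (2 * k + 0)"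
    by (rule conv_bounded_fps[OF Fpow_bounded S_bounded])
  then show ?thesis by (simp add: integrand_def)
qed

definition commutators_t :: "'a fps set" where "commutators_t = {p. \<forall>n. p $ n \<in> commutators A}"

lemma add_closed_commutators: "add_closed (commutators A)"
  by (rule add_closed_subspace[OF subspace_commutators])

lemma add_closed_commutators_t: "add_closed commutators_t"
  using add_closed_commutators by (auto simp: add_closed_def commutators_t_def)

text \<open>
  In each coefficient the Cauchy products of the two orders match after reversing the summation.
\<close>
lemma conv_commute_mod_commutators:
  assumes f: "homogeneous p f" and g: "homogeneous q g" and w: "w \<in> words L"
  shows "conv q f g w - signed (p * q) (conv p g f w) \<in> commutators_t"
proof (rule conv_graded_commute[OF add_closed_commutators_t _ w])
  fix u v assume u: "u \<in> words L" and v: "v \<in> words L"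
  have a: "f u $ i \<in> gr A (p + wdeg u)" and b: "g v $ i \<in> gr A (q + wdeg v)" for i
    by (rule homogeneous_degree[OF f u], rule homogeneous_degree[OF g v])
  let ?c = "gcomm A (p + wdeg u) (q + wdeg v)"
  have "(f u * g v - signed ((p + wdeg u) * (q + wdeg v)) (g v * f u)) $ n =
      (\<Sum>i\<le>n. ?c (f u $ i) (g v $ (n - i)))" for n
  proof -
    have "(g v * f u) $ n = (\<Sum>i\<le>n. g v $ (n - i) * f u $ i)"
      unfolding fps_mult_nth atLeast0AtMost
      by (rule sum.reindex_bij_witness[of _ "\<lambda>i. n - i" "\<lambda>i. n - i"]) auto
    then show ?thesis
      by (simp add: fps_mult_nth atLeast0AtMost gcomm_eq fps_nth_signed signed_def sum_subtractf sum.distrib sum_negf)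
  qed
  moreover have "(\<Sum>i\<le>n. ?c (f u $ i) (g v $ (n - i))) \<in> commutators A" for n
    by (rule add_closed_sum[OF add_closed_commutators gcomm_commutators[OF a b]])
  ultimately show "f u * g v - signed ((p + wdeg u) * (q + wdeg v)) (g v * f u) \<in> commutators_t"
    by (simp only: commutators_t_def mem_Collect_eq) blast
qed

definition der_coeff :: "'a fps \<Rightarrow> 'a fps" where "der_coeff p = Abs_fps (\<lambda>n. der A (p $ n))"

lemma der_coeff_nth: "der_coeff p $ n = der A (p $ n)" by (simp add: der_coeff_def)

lemma der_coeff_add: "der_coeff (p + q) = der_coeff p + der_coeff q"
  by (simp add: fps_eq_iff der_coeff_nth der.add)

lemma der_coeff_mult:
  assumes "\<And>n. a $ n \<in> gr A m"
  shows "der_coeff (a * b) = der_coeff a * b + signed m (a * der_coeff b)"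
proof (rule fps_ext)
  fix n :: nat
  have "der A (\<Sum>i\<le>n. a $ i * b $ (n - i)) =
      (\<Sum>i\<le>n. der A (a $ i) * b $ (n - i)) + signed m (\<Sum>i\<le>n. a $ i * der A (b $ (n - i)))"
    by (simp add: der.sum der_mult[OF assms] sum.distrib signed_def sum_negf)
  then show "der_coeff (a * b) $ n = (der_coeff a * b + signed m (a * der_coeff b)) $ n"
    by (simp add: der_coeff_nth fps_mult_nth fps_nth_signed atLeast0AtMost)
qed

abbreviation D :: "int \<Rightarrow> ('l word \<Rightarrow> 'a fps) \<Rightarrow> 'l word \<Rightarrow> 'a fps" where
  "D \<equiv> cdelta L der_coeff"

lemma D_conv:
  assumes f: "homogeneous p f" and w: "w \<in> words L"
  shows "D (p + q) (conv q f g) w = conv q (D p f) g w + signed p (conv (q + 1) f (D q g) w)"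
proof (rule cdelta_conv[OF der_coeff_add _ w])
  show "der_coeff (f u * g v) = der_coeff (f u) * g v + signed (p + wdeg u) (f u * der_coeff (g v))"
    if "u \<in> words L" for u v
    by (rule der_coeff_mult[OF homogeneous_degree[OF f that]])
qed

lemma D_nth: "w \<in> words L \<Longrightarrow> D p f w $ n = cdelta L (der A) p (\<lambda>u. f u $ n) w"
  using Q_transpose_map[OF dgla, of "\<lambda>a. a $ n" f "\<lambda>u. f u $ n" w]
  by (simp add: cdelta_def der_coeff_nth fps_nth_signed)

lemma conv_S_nth: "conv q f S w $ n = conv q (\<lambda>u. f u $ n) \<sigma> w"
proof -
  have "conv q f S w $ n = (\<Sum>i\<le>n. if i = n then conv q (\<lambda>u. f u $ n) \<sigma> w else 0)"
    unfolding conv_fps_nth by (intro sum.cong refl) (auto simp: S_nth)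
  then show ?thesis by simp
qed

lemma conv_S_left_nth: "conv q S f w $ n = conv q \<sigma> (\<lambda>u. f u $ n) w"
proof -
  have "conv q S f w $ n = (\<Sum>i\<le>n. if i = 0 then conv q \<sigma> (\<lambda>u. f u $ n) w else 0)"
    unfolding conv_fps_nth by (intro sum.cong refl) (auto simp: S_nth)
  then show ?thesis by simp
qed

text \<open>
  Coefficientwise: \<open>\<delta>(R) = 0\<close>, \<open>\<delta>\<^sup>2(s) = [R, s]\<close>, the Leibniz rule for \<open>s \<star> s\<close>, and associativity in degree 3.
\<close>
lemma bianchi:
  assumes w: "w \<in> words L"
  shows "D 2 F w = mult_t (conv 1 F S w - conv 0 S F w)"
proof (rule fps_ext)
  fix n :: nat
  have c: "conv 1 \<rho> \<sigma> w = curv A * \<sigma> w" "conv 0 \<sigma> \<rho> w = \<sigma> w * curv A"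
    by (simp_all add: \<rho>_def conv_const_left conv_const_right signed_def)
  have a: "conv 1 \<sigma>\<sigma> \<sigma> w = conv 0 \<sigma> \<sigma>\<sigma> w"
    by (simp add: \<sigma>\<sigma>_def conv_assoc conv_even[of 2])
  have z: "cdelta L (der A) 2 (\<lambda>u. 0) w = 0"
    using Q_transpose_map[OF dgla, of "\<lambda>_. 0::'a" \<sigma> "\<lambda>_. 0" w] w by (simp add: cdelta_def der.zero)
  consider "n = 0" | "n = 1" | "n = 2" | "n = 3" | "n - 4 + 4 = n" by linarith
  then consider "n = 0" | "n = 1" | "n = 2" | "n = 3" | m where "n = m + 4" by metis
  then show "D 2 F w $ n = mult_t (conv 1 F S w - conv 0 S F w) $ n"
    by cases
      (simp_all add: D_nth[OF w] F_nth_cases mult_t_nth conv_S_nth conv_S_left_nth cdelta_\<rho> cdelta_\<delta>\<sigma>[OF w] c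
        cdelta_\<sigma>\<sigma>[OF w] conv_even[of 2] a z)
qed

text \<open>
  \<open>\<delta>\<close> and \<open>t [-, s]\<close> are derivations that agree on \<open>F\<close>, hence on its powers.
\<close>
lemma D_Fpow:
  assumes "w \<in> words L"
  shows "D (2 * int k) (Fpow k) w = mult_t (conv 1 (Fpow k) S w - conv 0 S (Fpow k) w)"
  using assms
proof (induction k arbitrary: w)
  case 0
  have "der A 1 = 0" using der_mult[OF one_mem_gr, of 1] by (simp add: signed_def)
  then have "der_coeff (const_cochain 1 w) = 0"
    by (simp add: const_cochain_def fps_eq_iff der_coeff_nth der.zero)
  then have "D 0 (Fpow 0) w = 0" by (simp add: cdelta_def Fpow_0 Q_transpose_const_cochain)
  moreover have "conv 1 (Fpow 0) S w = conv 0 S (Fpow 0) w"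
    by (simp add: Fpow_0 conv_const_left conv_const_right one_mult_fps signed_def)
  ultimately show ?case by (simp add: fps_eq_iff mult_t_nth)
next
  case (Suc k)
  have "D (2 * int k + 2) (Fpow (Suc k)) w =
      conv 2 (D (2 * int k) (Fpow k)) F w + conv 3 (Fpow k) (D 2 F) w"
    unfolding Fpow_Suc using D_conv[OF homogeneous_Fpow Suc.prems, of k 2 F] by (simp add: signed_def)
  also have "conv 2 (D (2 * int k) (Fpow k)) F w =
      conv 2 (\<lambda>u. mult_t (conv 1 (Fpow k) S u - conv 0 S (Fpow k) u)) F w"
    by (rule conv_cong[OF Suc.IH refl Suc.prems])
  also have "\<dots> = mult_t (conv 2 (conv 1 (Fpow k) S) F w - conv 2 (conv 0 S (Fpow k)) F w)"
    unfolding conv_mult_t_left conv_diff_left ..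
  also have "conv 3 (Fpow k) (D 2 F) w =
      conv 3 (Fpow k) (\<lambda>u. mult_t (conv 1 F S u - conv 0 S F u)) w"
    by (rule conv_cong[OF refl bianchi Suc.prems])
  also have "\<dots> = mult_t (conv 3 (Fpow k) (conv 1 F S) w - conv 3 (Fpow k) (conv 0 S F) w)"
    unfolding conv_mult_t_right conv_diff_right ..
  also have "conv 2 (conv 1 (Fpow k) S) F w = conv 3 (Fpow k) (conv 0 S F) w"
    unfolding conv_assoc by (simp add: conv_even_fun[of 2])
  also have "conv 2 (conv 0 S (Fpow k)) F w = conv 0 S (Fpow (Suc k)) w"
    by (simp add: conv_assoc Fpow_Suc conv_even[of 2])
  also have "conv 3 (Fpow k) (conv 1 F S) w = conv 1 (Fpow (Suc k)) S w"
    by (simp add: conv_assoc Fpow_Suc)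
  finally show ?case by (simp add: mult_t_diff algebra_simps)
qed

definition partial_t :: "'a fps \<Rightarrow> 'a fps" where
  "partial_t p = Abs_fps (\<lambda>n. scal A (of_nat (n + 1)) (p $ (n + 1)))"

lemma partial_t_nth: "partial_t p $ n = scal A (of_nat (Suc n)) (p $ Suc n)"
  by (simp add: partial_t_def)

lemma partial_t_add: "partial_t (p + q) = partial_t p + partial_t q"
  by (simp add: fps_eq_iff partial_t_nth scale_right_distrib)

lemma partial_t_mult: "partial_t (p * q) = partial_t p * q + p * partial_t q"
proof (rule fps_ext)
  fix n :: nat
  let ?a = "\<lambda>i. scal A (of_nat i) (p $ i * q $ (Suc n - i))"
  let ?b = "\<lambda>i. scal A (of_nat (Suc n - i)) (p $ i * q $ (Suc n - i))"
  have "partial_t (p * q) $ n = (\<Sum>i\<le>Suc n. scal A (of_nat (Suc n)) (p $ i * q $ (Suc n - i)))"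
    by (simp only: partial_t_nth fps_mult_nth atLeast0AtMost scale_sum_right)
  also have "\<dots> = (\<Sum>i\<le>Suc n. ?a i + ?b i)"
    by (intro sum.cong refl) (simp flip: scale_left_distrib of_nat_add)
  also have "\<dots> = (\<Sum>i\<le>Suc n. ?a i) + (\<Sum>i\<le>Suc n. ?b i)" by (rule sum.distrib)
  also have "(\<Sum>i\<le>Suc n. ?a i) = (\<Sum>i\<le>n. ?a (Suc i))"
    by (simp add: sum.atMost_Suc_shift del: sum.atMost_Suc)
  also have "(\<Sum>i\<le>Suc n. ?b i) = (\<Sum>i\<le>n. ?b i)" by simp
  finally show "partial_t (p * q) $ n = (partial_t p * q + p * partial_t q) $ n"
    by (simp add: fps_mult_nth atLeast0AtMost partial_t_nth Suc_diff_le
        flip: scale_mult_left scale_mult_right)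
qed

lemma homogeneous_partial_t:
  assumes "homogeneous p f"
  shows "homogeneous p (\<lambda>w. partial_t (f w))"
proof -
  have "(\<lambda>w. scal A c (f w $ n)) \<in> Hom_S (p + 0) L V" for n c
    using assms by (intro Hom_S_map)
      (auto simp: homogeneous_def scale_right_distrib mult.commute intro: subspace_scale[OF subspace_G])
  then show ?thesis by (simp add: homogeneous_def partial_t_nth)
qed

text \<open>
  The derivative of a power is a sum of products with one factor \<open>\<partial>F/\<partial>t\<close>, which is moved to the end by
  cyclic permutation. The power \<open>F\<^sup>j\<close> on the right makes the induction work: splitting a factor \<open>F\<close> off
  the differentiated power enlarges \<open>j\<close>.
\<close>
lemma partial_t_Fpow:
  assumes w: "w \<in> words L"
  shows "conv 0 (\<lambda>u. partial_t (Fpow (Suc k) u)) (Fpow j) w -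
     Abs_fps (\<lambda>n. scal A (of_nat (Suc k)) (conv 0 (Fpow (k + j)) (\<lambda>u. partial_t (F u)) w $ n)) \<in> commutators_t"
proof (induction k arbitrary: j)
  note hF = homogeneous_partial_t[OF homogeneous_F]
  {
    case 0
    have "conv (2 * int j) (\<lambda>u. partial_t (F u)) (Fpow j) w -
        signed (2 * (2 * int j)) (conv 2 (Fpow j) (\<lambda>u. partial_t (F u)) w) \<in> commutators_t"
      by (rule conv_commute_mod_commutators[OF hF homogeneous_Fpow w])
    moreover have "Fpow (Suc 0) = F" by (simp add: Fpow_Suc' conv_Fpow_0)
    ultimately show ?case by (simp add: signed_def conv_even[of 2] conv_even[of "2 * int j"] fps_nth_inverse)
  next
    case (Suc k)
    let ?dF = "\<lambda>u. partial_t (F u)"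
    have "(\<lambda>u. partial_t (Fpow (Suc (Suc k)) u)) = (\<lambda>u. conv 0 (\<lambda>u. partial_t (Fpow (Suc k) u)) F u
        + conv 0 (Fpow (Suc k)) ?dF u)"
      unfolding Fpow_Suc'[of "Suc k"]
      by (rule ext) (rule even_derivation_conv[OF partial_t_add partial_t_mult])
    then have 1: "conv 0 (\<lambda>u. partial_t (Fpow (Suc (Suc k)) u)) (Fpow j) w =
        conv 0 (\<lambda>u. partial_t (Fpow (Suc k) u)) (Fpow (Suc j)) w + conv 0 (conv 0 (Fpow (Suc k)) ?dF) (Fpow j) w"
      by (simp add: conv_add_left conv_assoc_0 conv_F_Fpow)
    have "homogeneous (2 * int (Suc k) + 2) (conv 2 (Fpow (Suc k)) ?dF)"
      by (rule homogeneous_conv[OF homogeneous_Fpow hF])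
    then have "conv (2 * int j) (conv 2 (Fpow (Suc k)) ?dF) (Fpow j) w -
        signed ((2 * int (Suc k) + 2) * (2 * int j))
          (conv (2 * int (Suc k) + 2) (Fpow j) (conv 2 (Fpow (Suc k)) ?dF) w) \<in> commutators_t"
      by (rule conv_commute_mod_commutators[OF _ homogeneous_Fpow w])
    then have 2: "conv 0 (conv 0 (Fpow (Suc k)) ?dF) (Fpow j) w - conv 0 (Fpow (Suc k + j)) ?dF w \<in> commutators_t"
      by (simp add: conv_even[of "_ + _"] conv_even[of "2 * _"] conv_even_fun[of 2] signed_def
          conv_Fpow_add add.commute flip: conv_assoc_0)
    have e: "Abs_fps (\<lambda>n. scal A (of_nat (Suc (Suc k))) (p $ n)) =
        Abs_fps (\<lambda>n. scal A (of_nat (Suc k)) (p $ n)) + p" for p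
      by (simp only: fps_eq_iff fps_nth_Abs_fps fps_add_nth of_nat_Suc[of "Suc k"] scale_left_distrib scale_one)
        (simp add: add.commute)
    show ?case
      unfolding 1 e add_diff_add
      using add_closed_add[OF add_closed_commutators_t Suc[of "Suc j"] 2] by simp
  }
qed

text \<open>
  Both \<open>\<delta>(F\<^sup>k) \<star> s\<close> and \<open>F\<^sup>k \<star> \<delta>(s)\<close> contribute. The first is \<open>t (F\<^sup>k \<star> s \<star> s - s \<star> F\<^sup>k \<star> s)\<close>, and its second
  term equals the first up to a commutator, with the sign of two odd elements.
\<close>
lemma D_integrand:
  assumes w: "w \<in> words L"
  shows "D (2 * int k + 1) (integrand k) w - conv 0 (Fpow k) (\<lambda>u. partial_t (F u)) w \<in> commutators_t"
proof -
  have dS: "D 1 S u = Abs_fps (\<lambda>n. if n = 0 then \<delta>\<sigma> u else 0)" if u: "u \<in> words L" for u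
  proof (rule fps_ext)
    fix n :: nat
    have z: "cdelta L (der A) 1 (\<lambda>u. 0) u = 0"
      using Q_transpose_map[OF dgla, of "\<lambda>_. 0::'a" \<sigma> "\<lambda>_. 0" u] u by (simp add: cdelta_def der.zero)
    show "D 1 S u $ n = Abs_fps (\<lambda>n. if n = 0 then \<delta>\<sigma> u else 0) $ n"
      by (simp add: D_nth[OF u] S_nth cdelta_\<sigma>[OF u] z)
  qed
  have dF: "partial_t (F u) = D 1 S u + mult_t (conv 1 S S u + conv 1 S S u)" if u: "u \<in> words L" for u
  proof (rule fps_ext)
    fix n :: nat
    have two: "scal A 2 a = a + a" for a
      using scale_left_distrib[of 1 1 a] by simp
    have ss: "conv 1 S S u $ m = (if m = 0 then \<sigma>\<sigma> u else 0)" for m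
      by (simp add: conv_S_nth S_nth \<sigma>\<sigma>_def)
    consider "n = 0" | "n = 1" | "n > 1" by linarith
    then show "partial_t (F u) $ n = (D 1 S u + mult_t (conv 1 S S u + conv 1 S S u)) $ n"
      by cases (simp_all add: partial_t_nth F_nth_cases dS[OF u] mult_t_nth ss two)
  qed
  have "D (2 * int k + 1) (integrand k) w = conv 1 (D (2 * int k) (Fpow k)) S w + conv 2 (Fpow k) (D 1 S) w"
    unfolding integrand_def using D_conv[OF homogeneous_Fpow w, of k 1 S] by (simp add: signed_def)
  also have "conv 1 (D (2 * int k) (Fpow k)) S w =
      conv 1 (\<lambda>u. mult_t (conv 1 (Fpow k) S u - conv 0 S (Fpow k) u)) S w"
    by (rule conv_cong[OF D_Fpow refl w])
  also have "\<dots> = mult_t (conv 1 (conv 1 (Fpow k) S) S w - conv 1 (conv 0 S (Fpow k)) S w)"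
    unfolding conv_mult_t_left conv_diff_left ..
  also have "conv 1 (conv 1 (Fpow k) S) S w = conv 0 (Fpow k) (conv 1 S S) w"
    by (simp add: conv_assoc conv_even[of 2])
  also have "conv 1 (conv 0 S (Fpow k)) S w = conv 1 S (integrand k) w"
    by (simp add: conv_assoc integrand_def)
  finally have 1: "D (2 * int k + 1) (integrand k) w =
      mult_t (conv 0 (Fpow k) (conv 1 S S) w - conv 1 S (integrand k) w) + conv 0 (Fpow k) (D 1 S) w"
    by (simp add: conv_even[of 2])
  have "conv (2 * int k + 1) S (integrand k) w - signed (1 * (2 * int k + 1)) (conv 1 (integrand k) S w) \<in> commutators_t"
    by (rule conv_commute_mod_commutators[OF homogeneous_S homogeneous_integrand w])
  then have 2: "conv 1 S (integrand k) w + conv 0 (Fpow k) (conv 1 S S) w \<in> commutators_t"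
    by (simp add: conv_odd[of "2 * int k + 1"] signed_def integrand_def conv_assoc conv_even[of 2])
  have "conv 0 (Fpow k) (\<lambda>u. partial_t (F u)) w =
      conv 0 (Fpow k) (\<lambda>u. D 1 S u + mult_t (conv 1 S S u + conv 1 S S u)) w"
    by (rule conv_cong[OF refl dF w])
  also have "\<dots> = conv 0 (Fpow k) (D 1 S) w +
      mult_t (conv 0 (Fpow k) (conv 1 S S) w + conv 0 (Fpow k) (conv 1 S S) w)"
    unfolding conv_add_right conv_mult_t_right ..
  finally have dFw: "conv 0 (Fpow k) (\<lambda>u. partial_t (F u)) w = conv 0 (Fpow k) (D 1 S) w +
      mult_t (conv 0 (Fpow k) (conv 1 S S) w + conv 0 (Fpow k) (conv 1 S S) w)" .
  have "D (2 * int k + 1) (integrand k) w - conv 0 (Fpow k) (\<lambda>u. partial_t (F u)) w =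
      - mult_t (conv 1 S (integrand k) w + conv 0 (Fpow k) (conv 1 S S) w)"
    unfolding 1 dFw mult_t_diff mult_t_add by simp
  moreover have "mult_t p \<in> commutators_t" if "p \<in> commutators_t" for p
    using that by (simp add: commutators_t_def mult_t_nth add_closed_zero[OF add_closed_commutators])
  ultimately show ?thesis using add_closed_uminus[OF add_closed_commutators_t] 2 by simp
qed

text \<open>
  The integral from 0 to 1 of a polynomial of degree at most \<open>N\<close>. With a fixed cutoff it is additive on
  all power series.
\<close>
definition integral_to :: "nat \<Rightarrow> 'a fps \<Rightarrow> 'a" where
  "integral_to N p = (\<Sum>n\<le>N. scal A (1 / of_nat (n + 1)) (p $ n))"

lemma integral_to_add: "integral_to N (p + q) = integral_to N p + integral_to N q"
  by (simp add: integral_to_def scale_right_distrib sum.distrib)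

lemma integral_to_commutators_t: "p \<in> commutators_t \<Longrightarrow> integral_to N p \<in> commutators A"
  unfolding integral_to_def
  by (intro add_closed_sum[OF add_closed_commutators] subspace_scale[OF subspace_commutators])
    (simp add: commutators_t_def)

lemma integral_to_partial_t: "integral_to N (partial_t p) = (\<Sum>n\<le>Suc N. p $ n) - p $ 0"
proof -
  have "scal A (1 / of_nat (n + 1)) (partial_t p $ n) = p $ Suc n" for n
    unfolding partial_t_nth scale_scale by (simp del: of_nat_Suc)
  then have "integral_to N (partial_t p) = (\<Sum>n\<le>N. p $ Suc n)"
    by (simp add: integral_to_def)
  then show ?thesis by (simp add: sum.atMost_Suc_shift del: sum.atMost_Suc)
qed

lemma W_eq_integral: "N \<ge> 2 * k \<Longrightarrow> W A L s k w = scal A (1 / fact k) (integral_to N (integrand k w))"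
proof -
  assume N: "N \<ge> 2 * k"
  have X: "star_t A 1 (power_t A 2 (curvature_t A L s) k) (const_t (linear_cochain s)) n w = integrand k w $ n" for n
    unfolding integrand_def Fpow_def S_def \<sigma>_def gen_fun_star_t[symmetric] gen_fun_nth ..
  have "n \<le> N" if "integrand k w $ n \<noteq> 0" for n
    using integrand_bounded[of k w] that N by (auto simp: bounded_fps_def intro: leI order.strict_trans1)
  then have "(\<Sum>n | integrand k w $ n \<noteq> 0. scal A (1 / of_nat (n + 1)) (integrand k w $ n)) = integral_to N (integrand k w)"
    unfolding integral_to_def by (intro sum.mono_neutral_left) auto
  then show ?thesis by (simp add: W_def integral_t_def X)
qed

text \<open>
  On each word \<open>W\<close> is the same linear combination of the coefficients of \<open>F\<^sup>k \<star> s\<close>, which are symmetric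
  cochains.
\<close>
lemma W_Hom_S: "W A L s k \<in> Hom_S (2 * int k + 1) L V"
proof -
  have h: "(\<lambda>w. scal A c (f w)) \<in> Hom_S p L V" if "f \<in> Hom_S p L V" for c f p
    using Hom_S_map[OF that, of "scal A c" 0]
    by (simp add: scale_right_distrib mult.commute subspace_scale[OF subspace_G])
  have "(\<lambda>w. scal A (1 / fact k) (integral_to (2 * k) (integrand k w))) \<in> Hom_S (2 * int k + 1) L V"
    unfolding integral_to_def using homogeneous_integrand[of k]
    by (intro h Hom_S_sum) (simp add: homogeneous_def)
  moreover have "W A L s k = (\<lambda>w. scal A (1 / fact k) (integral_to (2 * k) (integrand k w)))"
    by (rule ext) (rule W_eq_integral[OF order_refl])
  ultimately show ?thesis by simp
qed

text \<open>
  Applied to \<open>h\<close> the evaluation at \<open>t = 1\<close> and at \<open>t = 0\<close>. The cutoff \<open>N\<close> bounds the degrees for which \<open>h\<close>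
  is multiplicative.
\<close>
lemma Fpow_value_mem:
  assumes add: "\<And>p q. h (p + q) = h p + h q" and one: "h 1 = 1"
    and mult: "\<And>p q a b. p \<in> bounded_fps a \<Longrightarrow> q \<in> bounded_fps b \<Longrightarrow> a + b \<le> N \<Longrightarrow> h (p * q) = h p * h q"
    and F: "\<And>u. u \<in> words L \<Longrightarrow> h (F u) \<in> I"
    and "2 * j \<le> N" and "w \<in> words L"
  shows "h (Fpow j w) \<in> subspace_power A I j"
  using assms(5,6)
proof (induction j arbitrary: w)
  case 0
  have "h 0 = 0" using add[of 0 0] by simp
  moreover have "0 \<in> subspace_power A I 0" by (simp add: subspace_power_def span_zero)
  ultimately show ?case using subspace_power_0 by (simp add: Fpow_0 const_cochain_def one)
next
  case (Suc j)
  have "h (Fpow (Suc j) w) = conv 2 (\<lambda>u. h (Fpow j u)) (\<lambda>u. h (F u)) w"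
    unfolding Fpow_Suc using Suc.prems
    by (intro conv_map[OF add mult[OF Fpow_bounded F_bounded]]) auto
  also have "\<dots> \<in> subspace_power A I (Suc j)"
  proof (rule conv_mem[OF _ _ Suc.prems(2)])
    show "add_closed (subspace_power A I (Suc j))"
      by (rule add_closed_subspace) (simp add: subspace_power_def)
    fix u v assume "u \<in> words L" "v \<in> words L"
    then show "h (Fpow j u) * h (F v) \<in> subspace_power A I (Suc j)"
      using Suc F by (intro subspace_power_mult) auto
  qed
  finally show ?case .
qed

text \<open>
  The two summands form \<open>\<delta>(W)\<close>, since \<open>W\<close> has odd degree. Integrating \<open>D_integrand\<close> and \<open>partial_t_Fpow\<close>
  gives \<open>(k + 1) \<integral>\<delta>(F\<^sup>k \<star> s) = F(1)\<^sup>k\<^sup>+\<^sup>1 - F(0)\<^sup>k\<^sup>+\<^sup>1\<close> up to commutators.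
\<close>
theorem W_closed:
  assumes w: "w \<in> words L"
  shows "der A (W A L s k w) + Q_transpose L (W A L s k) w \<in> trace_kernel A I k"
proof -
  \<comment> \<open>\<open>F\<^sup>k\<^sup>+\<^sup>1\<close> has degree at most \<open>2 k + 2\<close> in \<open>t\<close>, so its derivative has degree at most \<open>2 k + 1\<close>.\<close>
  let ?U = "trace_kernel A I k" and ?N = "2 * k + 1"
  let ?Y = "D (2 * int k + 1) (integrand k) w" and ?Z = "conv 0 (Fpow k) (\<lambda>u. partial_t (F u)) w"
  note U = subspace_trace_kernel[of k]
  have "integral_to ?N (partial_t (Fpow (Suc k) w)) = (\<Sum>n\<le>2 * k + 2. Fpow (Suc k) w $ n) - Fpow (Suc k) w $ 0"
    by (simp add: integral_to_partial_t)
  also have "\<dots> \<in> ?U"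
  proof (rule subspace_diff[OF U])
    have "(\<Sum>n\<le>2 * k + 2. Fpow (Suc k) w $ n) \<in> subspace_power A I (Suc k)"
    proof (rule Fpow_value_mem[where N = "2 * k + 2" and h = "\<lambda>p. \<Sum>n\<le>2 * k + 2. p $ n"])
      show "(\<Sum>n\<le>2 * k + 2. (1 :: 'a fps) $ n) = 1" by simp
      fix u assume u: "u \<in> words L"
      have "(\<Sum>n\<le>2 * k + 2. F u $ n) = (\<Sum>n\<le>2. F u $ n)"
        by (rule sum.mono_neutral_right) (auto simp: F_nth_cases)
      also have "\<dots> = \<rho> u + \<delta>\<sigma> u + \<sigma>\<sigma> u"
        by (simp add: numeral_2_eq_2 F_nth)
      finally show "(\<Sum>n\<le>2 * k + 2. F u $ n) \<in> I" using curvature_mem_I[OF u] by simp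
    qed (use w in \<open>simp_all add: sum.distrib eval_one_mult del: sum.atMost_Suc\<close>)
    then show "(\<Sum>n\<le>2 * k + 2. Fpow (Suc k) w $ n) \<in> ?U"
      by (intro IA_subset_trace_kernel subspace_power_subset_IA)
    have "\<rho> u \<in> I" for u
      by (simp add: \<rho>_def const_cochain_def curv_I subspace_0[OF subspace_I])
    then have "Fpow (Suc k) w $ 0 \<in> subspace_power A I (Suc k)"
      using w by (intro Fpow_value_mem[where N = "2 * k + 2" and h = "\<lambda>p. p $ 0"]) (simp_all add: F_nth)
    then show "Fpow (Suc k) w $ 0 \<in> ?U"
      by (intro IA_subset_trace_kernel subspace_power_subset_IA)
  qed
  finally have 1: "integral_to ?N (partial_t (Fpow (Suc k) w)) \<in> ?U" .
  have "partial_t (Fpow (Suc k) w) - Abs_fps (\<lambda>n. scal A (of_nat (Suc k)) (?Z $ n)) \<in> commutators_t"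
    using partial_t_Fpow[OF w, of k 0] by (simp add: conv_Fpow_0)
  then have "integral_to ?N (partial_t (Fpow (Suc k) w) - Abs_fps (\<lambda>n. scal A (of_nat (Suc k)) (?Z $ n))) \<in> ?U"
    by (intro commutators_subset_trace_kernel integral_to_commutators_t)
  moreover have "integral_to ?N (p - q) = integral_to ?N p - integral_to ?N q" for p q
    by (rule additive_signed(4)[of "integral_to ?N", OF integral_to_add])
  note int_diff = this
  moreover have "integral_to ?N (Abs_fps (\<lambda>n. scal A c (p $ n))) = scal A c (integral_to ?N p)" for c p
    by (simp add: integral_to_def scale_sum_right mult.commute del: sum.atMost_Suc)
  ultimately have "integral_to ?N (partial_t (Fpow (Suc k) w)) - scal A (of_nat (Suc k)) (integral_to ?N ?Z) \<in> ?U"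
    by simp
  from subspace_diff[OF U 1 this] have "scal A (of_nat (Suc k)) (integral_to ?N ?Z) \<in> ?U" by simp
  from subspace_scale[OF U this, of "1 / of_nat (Suc k)"] have 2: "integral_to ?N ?Z \<in> ?U"
    by (simp del: of_nat_Suc)
  have "integral_to ?N ?Y - integral_to ?N ?Z \<in> ?U"
    unfolding int_diff[symmetric] using D_integrand[OF w] by (intro commutators_subset_trace_kernel integral_to_commutators_t)
  from subspace_add[OF U this 2] have Y: "integral_to ?N ?Y \<in> ?U" by simp
  let ?h = "\<lambda>p. scal A (1 / fact k) (integral_to ?N p)"
  have h_add: "?h (p + q) = ?h p + ?h q" for p q by (simp add: integral_to_add scale_right_distrib)
  have W: "W A L s k u = ?h (integrand k u)" for u by (rule W_eq_integral) simp
  have "?h (Q_transpose L (integrand k) w) = Q_transpose L (W A L s k) w"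
    by (rule Q_transpose_map[where h = ?h, OF dgla h_add W[symmetric] w])
  moreover have "?h (der_coeff p) = der A (?h p)" for p
    by (simp add: integral_to_def der_coeff_nth der.scale der.sum del: sum.atMost_Suc)
  ultimately have "?h ?Y = der A (W A L s k w) + Q_transpose L (W A L s k) w"
    by (simp add: cdelta_def signed_def integral_to_add scale_right_distrib W)
  then show ?thesis using subspace_scale[OF U Y, of "1 / fact k"] by simp
qed

text \<open>
  \<open>F\<close> lives on words of at most two letters and \<open>s\<close> on single letters.
\<close>
lemma W_vanish:
  assumes w: "w \<in> words L" and len: "length w \<ge> 2 * k + 2"
  shows "W A L s k w = 0"
proof -
  have F: "F u = 0" if u: "u \<in> words L" "length u \<ge> 3" for u
  proof -
    have "\<sigma>\<sigma> u \<in> {0}" unfolding \<sigma>\<sigma>_def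
    proof (rule conv_mem[OF _ _ u(1)])
      fix u1 u2 :: "'l word" assume "length u1 + length u2 = length u"
      then have "length u1 \<ge> 2 \<or> length u2 \<ge> 2" using u by auto
      then show "\<sigma> u1 * \<sigma> u2 \<in> {0}" by (auto simp: \<sigma>_def linear_cochain_def split: list.split)
    qed (simp add: add_closed_def)
    then show ?thesis using u
      by (auto simp: fps_eq_iff F_nth_cases \<rho>_def const_cochain_def \<delta>\<sigma>_eq \<sigma>_def linear_cochain_def Q\<sigma>_def
         der.zero split: list.split)
  qed
  have Fpow: "Fpow j u = 0" if "u \<in> words L" "length u \<ge> 2 * j + 1" for j u
    using that
  proof (induction j arbitrary: u)
    case 0
    then show ?case by (cases u) (simp_all add: Fpow_0 const_cochain_def)
  next
    case (Suc j)
    have "conv 2 (Fpow j) F u \<in> {0}"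
    proof (rule conv_mem[OF _ _ Suc.prems(1)])
      fix u1 u2 :: "'l word" assume u12: "u1 \<in> words L" "u2 \<in> words L" "length u1 + length u2 = length u"
      then have "length u1 \<ge> 2 * j + 1 \<or> length u2 \<ge> 3" using Suc.prems by auto
      then show "Fpow j u1 * F u2 \<in> {0}" using Suc.IH F u12 by auto
    qed (simp add: add_closed_def)
    then show ?case by (simp add: Fpow_Suc)
  qed
  have "integrand k w \<in> {0}" unfolding integrand_def
  proof (rule conv_mem[OF _ _ w])
    fix u1 u2 :: "'l word" assume u12: "u1 \<in> words L" "u2 \<in> words L" "length u1 + length u2 = length w"
    then have "length u1 \<ge> 2 * k + 1 \<or> length u2 \<ge> 2" using len by auto
    moreover have "S u2 = 0" if "length u2 \<ge> 2"
      using that by (auto simp: fps_eq_iff S_nth \<sigma>_def linear_cochain_def split: list.split)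
    ultimately show "Fpow k u1 * S u2 \<in> {0}" using Fpow u12 by auto
  qed (simp add: add_closed_def)
  then show ?thesis by (simp add: W_eq_integral[OF order_refl] integral_to_def)
qed

lemma Fpow_Nil: "Fpow j [] = fps_const (curv A ^ j)"
proof (induction j)
  case 0
  show ?case by (simp add: Fpow_0 const_cochain_def)
next
  case (Suc j)
  have "F [] = fps_const (curv A)"
    by (auto simp: fps_eq_iff F_nth_cases \<rho>_def const_cochain_def \<delta>\<sigma>_eq \<sigma>\<sigma>_def conv_Nil der.zero)
  then show ?case by (simp add: Fpow_Suc conv_Nil Suc power_commutes)
qed

lemma W_Nil: "W A L s k [] = 0"
proof -
  have "S [] = 0" by (simp add: fps_eq_iff S_nth)
  then show ?thesis by (simp add: W_eq_integral[OF order_refl] integral_to_def integrand_def conv_Nil)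
qed

lemma W_singleton: "W A L s k [x] = scal A (1 / fact k) (curv A ^ k * s (snd x))"
proof -
  have "S [] = 0" by (simp add: fps_eq_iff S_nth)
  moreover have "S [x] = fps_const (s (snd x))" by (auto simp: fps_eq_iff S_nth)
  ultimately have "integrand k [x] = fps_const (curv A ^ k * s (snd x))"
    by (simp add: integrand_def conv_Cons conv_Nil Fpow_Nil)
  then have "integral_to (2 * k) (integrand k [x]) = (\<Sum>n\<le>2 * k. if n = 0 then curv A ^ k * s (snd x) else 0)"
    unfolding integral_to_def by (intro sum.cong) auto
  then show ?thesis by (simp add: W_eq_integral[OF order_refl])
qed

end

section \<open>The \<open>L\<^sub>\<infinity>\<close> morphism\<close>

theorem corollary4p10:
  fixes A :: "('k::field_char_0, 'a::{ring, monoid_mult}) cdga"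
    and I :: "'a set"
    and k :: nat
    and s :: "'a set \<Rightarrow> 'a"
  defines "B \<equiv> quotient_dgla A I"
    and "M \<equiv> trace_complex A I k"
    and "tr \<equiv> (\<lambda>a. a +o trace_kernel A I k)"
  assumes "curved_dg_algebra A"
    and "curved_Lie_ideal A I"
    and "graded_linear 0 B (gvs_of A) s"
    and "\<forall>n. \<forall>b\<in>gpart B n. s b +o I = b"
  shows "W A B s k \<in> Hom_S (2 * int k + 1) B (gvs_of A) \<and>
    Linf_morphism_abelian B M (\<lambda>xs. tr (W A B s k xs)) \<and>
    (\<forall>xs\<in>words B. length xs \<ge> 2 * k + 2 \<longrightarrow> tr (W A B s k xs) = gzero M) \<and>
    (\<forall>n. \<forall>b\<in>gpart B n. \<forall>x. x +o I = b \<longrightarrow>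
       tr (W A B s k [(n, b)]) = gsmult M (1 / fact k) (tr (curv A ^ k * x)))"
proof -
  interpret curved_ideal A I by unfold_locales (fact assms)+
  note B_eq = B_def[symmetric]
  have s_gr: "s b \<in> gr A n" if "b \<in> gpart B n" for b n
    using assms(6) that by (auto simp: graded_linear_def gvs_of_def)
  have sec: "s b +o I = b" if "b \<in> gpart B n" for b n
    using assms(7) that by blast
  note dB = is_dgla_B[folded B_def]
  \<comment> \<open>The section \<open>s\<close> is a morphism modulo \<open>I\<close> because projecting \<open>s b\<close> gives back \<open>b\<close>.\<close>
  interpret chern_simons A I B s
  proof unfold_locales
    show "is_dgla B" by (rule dB)
    show "graded_linear 0 B (gvs_of A) s" by (rule assms)
    show "der A (s x) - s (gdiff B x) \<in> I" if x: "x \<in> gpart B n" for x n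
    proof -
      have "gdiff B x = der A (s x) +o I"
        using B_simps(5)[of "s x"] by (simp add: sec[OF x] B_def)
      then show ?thesis
        using sec[OF dgla_diff_closed[OF dB x]] by (simp flip: coset_eq_iff[OF subspace_I])
    qed
    show "s (gbracket B i j x y) - gcomm A i j (s x) (s y) \<in> I"
      if x: "x \<in> gpart B i" and y: "y \<in> gpart B j" for x y i j
    proof -
      have "gbracket B i j x y = gcomm A i j (s x) (s y) +o I"
        using B_bracket[OF s_gr[OF x] s_gr[OF y]] by (simp add: sec[OF x] sec[OF y] B_def)
      then show ?thesis
        using sec[OF dgla_bracket_closed[OF dB x y]] by (simp flip: coset_eq_iff[OF subspace_I])
    qed
  qed
  have M: "M = trace_complex A I k" and tr: "tr a = trace k a" for a
    by (simp_all add: M_def tr_def)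
  have zero: "gzero M = trace k 0" unfolding M by (rule M_simps)
  have H: "(\<lambda>xs. tr (W A B s k xs)) \<in> Hom_S 0 B (shift_gvs 1 M)"
  proof -
    note W = W_Hom_S[of k]
    have shift_gpart: "gpart (shift_gvs 1 M) n = trace k ` gr A (2 * int k + 1 + n)" for n
      by (simp add: shift_gvs_def M M_simps add.assoc)
    have "gadd (shift_gvs 1 M) = gadd (trace_complex A I k)"
      "gsmult (shift_gvs 1 M) = gsmult (trace_complex A I k)"
      by (simp_all add: shift_gvs_def M)
    note shift = this shift_gpart
    show ?thesis
      unfolding Hom_S_def tr
    proof (intro CollectI conjI ballI allI)
      show "trace k (W A B s k xs) \<in> gpart (shift_gvs 1 M) (0 + wdeg xs)" if "xs \<in> words B" for xs
        using Hom_S_degree[OF W that] by (simp add: shift)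
      fix us vs n x assume us: "us \<in> words B" and vs: "vs \<in> words B" and x: "x \<in> gpart B n"
      show "trace k (W A B s k (us @ (n, gadd B x y) # vs)) = gadd (shift_gvs 1 M)
          (trace k (W A B s k (us @ (n, x) # vs))) (trace k (W A B s k (us @ (n, y) # vs)))"
        if "y \<in> gpart B n" for y
        unfolding Hom_S_add[OF W us vs x that] shift M_simps ..
      show "trace k (W A B s k (us @ (n, gsmult B c x) # vs)) =
          gsmult (shift_gvs 1 M) c (trace k (W A B s k (us @ (n, x) # vs)))" for c
        unfolding Hom_S_scale[OF W us vs x] shift M_simps ..
      show "trace k (W A B s k (us @ (n, x) # (m, y) # vs)) = gsmult (shift_gvs 1 M)
          ((-1) powi ((n - 1) * (m - 1))) (trace k (W A B s k (us @ (m, y) # (n, x) # vs)))"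
        if "y \<in> gpart B m" for m y
        unfolding shift M_simps scale_powi_minus_one Hom_S_swap[OF W us vs x that] ..
    qed
  qed
  have "Linf_morphism_abelian B M (\<lambda>xs. tr (W A B s k xs))"
    unfolding Linf_morphism_abelian_def
  proof (intro conjI allI ballI H dB)
    show "is_dgla M" unfolding M by (rule is_dgla_M)
    show "gbracket M i j x y = gzero M" for i j x y unfolding M M_simps ..
    show "tr (W A B s k []) = gzero M" by (simp add: W_Nil tr zero)
    fix xs assume xs: "xs \<in> words B"
    have "comp_Q B M (\<lambda>xs. tr (W A B s k xs)) xs = trace k (Q_transpose B (W A B s k) xs)"
      unfolding M tr comp_Q_trace gvs_of_eq comp_Q_eq_Q_transpose[OF dB W_Hom_S xs] ..
    moreover have "gsmult M (-1) (gdiff M (tr (W A B s k xs))) = trace k (- der A (W A B s k xs))"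
      unfolding M tr M_simps by simp
    moreover have "- der A (W A B s k xs) - Q_transpose B (W A B s k) xs \<in> trace_kernel A I k"
      using subspace_neg[OF subspace_trace_kernel W_closed[OF xs, of k]] by (simp add: algebra_simps)
    ultimately show "gsmult M (-1) (gdiff M (tr (W A B s k xs))) = comp_Q B M (\<lambda>xs. tr (W A B s k xs)) xs"
      by (simp add: trace_eq_iff)
  qed
  moreover have "tr (W A B s k [(n, b)]) = gsmult M (1 / fact k) (tr (curv A ^ k * x))"
    if b: "b \<in> gpart B n" and x: "x +o I = b" for n b x
  proof -
    have "s b +o I = x +o I" using sec[OF b] x by simp
    then have "s b - x \<in> I" by (simp add: coset_eq_iff[OF subspace_I])
    have "curv A ^ j \<in> subspace_power A I j" for j
      by (induction j) (simp_all add: subspace_power_0 subspace_power_mult_left curv_I)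
    then have "curv A ^ k * (s b - x) \<in> subspace_power A I (Suc k)"
      using \<open>s b - x \<in> I\<close> by (rule subspace_power_mult)
    then have "scal A (1 / fact k) (curv A ^ k * (s b - x)) \<in> trace_kernel A I k"
      by (intro subspace_scale[OF subspace_trace_kernel] IA_subset_trace_kernel subspace_power_subset_IA)
    then show ?thesis
      unfolding tr M M_simps W_singleton trace_eq_iff
      by (simp add: right_diff_distrib scale_right_diff_distrib)
  qed
  ultimately show ?thesis
    using W_Hom_S W_vanish by (auto simp: gvs_of_eq tr zero)
qed

end
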